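(* Let $m,n,p\in\mathbb{N}$ with $q:=m-p+2>0$, let $\gamma,A,B\in\mathbb{C}$, let $l\in\mathbb{N}$, let $\alpha\in\mathbb{C}$ satisfy $\alpha(\alpha-A+1)=-B$, and put $$a=-\frac{\alpha+l}{q},\qquad b=\frac{1+\alpha-A-l}{q},\qquad c=\frac{n+\gamma+1}{n+2}.$$ Suppose that $\gamma$ is not a negative integer and that $c$, $c-a-b$, $a-b\notin\mathbb{Z}$. Let $$U_l(t,x)=x^lF(a,b,c,z),\qquad z=\left(\frac{q}{n+2}\right)^2\frac{t^{n+2}}{x^{q}},$$ be the solution of the Cauchy problem $L_\gamma U_l=0$, $U_l(0,x)=x^l$, $\partial_tU_l(0,x)=0$. Depending on the parameters, $U_l$ may be holomorphic across some parts of $K=K_1\cup K_2$: 1. When $a\in-\mathbb{N}$: (a) $U_l$ is holomorphic on $K_1$ if and only if $l+aq\in\mathbb{N}$; (b) $U_l$ is always holomorphic on $K_2$. 2. When $b\in-\mathbb{N}$: (a) $U_l$ is holomorphic on $K_1$ if and only if $l+bq\in\mathbb{N}$; (b) $U_l$ is always holomorphic on $K_2$. 3. When $c-a\in-\mathbb{N}$: (a) $U_l$ is holomorphic on $K_1$ if and only if $l+bq\in\mathbb{N}$; (b) $U_l$ is always ramified around $K_2$. 4. When $c-b\in-\mathbb{N}$: (a) $U_l$ is holomorphic on $K_1$ if and only if $l+aq\in\mathbb{N}$; (b) $U_l$ is always ramified around $K_2$. 5. When $a,b,c-a,c-b\notin-\mathbb{N}$: (a) $U_l$ is holomorphic on $K_1$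 if and only if $-\alpha\in\mathbb{N}$ and $1+\alpha-A\in\mathbb{N}$; (b) $U_l$ is always ramified around $K_2$.
   Context: $\mathbb{N}=\{0,1,2,\dots\}$. The operator $L_\gamma$ is $$L_\gamma u:=x^mL_1(t,\partial_t)u-t^nx^{p-2}L_2(x,\partial_x)u,$$ where $L_1(t,\partial_t)=\partial_t^2+\frac{\gamma}{t}\partial_t$ and $L_2(x,\partial_x)=x^2\partial_x^2+Ax\partial_x+B$, with $(t,x)\in\mathbb{C}^2$. The characteristic curves are $$K_1:\ x=0,\qquad K_2:\ x^{q}-\left(\frac{q}{n+2}\right)^2t^{n+2}=0.$$ For $r>0$, $\Omega_r=\{(t,x)\in\mathbb{C}^2:\ |x^{q}-(\frac{q}{n+2})^2t^{n+2}|<r\}$, and $U_l$ is regarded as a holomorphic function on the universal covering space $\mathcal{R}(\Omega_r-K)$, i.e. as a multivalued function on $\Omega_r-K$ obtained by analytic continuation. $F(a,b,c,z)$ is the Gauss hypergeometric function, defined for $c\notin-\mathbb{N}$ by analytic continuation of the sum of the series $\sum_{i=0}^{\infty}\frac{(a)_i(b)_i}{(c)_i\,i!}z^i$, with $(\lambda)_i=\lambda(\lambda+1)\cdots(\lambda+i-1)$; its principal branch is defined on $|\arg(1-z)|<\pi$. *)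

theory Defs
  imports "HOL-Analysis.Analysis"
begin

section \<open>Holomorphic functions of two complex variables and analytic continuation\<close>

definition holo2_on :: "(complex \<times> complex \<Rightarrow> complex) \<Rightarrow> (complex \<times> complex) set \<Rightarrow> bool"
  where "holo2_on f S \<longleftrightarrow>
    (\<forall>P\<in>S. \<exists>d\<^sub>1 d\<^sub>2. (f has_derivative (\<lambda>(h, k). d\<^sub>1 * h + d\<^sub>2 * k)) (at P))"

text \<open>Germs are represented by functions on the whole space; two functions have the same germ
  at \<open>P\<close> iff they agree on a neighbourhood of \<open>P\<close>.\<close>

definition same_germ ::
  "complex \<times> complex \<Rightarrow> (complex \<times> complex \<Rightarrow> complex) \<Rightarrow> (complex \<times> complex \<Rightarrow> complex) \<Rightarrow> bool"
  where "same_germ P f g \<longleftrightarrow> (\<forall>\<^sub>F Q in nhds P. f Q = g Q)"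

text \<open>\<open>continues_along W \<gamma> f g\<close>: the germ of \<open>f\<close> at the start of the path \<open>\<gamma>\<close> in \<open>W\<close> has an
  analytic continuation along \<open>\<gamma>\<close>, and the resulting germ at the end of \<open>\<gamma>\<close> is that of \<open>g\<close>.
  Here \<open>F s\<close> represents the continued germ at \<open>\<gamma> s\<close>.\<close>

definition continues_along ::
  "(complex \<times> complex) set \<Rightarrow> (real \<Rightarrow> complex \<times> complex) \<Rightarrow>
   (complex \<times> complex \<Rightarrow> complex) \<Rightarrow> (complex \<times> complex \<Rightarrow> complex) \<Rightarrow> bool"
  where "continues_along W \<gamma> f g \<longleftrightarrow>
    path \<gamma> \<and> path_image \<gamma> \<subseteq> W \<and>
    (\<exists>F :: real \<Rightarrow> complex \<times> complex \<Rightarrow> complex.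
       same_germ (pathstart \<gamma>) (F 0) f \<and> same_germ (pathfinish \<gamma>) (F 1) g \<and>
       (\<forall>s\<in>{0..1}. \<exists>\<epsilon>>0. holo2_on (F s) (ball (\<gamma> s) \<epsilon>) \<and>
          (\<exists>\<delta>>0. \<forall>s'\<in>{0..1}. \<bar>s' - s\<bar> < \<delta> \<longrightarrow>
             \<gamma> s' \<in> ball (\<gamma> s) \<epsilon> \<and> same_germ (\<gamma> s') (F s') (F s))))"

text \<open>The multivalued function on \<open>W\<close> generated by a function \<open>f\<close> that is holomorphic on \<open>D\<close>:
  \<open>g\<close> represents one of its branches at \<open>Q\<close>. Only paths along which the continuation exists
  contribute. (For \<open>U\<close> below, branches other than the initial one may fail to continue
  across \<open>t = 0\<close>, where the operator is singular.)\<close>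

definition branch_at ::
  "(complex \<times> complex) set \<Rightarrow> (complex \<times> complex) set \<Rightarrow> (complex \<times> complex \<Rightarrow> complex) \<Rightarrow>
   complex \<times> complex \<Rightarrow> (complex \<times> complex \<Rightarrow> complex) \<Rightarrow> bool"
  where "branch_at W D f Q g \<longleftrightarrow>
    (\<exists>\<gamma>. pathstart \<gamma> \<in> D \<and> pathfinish \<gamma> = Q \<and> continues_along W \<gamma> f g)"

text \<open>For the multivalued function on \<open>\<Omega> - K\<close> generated by \<open>f\<close> on \<open>D \<inter> \<Omega>\<close>: at a point \<open>P\<close> of \<open>K\<close>,
  being holomorphic means that all branches near \<open>P\<close> extend holomorphically to a full neighbourhood
  of \<open>P\<close>; being ramified means that arbitrarily close to \<open>P\<close> some branch is changed by
  continuation along some closed path.\<close>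

definition holomorphic_across ::
  "(complex \<times> complex) set \<Rightarrow> (complex \<times> complex) set \<Rightarrow> (complex \<times> complex) set \<Rightarrow>
   (complex \<times> complex \<Rightarrow> complex) \<Rightarrow> complex \<times> complex \<Rightarrow> bool"
  where "holomorphic_across \<Omega> K D f P \<longleftrightarrow>
    (\<exists>V. open V \<and> P \<in> V \<and> V \<subseteq> \<Omega> \<and>
      (\<forall>Q\<in>V - K. \<forall>g. branch_at (\<Omega> - K) (D \<inter> \<Omega>) f Q g \<longrightarrow>
         (\<exists>h. holo2_on h V \<and> same_germ Q h g)))"

definition ramified_at ::
  "(complex \<times> complex) set \<Rightarrow> (complex \<times> complex) set \<Rightarrow> (complex \<times> complex) set \<Rightarrow>
   (complex \<times> complex \<Rightarrow> complex) \<Rightarrow> complex \<times> complex \<Rightarrow> bool"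
  where "ramified_at \<Omega> K D f P \<longleftrightarrow>
    (\<forall>V. open V \<and> P \<in> V \<and> V \<subseteq> \<Omega> \<longrightarrow>
      (\<exists>Q\<in>V - K. \<exists>g \<gamma> g'. branch_at (\<Omega> - K) (D \<inter> \<Omega>) f Q g \<and>
         pathstart \<gamma> = Q \<and> pathfinish \<gamma> = Q \<and>
         continues_along (V - K) \<gamma> g g' \<and> \<not> same_germ Q g' g))"


section \<open>The operator, the characteristic curves and the Cauchy problem\<close>

text \<open>Points are pairs \<open>(t, x)\<close>. The exponent \<open>p - 2\<close> may be negative, and \<open>\<gamma> / t\<close> is only
  meaningful for \<open>t \<noteq> 0\<close>.\<close>

definition L_op ::
  "nat \<Rightarrow> nat \<Rightarrow> nat \<Rightarrow> complex \<Rightarrow> complex \<Rightarrow> complex \<Rightarrow>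
   (complex \<times> complex \<Rightarrow> complex) \<Rightarrow> complex \<Rightarrow> complex \<Rightarrow> complex"
  where "L_op m n p \<gamma> A B u t x =
    x ^ m * ((deriv ^^ 2) (\<lambda>s. u (s, x)) t + \<gamma> / t * deriv (\<lambda>s. u (s, x)) t)
    - t ^ n * x powi (int p - 2) *
      (x\<^sup>2 * (deriv ^^ 2) (\<lambda>y. u (t, y)) x + A * x * deriv (\<lambda>y. u (t, y)) x + B * u (t, x))"

definition K\<^sub>1 :: "(complex \<times> complex) set"
  where "K\<^sub>1 = {(t, x). x = 0}"

definition K\<^sub>2 :: "nat \<Rightarrow> nat \<Rightarrow> (complex \<times> complex) set"
  where "K\<^sub>2 n q = {(t, x). x ^ q - (of_nat q / of_nat (n + 2))\<^sup>2 * t ^ (n + 2) = 0}"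

definition \<Omega> :: "nat \<Rightarrow> nat \<Rightarrow> real \<Rightarrow> (complex \<times> complex) set"
  where "\<Omega> n q r = {(t, x). norm (x ^ q - (of_nat q / of_nat (n + 2))\<^sup>2 * t ^ (n + 2)) < r}"

definition z_var :: "nat \<Rightarrow> nat \<Rightarrow> complex \<Rightarrow> complex \<Rightarrow> complex"
  where "z_var n q t x = (of_nat q / of_nat (n + 2))\<^sup>2 * (t ^ (n + 2) / x ^ q)"

text \<open>The region where \<open>U\<close> is given by the convergent hypergeometric series; it contains the
  points \<open>(0, x)\<close> with \<open>x \<noteq> 0\<close> and does not meet the characteristic curves.\<close>

definition initial_region :: "nat \<Rightarrow> nat \<Rightarrow> (complex \<times> complex) set"
  where "initial_region n q = {(t, x). x \<noteq> 0 \<and> norm (z_var n q t x) < 1}"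

text \<open>Sum of the Gauss series, meaningful for \<open>norm z < 1\<close> only. Its analytic continuation enters
  through that of \<open>U\<close>.\<close>

definition gauss_F :: "complex \<Rightarrow> complex \<Rightarrow> complex \<Rightarrow> complex \<Rightarrow> complex"
  where "gauss_F a b c z =
    (\<Sum>i. pochhammer a i * pochhammer b i / (pochhammer c i * fact i) * z ^ i)"

definition U_sol ::
  "nat \<Rightarrow> nat \<Rightarrow> nat \<Rightarrow> complex \<Rightarrow> complex \<Rightarrow> complex \<Rightarrow> complex \<times> complex \<Rightarrow> complex"
  where "U_sol n q l a b c = (\<lambda>(t, x). x ^ l * gauss_F a b c (z_var n q t x))"

definition solves_cauchy_problem ::
  "nat \<Rightarrow> nat \<Rightarrow> nat \<Rightarrow> complex \<Rightarrow> complex \<Rightarrow> complex \<Rightarrow> nat \<Rightarrow>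
   (complex \<times> complex) set \<Rightarrow> (complex \<times> complex \<Rightarrow> complex) \<Rightarrow> bool"
  where "solves_cauchy_problem m n p \<gamma> A B l D u \<longleftrightarrow>
    holo2_on u D \<and>
    (\<forall>(t, x)\<in>D. t \<noteq> 0 \<longrightarrow> L_op m n p \<gamma> A B u t x = 0) \<and>
    (\<forall>x. (0, x) \<in> D \<longrightarrow> u (0, x) = x ^ l \<and> deriv (\<lambda>s. u (s, x)) 0 = 0)"


section \<open>Behaviour on the characteristic curves\<close>

text \<open>The curves meet exactly at the origin. Behaviour on one curve refers to its points
  off the other one: for instance \<open>U\<close> may be holomorphic on \<open>K\<^sub>1 - {(0, 0)}\<close> and yet ramified
  around \<open>K\<^sub>2\<close>, hence not holomorphic at the origin.\<close>

definition holomorphic_on_K\<^sub>1 ::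
  "nat \<Rightarrow> nat \<Rightarrow> real \<Rightarrow> (complex \<times> complex \<Rightarrow> complex) \<Rightarrow> bool"
  where "holomorphic_on_K\<^sub>1 n q r u \<longleftrightarrow>
    (\<forall>P \<in> (K\<^sub>1 - K\<^sub>2 n q) \<inter> \<Omega> n q r.
       holomorphic_across (\<Omega> n q r) (K\<^sub>1 \<union> K\<^sub>2 n q) (initial_region n q) u P)"

definition holomorphic_on_K\<^sub>2 ::
  "nat \<Rightarrow> nat \<Rightarrow> real \<Rightarrow> (complex \<times> complex \<Rightarrow> complex) \<Rightarrow> bool"
  where "holomorphic_on_K\<^sub>2 n q r u \<longleftrightarrow>
    (\<forall>P \<in> (K\<^sub>2 n q - K\<^sub>1) \<inter> \<Omega> n q r.
       holomorphic_across (\<Omega> n q r) (K\<^sub>1 \<union> K\<^sub>2 n q) (initial_region n q) u P)"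

definition ramified_around_K\<^sub>2 ::
  "nat \<Rightarrow> nat \<Rightarrow> real \<Rightarrow> (complex \<times> complex \<Rightarrow> complex) \<Rightarrow> bool"
  where "ramified_around_K\<^sub>2 n q r u \<longleftrightarrow>
    (\<forall>P \<in> (K\<^sub>2 n q - K\<^sub>1) \<inter> \<Omega> n q r.
       ramified_at (\<Omega> n q r) (K\<^sub>1 \<union> K\<^sub>2 n q) (initial_region n q) u P)"

end

theory Submission
  imports Defs "HOL-Complex_Analysis.Complex_Analysis"
begin

text \<open>
  With \<open>z = (q/(n+2))\<^sup>2 t\<^sup>n\<^sup>+\<^sup>2 / x\<^sup>q\<close>, the solution is \<open>U = x\<^sup>l f(z)\<close>, where \<open>f\<close> is the Gauss function, and the
  curves \<open>x = 0\<close> and \<open>z = 1\<close> correspond to the singular points \<open>\<infinity>\<close> and \<open>1\<close> of the hypergeometric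
  equation. Everything follows from the behaviour of the continuations of \<open>f\<close> at these two points.

  At \<open>\<infinity>\<close> the equation has local solutions \<open>z\<^sup>-\<^sup>a G\<^sub>1(1/z)\<close> and \<open>z\<^sup>-\<^sup>b G\<^sub>2(1/z)\<close>. Multiplied by \<open>x\<^sup>l\<close> they
  become holomorphic functions times \<open>x\<^bsup>l+aq\<^esup>\<close> and \<open>x\<^bsup>l+bq\<^esup>\<close>. Hence a combination extends across
  \<open>x = 0\<close> exactly when the exponent of every summand that really occurs in it is a natural number
  (\<open>holomorphic_on_K\<^sub>1I\<close>, \<open>K\<^sub>1_exponent\<close>). At \<open>1\<close> there are the holomorphic solution \<open>h\<close> and
  \<open>(1-z)\<^bsup>c-a-b\<^esup> k(z)\<close>, and \<open>U\<close> is ramified around \<open>z = 1\<close> as soon as the second one occurs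
  (\<open>ramified_around_K\<^sub>2I\<close>). It remains to see which summands occur.

  If \<open>a\<close> or \<open>b\<close> is in \<open>-\<nat>\<close>, then \<open>f\<close> is a polynomial. If \<open>c-a\<close> or \<open>c-b\<close> is, then \<open>f\<close> is
  \<open>(1-z)\<^bsup>c-a-b\<^esup>\<close> times a polynomial by Euler's transformation. In both cases only one exponent occurs
  at \<open>\<infinity>\<close> in any branch (\<open>elementary_K\<^sub>1_iff\<close>). In the remaining case all coefficients are nonzero. The
  usual argument reads this off from Gamma quotients; here it is obtained from the radius of convergence
  (\<open>gauss_connection\<close>). Write \<open>f = A h + B (1-z)\<^bsup>c-a-b\<^esup> k\<close> near \<open>1\<close>. If \<open>B = 0\<close>, then \<open>f\<close> is regular at \<open>1\<close>,
  although its series does not terminate and has radius \<open>1\<close>; this argument uses only that \<open>a\<close> and \<open>b\<close> are not in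
  \<open>-\<nat>\<close> and so proves the ramification in the Euler case as well. If \<open>A = 0\<close>, the same applies to the
  Gauss function with parameters \<open>c-a, c-b, c\<close>. If only one exponent \<open>e\<close> occurs at \<open>\<infinity>\<close>, then the
  continuations of \<open>f\<close> above and below the cut \<open>[1,\<infinity>)\<close> are proportional, and comparing them near \<open>1\<close>
  shows that \<open>A = 0\<close> or \<open>B = 0\<close>.

  Finally, statements about \<^emph>\<open>all\<close> branches of \<open>U\<close> require that continuation along an arbitrary path
  preserves the form \<open>x\<^sup>l y(z)\<close> with \<open>y\<close> in a given local system of germs on \<open>\<complex> - {0, 1}\<close>
  (\<open>branch_comes_from\<close>). This follows from the identity theorem in two variables, even for paths that meet
  \<open>t = 0\<close>.
\<close>

section \<open>The hypergeometric differential equation\<close>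

text \<open>
  The Gauss equation in the form that also makes sense at its singular points \<open>0\<close> and \<open>1\<close>, where it
  becomes a condition on the first two Taylor coefficients. Only open \<open>S\<close> are of interest.
\<close>

definition hg_sol :: "complex \<Rightarrow> complex \<Rightarrow> complex \<Rightarrow> (complex \<Rightarrow> complex) \<Rightarrow> complex set \<Rightarrow> bool"
  where "hg_sol a b c y S \<longleftrightarrow> y holomorphic_on S \<and>
    (\<forall>z\<in>S. z * (1 - z) * deriv (deriv y) z + (c - (a + b + 1) * z) * deriv y z - a * b * y z = 0)"

lemma hg_solI:
  assumes "open S"
    and 1: "\<And>z. z \<in> S \<Longrightarrow> (y has_field_derivative d1 z) (at z)"
    and 2: "\<And>z. z \<in> S \<Longrightarrow> (d1 has_field_derivative d2 z) (at z)"
    and eq: "\<And>z. z \<in> S \<Longrightarrow> z * (1 - z) * d2 z + (c - (a + b + 1) * z) * d1 z - a * b * y z = 0"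
  shows "hg_sol a b c y S"
proof -
  have d: "deriv y z = d1 z" if "z \<in> S" for z
    using 1[OF that] by (rule DERIV_imp_deriv)
  have dd: "deriv (deriv y) z = d2 z" if "z \<in> S" for z
  proof (rule DERIV_imp_deriv)
    show "(deriv y has_field_derivative d2 z) (at z)"
      by (rule has_field_derivative_transform_within_open[OF 2[OF that] assms(1) that])
        (simp add: d)
  qed
  have "y holomorphic_on S"
    using 1 assms(1) by (auto simp: holomorphic_on_open)
  then show ?thesis
    unfolding hg_sol_def using d dd eq by simp
qed

lemma hg_sol_has_derivs:
  assumes "open S" "hg_sol a b c y S" "z \<in> S"
  shows "(y has_field_derivative deriv y z) (at z)"
    and "(deriv y has_field_derivative deriv (deriv y) z) (at z)"
proof -
  have h: "y holomorphic_on S" using assms by (simp add: hg_sol_def)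
  show "(y has_field_derivative deriv y z) (at z)"
    using holomorphic_derivI[OF h assms(1) assms(3)] .
  show "(deriv y has_field_derivative deriv (deriv y) z) (at z)"
    using holomorphic_derivI[OF holomorphic_deriv[OF h assms(1)] assms(1) assms(3)] .
qed

lemma hg_sol_eq:
  "hg_sol a b c y S \<Longrightarrow> z \<in> S \<Longrightarrow>
    z * (1 - z) * deriv (deriv y) z + (c - (a + b + 1) * z) * deriv y z - a * b * y z = 0"
  by (simp add: hg_sol_def)

lemma hg_sol_holo: "hg_sol a b c y S \<Longrightarrow> y holomorphic_on S"
  by (simp add: hg_sol_def)

lemma hg_sol_subset: "hg_sol a b c y S \<Longrightarrow> T \<subseteq> S \<Longrightarrow> hg_sol a b c y T"
  unfolding hg_sol_def using holomorphic_on_subset by blast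

lemma hg_sol_cong:
  assumes "hg_sol a b c y S" "open S" "\<And>z. z \<in> S \<Longrightarrow> y z = y' z"
  shows "hg_sol a b c y' S"
proof (rule hg_solI[OF assms(2)])
  fix z assume z: "z \<in> S"
  show "(y' has_field_derivative deriv y z) (at z)"
    by (rule has_field_derivative_transform_within_open[OF hg_sol_has_derivs(1)[OF assms(2,1) z] assms(2) z])
      (simp add: assms(3))
  show "(deriv y has_field_derivative deriv (deriv y) z) (at z)"
    by (rule hg_sol_has_derivs(2)[OF assms(2,1) z])
  show "z * (1 - z) * deriv (deriv y) z + (c - (a + b + 1) * z) * deriv y z - a * b * y' z = 0"
    using hg_sol_eq[OF assms(1) z] assms(3)[OF z] by simp
qed

lemma hg_sol_lincomb:
  assumes "hg_sol a b c y1 S" "hg_sol a b c y2 S" "open S"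
  shows "hg_sol a b c (\<lambda>z. k1 * y1 z + k2 * y2 z) S"
proof (rule hg_solI[OF assms(3)])
  fix z assume z: "z \<in> S"
  note [derivative_intros] = hg_sol_has_derivs[OF assms(3,1) z] hg_sol_has_derivs[OF assms(3,2) z]
  show "((\<lambda>z. k1 * y1 z + k2 * y2 z) has_field_derivative k1 * deriv y1 z + k2 * deriv y2 z) (at z)"
    by (auto intro!: derivative_eq_intros)
  show "((\<lambda>z. k1 * deriv y1 z + k2 * deriv y2 z) has_field_derivative
      k1 * deriv (deriv y1) z + k2 * deriv (deriv y2) z) (at z)"
    by (auto intro!: derivative_eq_intros)
  have "z * (1 - z) * (k1 * deriv (deriv y1) z + k2 * deriv (deriv y2) z) +
    (c - (a + b + 1) * z) * (k1 * deriv y1 z + k2 * deriv y2 z) - a * b * (k1 * y1 z + k2 * y2 z) =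
    k1 * (z * (1 - z) * deriv (deriv y1) z + (c - (a + b + 1) * z) * deriv y1 z - a * b * y1 z) +
    k2 * (z * (1 - z) * deriv (deriv y2) z + (c - (a + b + 1) * z) * deriv y2 z - a * b * y2 z)"
    by (simp add: algebra_simps)
  then show "z * (1 - z) * (k1 * deriv (deriv y1) z + k2 * deriv (deriv y2) z) +
    (c - (a + b + 1) * z) * (k1 * deriv y1 z + k2 * deriv y2 z) - a * b * (k1 * y1 z + k2 * y2 z) = 0"
    by (simp add: hg_sol_eq[OF assms(1) z] hg_sol_eq[OF assms(2) z])
qed

lemma deriv_lincomb:
  assumes "hg_sol a b c y1 S" "hg_sol a b c y2 S" "open S" "z \<in> S"
  shows "deriv (\<lambda>z. k1 * y1 z + k2 * y2 z) z = k1 * deriv y1 z + k2 * deriv y2 z"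
proof (rule DERIV_imp_deriv)
  note [derivative_intros] = hg_sol_has_derivs(1)[OF assms(3,1,4)] hg_sol_has_derivs(1)[OF assms(3,2,4)]
  show "((\<lambda>z. k1 * y1 z + k2 * y2 z) has_field_derivative k1 * deriv y1 z + k2 * deriv y2 z) (at z)"
    by (auto intro!: derivative_eq_intros)
qed

section \<open>Uniqueness of solutions\<close>

text \<open>
  At a zero, \<open>g = (z - z0)\<^sup>j\<^sup>+\<^sup>1 v\<close> with \<open>v(z0) \<noteq> 0\<close>. Dividing the equation by \<open>(z - z0)\<^sup>j\<close> and letting
  \<open>z\<close> tend to \<open>z0\<close> leaves \<open>(j + 1) v(z0) (j \<alpha>(z0) + \<beta>(z0)) = 0\<close>. The factor \<open>z - z0\<close> in front of the second
  derivative admits regular singular points; at an ordinary point one multiplies the equation by it.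
\<close>

lemma indicial_equation:
  fixes g \<alpha> \<beta> \<delta> :: "complex \<Rightarrow> complex"
  assumes g: "g holomorphic_on S" and S: "open S" "connected S" "z0 \<in> S"
    and ode: "\<And>z. z \<in> S \<Longrightarrow>
      (z - z0) * \<alpha> z * deriv (deriv g) z + \<beta> z * deriv g z + \<delta> z * g z = 0"
    and cont: "isCont \<alpha> z0" "isCont \<beta> z0" "isCont \<delta> z0"
    and g0: "g z0 = 0" and nz: "\<not> (\<forall>z\<in>S. g z = 0)"
  shows "\<exists>j::nat. of_nat j * \<alpha> z0 + \<beta> z0 = 0 \<and> (deriv g z0 = 0 \<longrightarrow> j > 0)"
proof -
  have "\<not> g constant_on S"
    using nz g0 S(3) unfolding constant_on_def by metis
  from holomorphic_factor_zero_nonconstant[OF g S g0 this]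
  obtain v r k where k: "0 < k" and r: "0 < r" and sub: "ball z0 r \<subseteq> S"
    and v: "v holomorphic_on ball z0 r"
    and gv: "\<And>w. w \<in> ball z0 r \<Longrightarrow> g w = (w - z0) ^ k * v w"
    and vnz: "\<And>w. w \<in> ball z0 r \<Longrightarrow> v w \<noteq> 0"
    by metis
  obtain j where j: "k = Suc j" using k by (cases k) auto
  define B where "B = ball z0 r"
  have opB: "open B" and z0B: "z0 \<in> B" using r by (auto simp: B_def)
  define v1 where "v1 = (\<lambda>w. of_nat (Suc j) * v w + (w - z0) * deriv v w)"
  have v1h: "v1 holomorphic_on B"
    unfolding v1_def using v opB by (auto intro!: holomorphic_intros simp: B_def)
  have dv: "(v has_field_derivative deriv v w) (at w)" if "w \<in> B" for w
    using holomorphic_derivI[OF v _ ] that by (simp add: B_def)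
  have dv1: "(v1 has_field_derivative deriv v1 w) (at w)" if "w \<in> B" for w
    using holomorphic_derivI[OF v1h opB that] .
  have dg: "deriv g w = (w - z0) ^ j * v1 w" if w: "w \<in> B" for w
  proof (rule DERIV_imp_deriv)
    have "((\<lambda>w. (w - z0) ^ k * v w) has_field_derivative (w - z0) ^ j * v1 w) (at w)"
      unfolding j v1_def
      by (rule derivative_eq_intros dv w refl | simp add: algebra_simps)+
    then show "(g has_field_derivative (w - z0) ^ j * v1 w) (at w)"
      by (rule has_field_derivative_transform_within_open[OF _ opB w]) (simp add: gv B_def)
  qed
  have ddg: "(w - z0) * deriv (deriv g) w = (w - z0) ^ j * (of_nat j * v1 w + (w - z0) * deriv v1 w)"
    if w: "w \<in> B" for w
  proof -
    have "((\<lambda>w. (w - z0) ^ j * v1 w) has_field_derivative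
        of_nat j * (w - z0) ^ (j - 1) * v1 w + (w - z0) ^ j * deriv v1 w) (at w)"
      by (rule derivative_eq_intros dv1 w refl | simp add: algebra_simps)+
    then have "(deriv g has_field_derivative
        of_nat j * (w - z0) ^ (j - 1) * v1 w + (w - z0) ^ j * deriv v1 w) (at w)"
      by (rule has_field_derivative_transform_within_open[OF _ opB w]) (simp add: dg)
    then have "deriv (deriv g) w = of_nat j * (w - z0) ^ (j - 1) * v1 w + (w - z0) ^ j * deriv v1 w"
      by (rule DERIV_imp_deriv)
    moreover have "(w - z0) * (of_nat j * (w - z0) ^ (j - 1)) = of_nat j * (w - z0) ^ j"
      by (cases j) simp_all
    ultimately show ?thesis
      by (simp only: distrib_left mult.assoc[symmetric]) (simp add: algebra_simps)
  qed
  define \<phi> where "\<phi> = (\<lambda>w. \<alpha> w * (of_nat j * v1 w + (w - z0) * deriv v1 w) + \<beta> w * v1 w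
      + \<delta> w * ((w - z0) * v w))"
  have "\<phi> w = 0" if "w \<in> B - {z0}" for w
  proof -
    have "(w - z0) ^ j * \<phi> w = \<alpha> w * ((w - z0) * deriv (deriv g) w) + \<beta> w * deriv g w + \<delta> w * g w"
    proof -
      have wB: "w \<in> B" using that by simp
      then have "w \<in> ball z0 r" by (simp add: B_def)
      show ?thesis
        unfolding ddg[OF wB] dg[OF wB] gv[OF \<open>w \<in> ball z0 r\<close>] j \<phi>_def
        by (simp add: algebra_simps)
    qed
    also have "\<dots> = 0"
      using ode[of w] that sub by (auto simp: B_def algebra_simps)
    finally show ?thesis using that by simp
  qed
  then have ev: "eventually (\<lambda>w. \<phi> w = 0) (at z0)"
    using opB z0B by (auto simp: eventually_at_topological)
  have c1: "isCont v z0" "isCont v1 z0" "isCont (deriv v1) z0"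
    using v v1h holomorphic_deriv[OF v1h opB] opB z0B
    by (auto simp: B_def dest!: holomorphic_on_imp_continuous_on continuous_on_interior)
  have "isCont \<phi> z0"
    unfolding \<phi>_def by (intro continuous_intros cont c1)
  then have "(\<phi> \<longlongrightarrow> \<phi> z0) (at z0)" by (simp add: isCont_def)
  moreover have "(\<phi> \<longlongrightarrow> 0) (at z0)"
    using ev by (rule tendsto_eventually)
  ultimately have "\<phi> z0 = 0" using tendsto_unique at_neq_bot by blast
  then have "of_nat (Suc j) * v z0 * (of_nat j * \<alpha> z0 + \<beta> z0) = 0"
    by (simp add: \<phi>_def v1_def algebra_simps)
  then have "of_nat j * \<alpha> z0 + \<beta> z0 = 0"
    using vnz[of z0] r by (simp del: of_nat_Suc)
  moreover have "j > 0" if "deriv g z0 = 0"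
  proof (rule ccontr)
    assume "\<not> j > 0"
    then have "deriv g z0 = v z0" using dg[OF z0B] by (simp add: v1_def)
    with that vnz[of z0] r show False by simp
  qed
  ultimately show ?thesis by blast
qed

text \<open>
  At an ordinary point the indicial equation is \<open>j = 0\<close>: the difference of two solutions can vanish there
  to first order only.
\<close>

lemma hg_unique:
  assumes y: "hg_sol a b c y1 S" "hg_sol a b c y2 S"
    and S: "open S" "connected S" "0 \<notin> S" "1 \<notin> S" "z0 \<in> S"
    and eq: "y1 z0 = y2 z0" "deriv y1 z0 = deriv y2 z0" and z: "z \<in> S"
  shows "y1 z = y2 z"
proof -
  define g where "g = (\<lambda>z. 1 * y1 z + (- 1) * y2 z)"
  have g: "hg_sol a b c g S" unfolding g_def by (rule hg_sol_lincomb[OF y S(1)])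
  have dg: "deriv g z0 = 0"
    unfolding g_def using eq by (subst deriv_lincomb[OF y S(1,5)]) simp
  have "\<forall>z\<in>S. g z = 0"
  proof (rule ccontr)
    assume nz: "\<not> (\<forall>z\<in>S. g z = 0)"
    have "\<exists>j::nat. of_nat j * (z0 * (1 - z0)) + (z0 - z0) * (c - (a + b + 1) * z0) = 0 \<and>
        (deriv g z0 = 0 \<longrightarrow> j > 0)"
    proof (rule indicial_equation[where \<alpha> = "\<lambda>z. z * (1 - z)" and \<beta> = "\<lambda>z. (z - z0) * (c - (a + b + 1) * z)"
          and \<delta> = "\<lambda>z. - (z - z0) * (a * b)", OF hg_sol_holo[OF g] S(1,2,5)])
      fix z assume "z \<in> S"
      have "(z - z0) * (z * (1 - z) * deriv (deriv g) z + (c - (a + b + 1) * z) * deriv g z - a * b * g z) = 0"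
        using hg_sol_eq[OF g \<open>z \<in> S\<close>] by simp
      then show "(z - z0) * (z * (1 - z)) * deriv (deriv g) z + (z - z0) * (c - (a + b + 1) * z) * deriv g z +
          - (z - z0) * (a * b) * g z = 0"
        by (simp add: algebra_simps)
    qed (use eq nz in \<open>auto simp: g_def intro!: continuous_intros\<close>)
    then show False using dg S by auto
  qed
  then show ?thesis using z by (auto simp: g_def)
qed

text \<open>
  At the singular point \<open>0\<close> the indicial equation is \<open>j + c = 0\<close>, so a single initial value
  determines a holomorphic solution.
\<close>

lemma hg_unique_at_0:
  assumes y: "hg_sol a b c y1 S" "hg_sol a b c y2 S"
    and S: "open S" "connected S" "0 \<in> S" and c: "c \<notin> \<int>\<^sub>\<le>\<^sub>0"
    and eq: "y1 0 = y2 0" and z: "z \<in> S"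
  shows "y1 z = y2 z"
proof -
  define g where "g = (\<lambda>z. 1 * y1 z + (- 1) * y2 z)"
  have g: "hg_sol a b c g S" unfolding g_def by (rule hg_sol_lincomb[OF y S(1)])
  have "\<forall>z\<in>S. g z = 0"
  proof (rule ccontr)
    assume nz: "\<not> (\<forall>z\<in>S. g z = 0)"
    have "\<exists>j::nat. of_nat j * (1 - 0) + (c - (a + b + 1) * 0) = 0 \<and>
        (deriv g 0 = 0 \<longrightarrow> j > 0)"
    proof (rule indicial_equation[where \<alpha> = "\<lambda>z. 1 - z" and \<beta> = "\<lambda>z. c - (a + b + 1) * z"
          and \<delta> = "\<lambda>z. - (a * b)", OF hg_sol_holo[OF g] S(1,2,3)])
      fix z assume "z \<in> S"
      show "(z - 0) * (1 - z) * deriv (deriv g) z + (c - (a + b + 1) * z) * deriv g z +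
          - (a * b) * g z = 0"
        using hg_sol_eq[OF g \<open>z \<in> S\<close>] by simp
    qed (use eq nz in \<open>auto simp: g_def intro!: continuous_intros\<close>)
    then obtain j :: nat where "c = - of_nat j" by (auto simp: add_eq_0_iff)
    with c show False by simp
  qed
  then show ?thesis using z by (auto simp: g_def)
qed

section \<open>Existence and continuation of solutions\<close>

text \<open>
  Integrating the bound along the segment gains the factor \<open>1/(k+1)\<close>, which gives the Picard iteration
  its factorial convergence.
\<close>

lemma norm_primitive_le:
  fixes G g :: "complex \<Rightarrow> complex"
  assumes der: "\<And>\<zeta>. \<zeta> \<in> closed_segment z0 z \<Longrightarrow> (G has_field_derivative g \<zeta>) (at \<zeta>)"
    and bd: "\<And>\<zeta>. \<zeta> \<in> closed_segment z0 z \<Longrightarrow> norm (g \<zeta>) \<le> C * norm (\<zeta> - z0) ^ k"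
    and G0: "G z0 = 0"
  shows "norm (G z) \<le> C * norm (z - z0) ^ Suc k / of_nat (Suc k)"
proof -
  define pt where "pt = (\<lambda>t::real. z0 + of_real t * (z - z0))"
  have seg: "pt t \<in> closed_segment z0 z" if "0 \<le> t" "t \<le> 1" for t
    using that by (auto simp: pt_def closed_segment_def scaleR_conv_of_real algebra_simps intro!: exI[of _ t])
  have d: "((\<lambda>t. G (pt t)) has_vector_derivative (z - z0) * g (pt t)) (at t)" if "0 \<le> t" "t \<le> 1" for t
  proof -
    have "(pt has_vector_derivative (z - z0)) (at t)"
      unfolding pt_def by (auto intro!: derivative_eq_intros)
    from field_vector_diff_chain_at[OF this der[OF seg[OF that]]]
    show ?thesis by (simp add: o_def)
  qed
  have "norm (G (pt 1) - G (pt 0)) \<le>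
    C * norm (z - z0) ^ Suc k * 1 ^ Suc k / of_nat (Suc k) - C * norm (z - z0) ^ Suc k * 0 ^ Suc k / of_nat (Suc k)"
  proof (rule differentiable_bound_general[where f = "\<lambda>t. G (pt t)"
        and \<phi> = "\<lambda>t. C * norm (z - z0) ^ Suc k * t ^ Suc k / of_nat (Suc k)"
        and f' = "\<lambda>t. (z - z0) * g (pt t)" and \<phi>' = "\<lambda>t. C * norm (z - z0) ^ Suc k * t ^ k"])
    show "continuous_on {0..1} (\<lambda>t. G (pt t))"
      by (intro continuous_at_imp_continuous_on ballI has_vector_derivative_continuous[OF d]) auto
    show "continuous_on {0..1} (\<lambda>t. C * norm (z - z0) ^ Suc k * t ^ Suc k / real (Suc k))"
      by (intro continuous_intros) auto
    fix t :: real assume t: "0 < t" "t < 1"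
    show "((\<lambda>t. G (pt t)) has_vector_derivative (z - z0) * g (pt t)) (at t)" using d t by simp
    show "((\<lambda>t. C * norm (z - z0) ^ Suc k * t ^ Suc k / real (Suc k)) has_vector_derivative
        C * norm (z - z0) ^ Suc k * t ^ k) (at t)"
      unfolding has_real_derivative_iff_has_vector_derivative[symmetric]
      by (rule derivative_eq_intros refl | simp add: field_simps del: power_Suc of_nat_Suc)+
    have "norm (g (pt t)) \<le> C * norm (pt t - z0) ^ k" using bd[OF seg] t by simp
    also have "norm (pt t - z0) = t * norm (z - z0)" using t by (simp add: pt_def norm_mult)
    finally have "norm (g (pt t)) \<le> C * (t * norm (z - z0)) ^ k" .
    then have "norm (z - z0) * norm (g (pt t)) \<le> norm (z - z0) * (C * (t * norm (z - z0)) ^ k)"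
      by (intro mult_left_mono) auto
    then show "norm ((z - z0) * g (pt t)) \<le> C * norm (z - z0) ^ Suc k * t ^ k"
      by (simp add: norm_mult power_mult_distrib mult_ac)
  qed auto
  then show ?thesis by (simp add: pt_def G0)
qed

text \<open>
  Picard iteration for the system \<open>y' = w\<close>, \<open>w' = P w + Q y\<close>, written as a series of increments \<open>Y k\<close>, \<open>W k\<close>.
  Convexity provides the primitives. On a compact convex set the increments are at most
  \<open>C M\<^sup>k \<bar>z - z0\<bar>\<^sup>k / k!\<close>, so the series may be differentiated term by term on all of \<open>S\<close>, not only near \<open>z0\<close>.
\<close>

lemma linear_ode_exists:
  fixes P Q :: "complex \<Rightarrow> complex"
  assumes S: "open S" "convex S" "z0 \<in> S"
    and PQ: "P holomorphic_on S" "Q holomorphic_on S"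
  obtains y w where "y z0 = u" "w z0 = v"
    and "\<And>z. z \<in> S \<Longrightarrow> (y has_field_derivative w z) (at z)"
    and "\<And>z. z \<in> S \<Longrightarrow> (w has_field_derivative P z * w z + Q z * y z) (at z)"
proof -
  define prim where "prim = (\<lambda>g. SOME G. G z0 = 0 \<and>
      (\<forall>z\<in>S. (G has_field_derivative g z) (at z)))"
  have prim: "prim g z0 = 0 \<and> (\<forall>z\<in>S. (prim g has_field_derivative g z) (at z))"
    if "g holomorphic_on S" for g
  proof -
    obtain G where G: "\<And>z. z \<in> S \<Longrightarrow> (G has_field_derivative g z) (at z within S)"
      using holomorphic_convex_primitive'[OF S(2,1) \<open>g holomorphic_on S\<close>] by metis
    then have "((\<lambda>z. G z - G z0) has_field_derivative g z) (at z)" if "z \<in> S" for z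
      using G[OF that] by (auto intro!: derivative_eq_intros simp: at_within_open[OF that S(1)])
    then have "\<exists>G. G z0 = 0 \<and> (\<forall>z\<in>S. (G has_field_derivative g z) (at z))"
      by (intro exI[of _ "\<lambda>z. G z - G z0"]) auto
    from someI_ex[OF this] show ?thesis unfolding prim_def .
  qed
  define YW where "YW = rec_nat ((\<lambda>_. u), (\<lambda>_. v))
     (\<lambda>k p. (prim (snd p), prim (\<lambda>z. P z * snd p z + Q z * fst p z)))"
  define Y where "Y k = fst (YW k)" for k
  define W where "W k = snd (YW k)" for k
  have Y0: "Y 0 = (\<lambda>_. u)" and W0: "W 0 = (\<lambda>_. v)" by (simp_all add: Y_def W_def YW_def)
  have YS: "Y (Suc k) = prim (W k)" and WS: "W (Suc k) = prim (\<lambda>z. P z * W k z + Q z * Y k z)" for k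
    by (simp_all add: Y_def W_def YW_def)
  have holo: "Y k holomorphic_on S \<and> W k holomorphic_on S" for k
  proof (induction k)
    case 0 then show ?case by (simp add: Y0 W0)
  next
    case (Suc k)
    then have "(\<lambda>z. P z * W k z + Q z * Y k z) holomorphic_on S"
      using PQ by (intro holomorphic_intros) auto
    from prim[OF this] prim[of "W k"] Suc show ?case
      unfolding YS WS by (auto simp: holomorphic_on_open S)
  qed
  have holo': "(\<lambda>z. P z * W k z + Q z * Y k z) holomorphic_on S" for k
    using PQ holo by (intro holomorphic_intros) auto
  define DY where "DY k = (case k of 0 \<Rightarrow> (\<lambda>_. 0) | Suc j \<Rightarrow> W j)" for k
  define DW where "DW k = (case k of 0 \<Rightarrow> (\<lambda>_. 0) | Suc j \<Rightarrow> (\<lambda>z. P z * W j z + Q z * Y j z))" for k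
  have derY: "(Y k has_field_derivative DY k z) (at z)" if "z \<in> S" for k z
    using prim[of "W (k - 1)"] holo that
    by (cases k) (auto simp: DY_def Y0 YS)
  have derW: "(W k has_field_derivative DW k z) (at z)" if "z \<in> S" for k z
    using prim[OF holo'[of "k - 1"]] that
    by (cases k) (auto simp: DW_def W0 WS)
  have Yz0: "Y (Suc k) z0 = 0" and Wz0: "W (Suc k) z0 = 0" for k
    using prim[of "W k"] prim[OF holo'[of k]] holo by (auto simp: YS WS)
  have loc: "\<exists>d h. 0 < d \<and> summable h \<and>
      (\<forall>k. \<forall>z\<in>ball z1 d \<inter> S. norm (Y k z) \<le> h k \<and> norm (W k z) \<le> h k)" if z1: "z1 \<in> S" for z1
  proof -
    obtain d where d: "d > 0" "cball z1 d \<subseteq> S"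
      using open_contains_cball[THEN iffD1, OF S(1)] z1 by blast
    \<comment> \<open>contains with every point the segment to \<open>z0\<close> along which the primitives are estimated\<close>
    define K where "K = convex hull (insert z0 (cball z1 d))"
    have K: "compact K" "K \<subseteq> S" "convex K" "z0 \<in> K" "cball z1 d \<subseteq> K"
      unfolding K_def using d S
      by (auto simp: compact_convex_hull intro!: hull_minimal hull_inc del: subsetI)
        (meson hull_subset insert_subset)+
    have "compact ((\<lambda>z. norm (P z) + norm (Q z) + 1) ` K)"
      using K PQ by (intro compact_continuous_image continuous_intros)
        (auto intro: continuous_on_subset holomorphic_on_imp_continuous_on)
    then have "bounded ((\<lambda>z. norm (P z) + norm (Q z) + 1) ` K)" by (rule compact_imp_bounded)
    then obtain M where "\<forall>x\<in>(\<lambda>z. norm (P z) + norm (Q z) + 1) ` K. \<bar>x\<bar> \<le> M"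
      unfolding bounded_real by blast
    then have M: "\<And>z. z \<in> K \<Longrightarrow> norm (P z) + norm (Q z) + 1 \<le> M" by fastforce
    have M1: "1 \<le> M" using M[OF K(4)] norm_ge_zero[of "P z0"] norm_ge_zero[of "Q z0"] by linarith
    obtain R where R: "\<And>z. z \<in> K \<Longrightarrow> norm (z - z0) \<le> R"
    proof -
      have "bounded ((\<lambda>z. z - z0) ` K)"
        using K(1) by (intro compact_imp_bounded compact_continuous_image continuous_intros)
      then show ?thesis using that unfolding bounded_iff by auto
    qed
    define C where "C = norm u + norm v"
    have C0: "C \<ge> 0" by (simp add: C_def)
    have bd: "z \<in> K \<Longrightarrow> norm (Y k z) \<le> C * M ^ k / fact k * norm (z - z0) ^ k \<and>
        norm (W k z) \<le> C * M ^ k / fact k * norm (z - z0) ^ k" for k z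
    proof (induction k arbitrary: z)
      case 0 then show ?case by (simp add: Y0 W0 C_def)
    next
      case (Suc k)
      have seg: "closed_segment z0 z \<subseteq> K"
        using K Suc.prems by (simp add: closed_segment_subset)
      define E where "E = C * M ^ Suc k / fact k"
      have step: "norm (G z) \<le> C * M ^ Suc k / fact (Suc k) * norm (z - z0) ^ Suc k"
        if "G z0 = 0" "\<And>\<zeta>. \<zeta> \<in> K \<Longrightarrow> (G has_field_derivative g \<zeta>) (at \<zeta>)"
          "\<And>\<zeta>. \<zeta> \<in> K \<Longrightarrow> norm (g \<zeta>) \<le> E * norm (\<zeta> - z0) ^ k" for G g
      proof -
        have "norm (G z) \<le> E * norm (z - z0) ^ Suc k / of_nat (Suc k)"
          by (rule norm_primitive_le[where g = g]) (use that seg in auto)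
        then show ?thesis by (simp add: E_def field_simps)
      qed
      have "norm (Y (Suc k) z) \<le> C * M ^ Suc k / fact (Suc k) * norm (z - z0) ^ Suc k"
      proof (rule step[where g = "W k"])
        fix \<zeta> assume "\<zeta> \<in> K"
        show "(Y (Suc k) has_field_derivative W k \<zeta>) (at \<zeta>)"
          using derY[of \<zeta> "Suc k"] \<open>\<zeta> \<in> K\<close> K by (auto simp: DY_def)
        have "norm (W k \<zeta>) \<le> C * M ^ k / fact k * norm (\<zeta> - z0) ^ k" using Suc.IH[OF \<open>\<zeta> \<in> K\<close>] by simp
        also have "\<dots> \<le> E * norm (\<zeta> - z0) ^ k"
        proof -
          have "C * M ^ k \<le> C * M ^ Suc k"
            using C0 power_increasing[OF _ M1, of k "Suc k"] by (intro mult_left_mono) auto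
          then show ?thesis
            unfolding E_def by (intro mult_right_mono divide_right_mono) auto
        qed
        finally show "norm (W k \<zeta>) \<le> E * norm (\<zeta> - z0) ^ k" .
      qed (simp add: Yz0)
      moreover have "norm (W (Suc k) z) \<le> C * M ^ Suc k / fact (Suc k) * norm (z - z0) ^ Suc k"
      proof (rule step[where g = "\<lambda>z. P z * W k z + Q z * Y k z"])
        fix \<zeta> assume "\<zeta> \<in> K"
        show "(W (Suc k) has_field_derivative P \<zeta> * W k \<zeta> + Q \<zeta> * Y k \<zeta>) (at \<zeta>)"
          using derW[of \<zeta> "Suc k"] \<open>\<zeta> \<in> K\<close> K by (auto simp: DW_def)
        define e where "e = C * M ^ k / fact k * norm (\<zeta> - z0) ^ k"
        have e0: "e \<ge> 0" using C0 M1 by (simp add: e_def)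
        have "norm (P \<zeta> * W k \<zeta> + Q \<zeta> * Y k \<zeta>) \<le> norm (P \<zeta>) * norm (W k \<zeta>) + norm (Q \<zeta>) * norm (Y k \<zeta>)"
          by (metis norm_mult norm_triangle_ineq)
        also have "\<dots> \<le> norm (P \<zeta>) * e + norm (Q \<zeta>) * e"
          using Suc.IH[OF \<open>\<zeta> \<in> K\<close>] by (intro add_mono mult_left_mono) (auto simp: e_def)
        also have "\<dots> = (norm (P \<zeta>) + norm (Q \<zeta>)) * e" by (simp add: algebra_simps)
        also have "\<dots> \<le> M * e" using M[OF \<open>\<zeta> \<in> K\<close>] e0 by (intro mult_right_mono) auto
        also have "\<dots> = E * norm (\<zeta> - z0) ^ k" by (simp add: E_def e_def field_simps)
        finally show "norm (P \<zeta> * W k \<zeta> + Q \<zeta> * Y k \<zeta>) \<le> E * norm (\<zeta> - z0) ^ k" .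
      qed (simp add: Wz0)
      ultimately show ?case by blast
    qed
    define h where "h = (\<lambda>k. C * ((M * R) ^ k / fact k))"
    have "summable h"
      unfolding h_def using summable_exp[of "M * R"]
      by (intro summable_mult) (simp add: field_simps)
    moreover have "norm (Y k z) \<le> h k \<and> norm (W k z) \<le> h k" if "z \<in> ball z1 d \<inter> S" for k z
    proof -
      have zK: "z \<in> K" using that K by auto
      have "C * M ^ k / fact k * norm (z - z0) ^ k \<le> C * M ^ k / fact k * R ^ k"
        using R[OF zK] C0 M1 by (intro mult_left_mono power_mono) auto
      also have "\<dots> = h k" by (simp add: h_def power_mult_distrib)
      finally show ?thesis using bd[OF zK, of k] by linarith
    qed
    ultimately show ?thesis using d(1) by blast
  qed
  have "\<exists>g g'. \<forall>x\<in>S. ((\<lambda>k. Y k x) sums g x) \<and> ((\<lambda>k. DY k x) sums g' x) \<and> (g has_field_derivative g' x) (at x)"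
  proof (rule series_and_derivative_comparison_local[OF S(1) derY])
    fix x assume "x \<in> S"
    from loc[OF this] obtain d h where dh: "0 < d" "summable h"
      "\<forall>k. \<forall>z\<in>ball x d \<inter> S. norm (Y k z) \<le> h k \<and> norm (W k z) \<le> h k" by blast
    then have "\<forall>\<^sub>F k in sequentially. \<forall>y\<in>ball x d \<inter> S. norm (Y k y) \<le> h k"
      by (intro always_eventually) blast
    with dh show "\<exists>d h. 0 < d \<and> summable h \<and> (\<forall>\<^sub>F k in sequentially. \<forall>y\<in>ball x d \<inter> S. norm (Y k y) \<le> h k)"
      by blast
  qed
  then obtain y y' where y: "\<And>x. x \<in> S \<Longrightarrow> (\<lambda>k. Y k x) sums y x"
    "\<And>x. x \<in> S \<Longrightarrow> (\<lambda>k. DY k x) sums y' x" "\<And>x. x \<in> S \<Longrightarrow> (y has_field_derivative y' x) (at x)"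
    by blast
  have "\<exists>g g'. \<forall>x\<in>S. ((\<lambda>k. W k x) sums g x) \<and> ((\<lambda>k. DW k x) sums g' x) \<and> (g has_field_derivative g' x) (at x)"
  proof (rule series_and_derivative_comparison_local[OF S(1) derW])
    fix x assume "x \<in> S"
    from loc[OF this] obtain d h where dh: "0 < d" "summable h"
      "\<forall>k. \<forall>z\<in>ball x d \<inter> S. norm (Y k z) \<le> h k \<and> norm (W k z) \<le> h k" by blast
    then have "\<forall>\<^sub>F k in sequentially. \<forall>y\<in>ball x d \<inter> S. norm (W k y) \<le> h k"
      by (intro always_eventually) blast
    with dh show "\<exists>d h. 0 < d \<and> summable h \<and> (\<forall>\<^sub>F k in sequentially. \<forall>y\<in>ball x d \<inter> S. norm (W k y) \<le> h k)"
      by blast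
  qed
  then obtain w w' where w: "\<And>x. x \<in> S \<Longrightarrow> (\<lambda>k. W k x) sums w x"
    "\<And>x. x \<in> S \<Longrightarrow> (\<lambda>k. DW k x) sums w' x" "\<And>x. x \<in> S \<Longrightarrow> (w has_field_derivative w' x) (at x)"
    by blast
  have y'w: "y' x = w x" if "x \<in> S" for x
  proof -
    have "(\<lambda>k. DY (Suc k) x) sums w x" using w(1)[OF that] by (simp add: DY_def)
    then have "(\<lambda>k. DY k x) sums (w x + DY 0 x)" by (rule sums_Suc)
    then have "(\<lambda>k. DY k x) sums w x" by (simp add: DY_def)
    then show ?thesis using y(2)[OF that] sums_unique2 by blast
  qed
  have w'eq: "w' x = P x * w x + Q x * y x" if "x \<in> S" for x
  proof -
    have "(\<lambda>k. DW (Suc k) x) sums (P x * w x + Q x * y x)"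
      unfolding DW_def using w(1)[OF that] y(1)[OF that]
      by (auto intro!: sums_add sums_mult)
    then have "(\<lambda>k. DW k x) sums (P x * w x + Q x * y x + DW 0 x)" by (rule sums_Suc)
    then have "(\<lambda>k. DW k x) sums (P x * w x + Q x * y x)" by (simp add: DW_def)
    then show ?thesis using w(2)[OF that] sums_unique2 by blast
  qed
  have "(\<lambda>k. Y (Suc k) z0) sums 0" by (simp add: Yz0)
  from sums_Suc[OF this] have "y z0 = u"
    using y(1)[OF S(3)] sums_unique2 by (fastforce simp: Y0)
  moreover have "(\<lambda>k. W (Suc k) z0) sums 0" by (simp add: Wz0)
  from sums_Suc[OF this] have "w z0 = v"
    using w(1)[OF S(3)] sums_unique2 by (fastforce simp: W0)
  moreover have "(y has_field_derivative w z) (at z)" if "z \<in> S" for z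
    using y(3)[OF that] y'w[OF that] by simp
  moreover have "(w has_field_derivative P z * w z + Q z * y z) (at z)" if "z \<in> S" for z
    using w(3)[OF that] w'eq[OF that] by simp
  ultimately show ?thesis using that by blast
qed

lemma hg_exists:
  assumes S: "open S" "convex S" "0 \<notin> S" "1 \<notin> S" "z0 \<in> S"
  obtains y where "hg_sol a b c y S" "y z0 = u" "deriv y z0 = v"
proof -
  define P where "P = (\<lambda>z. - (c - (a + b + 1) * z) / (z * (1 - z)))"
  define Q where "Q = (\<lambda>z. a * b / (z * (1 - z)))"
  have "P holomorphic_on S" "Q holomorphic_on S"
    unfolding P_def Q_def using S by (auto intro!: holomorphic_intros)
  from linear_ode_exists[OF S(1,2,5) this]
  obtain y w where yw: "y z0 = u" "w z0 = v"
    "\<And>z. z \<in> S \<Longrightarrow> (y has_field_derivative w z) (at z)"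
    "\<And>z. z \<in> S \<Longrightarrow> (w has_field_derivative P z * w z + Q z * y z) (at z)"
    by metis
  have "hg_sol a b c y S"
  proof (rule hg_solI[OF S(1) yw(3,4)])
    fix z assume "z \<in> S"
    then have "z * (1 - z) \<noteq> 0" using S by auto
    then have "z * (1 - z) * P z = - (c - (a + b + 1) * z)" "z * (1 - z) * Q z = a * b"
      by (simp_all add: P_def Q_def)
    moreover have "z * (1 - z) * (P z * w z + Q z * y z) =
       (z * (1 - z) * P z) * w z + (z * (1 - z) * Q z) * y z" by (simp add: algebra_simps)
    ultimately show "z * (1 - z) * (P z * w z + Q z * y z) + (c - (a + b + 1) * z) * w z - a * b * y z = 0"
      by (simp only:) (simp add: algebra_simps)
  qed
  moreover have "deriv y z0 = v" using yw(3)[OF S(5)] yw(2) by (simp add: DERIV_imp_deriv)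
  ultimately show ?thesis using that yw(1) by blast
qed

text \<open>
  Analytic continuation by adding one convex piece at a time, which avoids a monodromy theorem.
\<close>

lemma hg_extend:
  assumes X: "open X" "hg_sol a b c f X"
    and C: "open C" "convex C" "0 \<notin> C" "1 \<notin> C"
    and XC: "connected (X \<inter> C)" "X \<inter> C \<noteq> {}"
  obtains g where "hg_sol a b c g (X \<union> C)" "\<And>z. z \<in> X \<Longrightarrow> g z = f z"
proof -
  obtain z0 where z0: "z0 \<in> X" "z0 \<in> C" using XC by blast
  obtain y where y: "hg_sol a b c y C" "y z0 = f z0" "deriv y z0 = deriv f z0"
    using hg_exists[OF C z0(2)] by metis
  have eq: "f z = y z" if "z \<in> X \<inter> C" for z
    by (rule hg_unique[of a b c f "X \<inter> C" y z0])
      (use y z0 X C XC that in \<open>auto intro: hg_sol_subset\<close>)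
  define g where "g = (\<lambda>z. if z \<in> X then f z else y z)"
  have gX: "hg_sol a b c g X" by (rule hg_sol_cong[OF X(2,1)]) (simp add: g_def)
  have gC: "hg_sol a b c g C" by (rule hg_sol_cong[OF y(1) C(1)]) (use eq in \<open>auto simp: g_def\<close>)
  have "hg_sol a b c g (X \<union> C)"
    using gX gC holomorphic_on_Un[OF _ _ X(1) C(1)] unfolding hg_sol_def by blast
  then show ?thesis using that by (simp add: g_def)
qed

text \<open>
  Independence on \<open>S\<close> and uniqueness make the Wronskian nonzero at every point, so that the initial data
  of \<open>y\<close> at a point of \<open>T\<close> can be matched.
\<close>

lemma hg_span:
  assumes y: "hg_sol a b c y1 S" "hg_sol a b c y2 S"
    and S: "open S" "connected S" "0 \<notin> S" "1 \<notin> S"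
    and indep: "\<And>k1 k2. (\<And>z. z \<in> S \<Longrightarrow> k1 * y1 z + k2 * y2 z = 0) \<Longrightarrow> k1 = 0 \<and> k2 = 0"
    and T: "open T" "connected T" "T \<subseteq> S" "T \<noteq> {}" and yT: "hg_sol a b c y T"
  obtains k1 k2 where "\<And>z. z \<in> T \<Longrightarrow> y z = k1 * y1 z + k2 * y2 z"
proof -
  obtain z0 where z0: "z0 \<in> T" "z0 \<in> S" using T by blast
  define \<omega> where "\<omega> = y1 z0 * deriv y2 z0 - y2 z0 * deriv y1 z0"
  have zero: "k1 = 0 \<and> k2 = 0" if "k1 * y1 z0 + k2 * y2 z0 = 0" "k1 * deriv y1 z0 + k2 * deriv y2 z0 = 0" for k1 k2
  proof (rule indep)
    fix z assume z: "z \<in> S"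
    show "k1 * y1 z + k2 * y2 z = 0"
      by (rule hg_unique[OF hg_sol_lincomb[OF y S(1)] _ S z0(2), where ?y2.0 = "\<lambda>_. 0"])
        (use that z in \<open>auto simp: deriv_lincomb[OF y S(1) z0(2)] hg_sol_def\<close>)
  qed
  have "\<omega> \<noteq> 0"
  proof
    assume w: "\<omega> = 0"
    have "y2 z0 = 0 \<and> - y1 z0 = 0"
      by (rule zero) (use w in \<open>auto simp: \<omega>_def algebra_simps\<close>)
    moreover have "deriv y2 z0 = 0 \<and> - deriv y1 z0 = 0"
      by (rule zero) (use w in \<open>auto simp: \<omega>_def algebra_simps\<close>)
    ultimately show False using zero[of 1 0] by auto
  qed
  \<comment> \<open>Cramer's rule\<close>
  define k1 where "k1 = (y z0 * deriv y2 z0 - y2 z0 * deriv y z0) / \<omega>"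
  define k2 where "k2 = (y1 z0 * deriv y z0 - y z0 * deriv y1 z0) / \<omega>"
  have k: "\<omega> * k1 = y z0 * deriv y2 z0 - y2 z0 * deriv y z0" "\<omega> * k2 = y1 z0 * deriv y z0 - y z0 * deriv y1 z0"
    using \<open>\<omega> \<noteq> 0\<close> by (simp_all add: k1_def k2_def)
  have "\<omega> * (k1 * y1 z0 + k2 * y2 z0) = \<omega> * y z0"
    "\<omega> * (k1 * deriv y1 z0 + k2 * deriv y2 z0) = \<omega> * deriv y z0"
    unfolding distrib_left mult.assoc[symmetric] k by (simp_all add: \<omega>_def algebra_simps)
  then have e: "k1 * y1 z0 + k2 * y2 z0 = y z0" "k1 * deriv y1 z0 + k2 * deriv y2 z0 = deriv y z0"
    using \<open>\<omega> \<noteq> 0\<close> by simp_all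
  have "y z = k1 * y1 z + k2 * y2 z" if "z \<in> T" for z
  proof (rule hg_unique[OF yT hg_sol_subset[OF hg_sol_lincomb[OF y S(1)] T(3)] T(1,2) _ _ z0(1) _ _ that])
    show "y z0 = k1 * y1 z0 + k2 * y2 z0" using e by simp
    show "deriv y z0 = deriv (\<lambda>z. k1 * y1 z + k2 * y2 z) z0"
      using e by (simp add: deriv_lincomb[OF y S(1) z0(2)])
  qed (use T S in auto)
  then show ?thesis using that by blast
qed

section \<open>The Gauss series\<close>

definition gauss_fps :: "complex \<Rightarrow> complex \<Rightarrow> complex \<Rightarrow> complex fps"
  where "gauss_fps a b c =
    Abs_fps (\<lambda>i. pochhammer a i * pochhammer b i / (pochhammer c i * fact i))"

lemma gauss_F_eval: "gauss_F a b c z = eval_fps (gauss_fps a b c) z"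
  by (simp add: gauss_F_def eval_fps_def gauss_fps_def)

lemma gauss_fps_0 [simp]: "fps_nth (gauss_fps a b c) 0 = 1"
  by (simp add: gauss_fps_def)

lemma gauss_F_0 [simp]: "gauss_F a b c 0 = 1"
  by (simp add: gauss_F_eval eval_fps_at_0)

lemma gauss_F_commute: "gauss_F a b c = gauss_F b a c"
  by (simp add: gauss_F_def fun_eq_iff mult.commute)

lemma pochhammer_nonzero: "c \<notin> \<int>\<^sub>\<le>\<^sub>0 \<Longrightarrow> pochhammer (c :: complex) i \<noteq> 0"
  by (auto simp: pochhammer_eq_0_iff)

lemma pochhammer_eq_0_ge: "pochhammer (- of_nat N :: complex) i = 0 \<longleftrightarrow> i > N"
  by (auto simp: pochhammer_eq_0_iff)

lemma gauss_fps_Suc: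
  assumes "c \<notin> \<int>\<^sub>\<le>\<^sub>0"
  shows "of_nat (Suc i) * (c + of_nat i) * fps_nth (gauss_fps a b c) (Suc i) =
    (a + of_nat i) * (b + of_nat i) * fps_nth (gauss_fps a b c) i"
proof -
  have "pochhammer c i \<noteq> 0" "c + of_nat i \<noteq> 0"
    using pochhammer_nonzero[OF assms, of i] pochhammer_nonzero[OF assms, of "Suc i"]
    by (auto simp: pochhammer_Suc)
  moreover have "u * v * (p * x * (q * y) / (r * v * (u * w))) = x * y * (p * q / (r * w))"
    if "u \<noteq> 0" "v \<noteq> 0" for u v w p q r x y :: complex
    using that by simp
  ultimately show ?thesis
    unfolding gauss_fps_def fps_nth_Abs_fps pochhammer_Suc fact_Suc of_nat_mult
    by (simp only: of_nat_neq_0 not_False_eq_True of_nat_fact)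
qed

lemma tendsto_shifted_ratio:
  "((\<lambda>n. (of_nat n + u) / (of_nat n + v :: complex)) \<longlongrightarrow> 1) sequentially"
proof -
  have inf: "filterlim (\<lambda>n. of_nat n + v :: complex) at_infinity sequentially"
    using tendsto_add_filterlim_at_infinity'[OF tendsto_of_nat tendsto_const] by (simp add: add.commute)
  have "((\<lambda>n. 1 + (u - v) / (of_nat n + v)) \<longlongrightarrow> 1 + 0) sequentially"
    by (intro tendsto_add tendsto_const tendsto_divide_0[OF tendsto_const inf])
  moreover have "\<forall>\<^sub>F n in sequentially. of_nat n + v \<noteq> (0 :: complex)"
    using inf by (rule filterlim_at_infinity_imp_eventually_ne)
  then have "\<forall>\<^sub>F n in sequentially. 1 + (u - v) / (of_nat n + v) = (of_nat n + u) / (of_nat n + v)"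
    by eventually_elim (simp add: field_simps)
  ultimately show ?thesis by (simp add: tendsto_cong)
qed

text \<open>
  No coefficient vanishes, and the quotients of consecutive coefficients tend to \<open>1\<close>.
\<close>

lemma gauss_radius_1:
  assumes c: "c \<notin> \<int>\<^sub>\<le>\<^sub>0" and ab: "a \<notin> \<int>\<^sub>\<le>\<^sub>0" "b \<notin> \<int>\<^sub>\<le>\<^sub>0"
  shows "fps_conv_radius (gauss_fps a b c) = 1"
proof -
  define e where "e = fps_nth (gauss_fps a b c)"
  have e: "e i \<noteq> 0" for i
    using pochhammer_nonzero[OF c, of i] pochhammer_nonzero[OF ab(1), of i] pochhammer_nonzero[OF ab(2), of i]
    by (simp add: e_def gauss_fps_def)
  have nz: "of_nat i + u \<noteq> 0" if "u \<notin> \<int>\<^sub>\<le>\<^sub>0" for u :: complex and i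
    using that by (metis add.commute add_eq_0_iff2 minus_of_nat_in_nonpos_Ints)
  have "e i / e (Suc i) = ((of_nat i + 1) / (of_nat i + a)) * ((of_nat i + c) / (of_nat i + b))" for i
  proof -
    have "x / y = (s / A) * (C / B)" if "s * C * y = A * B * x" "y \<noteq> 0" "A \<noteq> 0" "B \<noteq> 0" for x y s A B C :: complex
      using that by (simp add: frac_eq_eq mult_ac)
    moreover have "(of_nat i + 1) * (of_nat i + c) * e (Suc i) = (of_nat i + a) * (of_nat i + b) * e i"
      using gauss_fps_Suc[OF c, of i a b] unfolding e_def[symmetric] by (simp add: add.commute)
    ultimately show ?thesis using e[of "Suc i"] nz[OF ab(1), of i] nz[OF ab(2), of i] by blast
  qed
  moreover have "(\<lambda>i. ((of_nat i + 1) / (of_nat i + a)) * ((of_nat i + c) / (of_nat i + b))) \<longlonglongrightarrow> 1 * 1"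
    by (intro tendsto_mult tendsto_shifted_ratio)
  ultimately have "(\<lambda>i. e i / e (Suc i)) \<longlonglongrightarrow> 1" by simp
  then have "(\<lambda>i. norm (e i) / norm (e (Suc i))) \<longlonglongrightarrow> 1"
    using tendsto_norm[of "\<lambda>i. e i / e (Suc i)" 1] by (simp add: norm_divide)
  then show ?thesis
    unfolding fps_conv_radius_def e_def[symmetric]
    by (intro conv_radius_ratio_limit_nonzero[where c = 1]) (auto simp: one_ereal_def)
qed

lemma gauss_F_polynomial:
  assumes "a \<in> \<int>\<^sub>\<le>\<^sub>0"
  obtains N where "a = - of_nat N"
    "\<And>z. gauss_F a b c z = (\<Sum>i\<le>N. fps_nth (gauss_fps a b c) i * z ^ i)"
proof -
  obtain N where N: "a = - of_nat N" using assms by (auto elim!: nonpos_Ints_cases')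
  have "gauss_F a b c z = (\<Sum>i\<le>N. fps_nth (gauss_fps a b c) i * z ^ i)" for z
    unfolding gauss_F_eval eval_fps_def
    by (rule suminf_finite) (auto simp: gauss_fps_def N pochhammer_eq_0_ge)
  with N that show ?thesis by blast
qed

lemma gauss_radius:
  assumes c: "c \<notin> \<int>\<^sub>\<le>\<^sub>0"
  shows "fps_conv_radius (gauss_fps a b c) \<ge> 1"
proof (cases "a \<in> \<int>\<^sub>\<le>\<^sub>0 \<or> b \<in> \<int>\<^sub>\<le>\<^sub>0")
  case True
  then obtain N where N: "a = - of_nat N \<or> b = - of_nat N" by (auto elim!: nonpos_Ints_cases')
  have "\<forall>\<^sub>F i in sequentially. fps_nth (gauss_fps a b c) i = 0"
    using eventually_gt_at_top[of N]
    by eventually_elim (use N in \<open>auto simp: gauss_fps_def pochhammer_eq_0_ge\<close>)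
  then have "fps_conv_radius (gauss_fps a b c) = \<infinity>"
    unfolding fps_conv_radius_def by (subst conv_radius_cong'[where g = "\<lambda>_. 0"]) auto
  then show ?thesis by simp
next
  case False
  then show ?thesis using gauss_radius_1[OF c, of a b] by simp
qed

text \<open>
  The recursion of the coefficients is the equation read off coefficientwise.
\<close>

lemma gauss_hg_sol:
  assumes c: "c \<notin> \<int>\<^sub>\<le>\<^sub>0"
  shows "hg_sol a b c (gauss_F a b c) (ball 0 1)"
proof -
  define F where "F = gauss_fps a b c"
  define D where "D = fps_deriv F"
  define E where "E = fps_deriv D"
  have r: "fps_conv_radius F \<ge> 1" using gauss_radius[OF c] by (simp add: F_def)
  have rD: "fps_conv_radius D \<ge> 1" using r fps_conv_radius_deriv[of F] by (simp add: D_def)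
  have rE: "fps_conv_radius E \<ge> 1" using rD fps_conv_radius_deriv[of D] by (simp add: E_def)
  have ode: "fps_X * (1 - fps_X) * E + (fps_const c - fps_const (a + b + 1) * fps_X) * D
      - fps_const (a * b) * F = 0"
  proof (rule fps_ext)
    fix i
    have rec: "of_nat (Suc i) * (c + of_nat i) * F $ Suc i = (a + of_nat i) * (b + of_nat i) * F $ i" for i
      using gauss_fps_Suc[OF c] by (simp add: F_def)
    have rew: "fps_X * (1 - fps_X) * E + (fps_const c - fps_const (a + b + 1) * fps_X) * D - fps_const (a * b) * F
      = fps_X * E - fps_X * (fps_X * E) + fps_const c * D - fps_const (a + b + 1) * (fps_X * D) - fps_const (a * b) * F"
      by (simp add: algebra_simps)
    have "(fps_X * E - fps_X * (fps_X * E) + fps_const c * D - fps_const (a + b + 1) * (fps_X * D) - fps_const (a * b) * F) $ i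
       = of_nat (Suc i) * (c + of_nat i) * F $ Suc i - (a + of_nat i) * (b + of_nat i) * F $ i"
    proof (cases i)
      case 0 then show ?thesis by (simp add: D_def E_def)
    next
      case (Suc j)
      show ?thesis unfolding Suc
        by (cases j) (simp_all add: D_def E_def algebra_simps)
    qed
    also have "\<dots> = 0" using rec[of i] by simp
    finally show "(fps_X * (1 - fps_X) * E + (fps_const c - fps_const (a + b + 1) * fps_X) * D
      - fps_const (a * b) * F) $ i = 0 $ i" unfolding rew by simp
  qed
  show ?thesis
  proof (rule hg_solI)
    fix z :: complex assume "z \<in> ball 0 1"
    then have "ereal (norm z) < 1" by (simp add: one_ereal_def)
    then have z: "ereal (norm z) < fps_conv_radius F" "ereal (norm z) < fps_conv_radius D"
      "ereal (norm z) < fps_conv_radius E"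
      using r rD rE by order+
    show "(gauss_F a b c has_field_derivative eval_fps D z) (at z)"
      unfolding D_def using has_field_derivative_eval_fps[OF z(1)] by (simp add: gauss_F_eval[abs_def] F_def)
    show "(eval_fps D has_field_derivative eval_fps E z) (at z)"
      unfolding E_def using has_field_derivative_eval_fps[OF z(2)] .
    have lt: "ereal (norm z) < fps_conv_radius (f * g)" 
      if "ereal (norm z) < fps_conv_radius f" "ereal (norm z) < fps_conv_radius g" for f g :: "complex fps"
      using that fps_conv_radius_mult[of f g] by (meson less_le_trans min_less_iff_conj)
    have lt2: "ereal (norm z) < fps_conv_radius (f - g)" 
      if "ereal (norm z) < fps_conv_radius f" "ereal (norm z) < fps_conv_radius g" for f g :: "complex fps"
      using that fps_conv_radius_diff[of f g] by (meson less_le_trans min_less_iff_conj)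
    have lt3: "ereal (norm z) < fps_conv_radius (f + g)" 
      if "ereal (norm z) < fps_conv_radius f" "ereal (norm z) < fps_conv_radius g" for f g :: "complex fps"
      using that fps_conv_radius_add[of f g] by (meson less_le_trans min_less_iff_conj)
    have "0 = eval_fps (fps_X * (1 - fps_X) * E + (fps_const c - fps_const (a + b + 1) * fps_X) * D
      - fps_const (a * b) * F) z" by (simp add: ode)
    also have "\<dots> = z * (1 - z) * eval_fps E z + (c - (a + b + 1) * z) * eval_fps D z - a * b * eval_fps F z"
      using z by (simp add: eval_fps_mult eval_fps_add eval_fps_diff lt lt2 lt3)
    finally show "z * (1 - z) * eval_fps E z + (c - (a + b + 1) * z) * eval_fps D z - a * b * gauss_F a b c z = 0"
      by (simp add: gauss_F_eval F_def)
  qed simp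
qed

text \<open>
  The Taylor series of \<open>g\<close> at \<open>0\<close> would converge on a disc larger than the exact disc of convergence of the
  Gauss series.
\<close>

lemma gauss_F_not_extendable:
  assumes c: "c \<notin> \<int>\<^sub>\<le>\<^sub>0" and ab: "a \<notin> \<int>\<^sub>\<le>\<^sub>0" "b \<notin> \<int>\<^sub>\<le>\<^sub>0"
    and R: "R > 1" and g: "g holomorphic_on ball 0 R"
    and eq: "\<And>z. z \<in> ball 0 1 \<Longrightarrow> g z = gauss_F a b c z"
  shows False
proof -
  have 1: "g has_fps_expansion fps_expansion g 0"
    using g R by (intro has_fps_expansion_fps_expansion[of "ball 0 R"]) auto
  have "eval_fps (gauss_fps a b c) has_fps_expansion gauss_fps a b c"
    by (rule eval_fps_has_fps_expansion) (simp add: gauss_radius_1[OF c ab])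
  moreover have "\<forall>\<^sub>F z in nhds 0. eval_fps (gauss_fps a b c) z = g z"
    using eventually_nhds_in_open[of "ball 0 1 :: complex set" 0]
    by (auto elim!: eventually_mono simp: eq gauss_F_eval)
  ultimately have "g has_fps_expansion gauss_fps a b c"
    unfolding has_fps_expansion_def by (auto elim: eventually_elim2)
  with 1 have "fps_expansion g 0 = gauss_fps a b c" by (rule fps_expansion_unique_complex)
  moreover have "fps_conv_radius (fps_expansion g 0) \<ge> ereal R"
    using g by (intro conv_radius_fps_expansion) simp
  ultimately show False using gauss_radius_1[OF c ab] R by simp
qed

section \<open>Changes of variable and local exponents\<close>

lemma hg_sol_commute: "hg_sol a b c y S \<Longrightarrow> hg_sol b a c y S"
  by (simp add: hg_sol_def add.commute mult.commute)

lemma hg_reflect: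
  assumes w: "hg_sol a b (a + b - c + 1) w T" "open T"
    and S: "open S" "\<And>z. z \<in> S \<Longrightarrow> 1 - z \<in> T"
  shows "hg_sol a b c (\<lambda>z. w (1 - z)) S"
proof (rule hg_solI[OF S(1)])
  fix z assume "z \<in> S"
  then have zT: "1 - z \<in> T" by (rule S)
  note d = hg_sol_has_derivs[OF w(2,1) zT]
  have m: "((\<lambda>z. 1 - z) has_field_derivative - 1) (at z)"
    by (auto intro!: derivative_eq_intros)
  show "((\<lambda>z. w (1 - z)) has_field_derivative - deriv w (1 - z)) (at z)"
    using DERIV_chain2[OF d(1) m] by simp
  show "((\<lambda>z. - deriv w (1 - z)) has_field_derivative deriv (deriv w) (1 - z)) (at z)"
    using DERIV_minus[OF DERIV_chain2[OF d(2) m]] by simp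
  show "z * (1 - z) * deriv (deriv w) (1 - z) + (c - (a + b + 1) * z) * (- deriv w (1 - z)) - a * b * w (1 - z) = 0"
    using hg_sol_eq[OF w(1) zT] by (simp add: algebra_simps)
qed

lemma has_derivative_exp_log:
  assumes "(\<Lambda> has_field_derivative 1 / z) (at z)"
  shows "((\<lambda>z. exp (e * \<Lambda> z)) has_field_derivative exp (e * \<Lambda> z) * (e * (1 / z))) (at z)"
  using assms by (auto intro!: derivative_eq_intros)

text \<open>
  Here and below \<open>\<Lambda>\<close> is any branch of the logarithm, described by its derivative, so that the
  lemmas apply on every domain that carries one.
\<close>

lemma hg_exponent_at_0:
  assumes w: "hg_sol (a - c + 1) (b - c + 1) (2 - c) w S" "open S" "0 \<notin> S"
    and \<Lambda>: "\<And>z. z \<in> S \<Longrightarrow> (\<Lambda> has_field_derivative 1 / z) (at z)"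
  shows "hg_sol a b c (\<lambda>z. exp ((1 - c) * \<Lambda> z) * w z) S"
proof (rule hg_solI[OF w(2)])
  fix z assume z: "z \<in> S"
  have z0: "z \<noteq> 0" using z w(3) by auto
  define R where "R = (\<lambda>z::complex. 1 / z)"
  define E where "E = (\<lambda>z. exp ((1 - c) * \<Lambda> z))"
  have dE: "(E has_field_derivative E z * ((1 - c) * R z)) (at z)"
    unfolding E_def R_def using \<Lambda>[OF z] by (rule has_derivative_exp_log)
  have dR: "(R has_field_derivative - (R z)\<^sup>2) (at z)"
    unfolding R_def using z0 by (auto intro!: derivative_eq_intros simp: power2_eq_square)
  note [derivative_intros] = hg_sol_has_derivs[OF w(2,1) z] dE dR
  have "((\<lambda>z. E z * w z) has_field_derivative E z * ((1 - c) * w z * R z + deriv w z)) (at z)"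
    by (rule derivative_eq_intros refl | simp add: algebra_simps)+
  then show "((\<lambda>z. exp ((1 - c) * \<Lambda> z) * w z) has_field_derivative
      E z * ((1 - c) * w z * R z + deriv w z)) (at z)" by (simp add: E_def)
  show "((\<lambda>z. E z * ((1 - c) * w z * R z + deriv w z)) has_field_derivative
      E z * ((1 - c) * - c * w z * (R z)\<^sup>2 + 2 * (1 - c) * deriv w z * R z + deriv (deriv w) z)) (at z)"
    by (rule derivative_eq_intros refl | simp add: algebra_simps power2_eq_square)+
  have r: "R z * z = 1" using z0 by (simp add: R_def)
  have E: "exp ((1 - c) * \<Lambda> z) = E z" by (simp add: E_def)
  have "z * (1 - z) * deriv (deriv w) z + (2 - c - (a - c + 1 + (b - c + 1) + 1) * z) * deriv w z
      - (a - c + 1) * (b - c + 1) * w z = 0"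
    by (rule hg_sol_eq[OF w(1) z])
  with r show "z * (1 - z) * (E z * ((1 - c) * - c * w z * (R z)\<^sup>2 + 2 * (1 - c) * deriv w z * R z + deriv (deriv w) z)) +
      (c - (a + b + 1) * z) * (E z * ((1 - c) * w z * R z + deriv w z)) -
      a * b * (exp ((1 - c) * \<Lambda> z) * w z) = 0"
    unfolding E by algebra
qed

lemma hg_exponent_at_infinity:
  assumes w: "hg_sol a (a - c + 1) (a - b + 1) w T" "open T"
    and S: "open S" "0 \<notin> S" "\<And>z. z \<in> S \<Longrightarrow> 1 / z \<in> T"
    and \<Lambda>: "\<And>z. z \<in> S \<Longrightarrow> (\<Lambda> has_field_derivative 1 / z) (at z)"
  shows "hg_sol a b c (\<lambda>z. exp (- a * \<Lambda> z) * w (1 / z)) S"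
proof (rule hg_solI[OF S(1)])
  fix z assume z: "z \<in> S"
  have z0: "z \<noteq> 0" using z S by auto
  note d = hg_sol_has_derivs[OF w(2,1) S(3)[OF z]]
  have m: "((\<lambda>z. 1 / z) has_field_derivative - ((1 / z)\<^sup>2)) (at z)"
    using z0 by (auto intro!: derivative_eq_intros simp: power2_eq_square)
  note [derivative_intros] = DERIV_chain2[OF d(1) m] DERIV_chain2[OF d(2) m]
    has_derivative_exp_log[OF \<Lambda>[OF z], of "- a"] m
  show "((\<lambda>z. exp (- a * \<Lambda> z) * w (1 / z)) has_field_derivative
      exp (- a * \<Lambda> z) * (- a * w (1 / z) * (1 / z) - deriv w (1 / z) * (1 / z)\<^sup>2)) (at z)"
    by (rule derivative_eq_intros refl | simp add: algebra_simps power2_eq_square)+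
  show "((\<lambda>z. exp (- a * \<Lambda> z) * (- a * w (1 / z) * (1 / z) - deriv w (1 / z) * (1 / z)\<^sup>2)) has_field_derivative
      exp (- a * \<Lambda> z) * (a * (a + 1) * w (1 / z) * (1 / z)\<^sup>2 + (2 * a + 2) * deriv w (1 / z) * (1 / z) ^ 3
        + deriv (deriv w) (1 / z) * (1 / z) ^ 4)) (at z)"
    by (rule derivative_eq_intros refl | simp add: algebra_simps power2_eq_square power3_eq_cube power4_eq_xxxx)+
  have r: "(1 / z) * z = 1" using z0 by simp
  have "1 / z * (1 - 1 / z) * deriv (deriv w) (1 / z) +
      (a - b + 1 - (a + (a - c + 1) + 1) * (1 / z)) * deriv w (1 / z) - a * (a - c + 1) * w (1 / z) = 0"
    by (rule hg_sol_eq[OF w(1) S(3)[OF z]])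
  with r show "z * (1 - z) * (exp (- a * \<Lambda> z) * (a * (a + 1) * w (1 / z) * (1 / z)\<^sup>2 + (2 * a + 2) * deriv w (1 / z) * (1 / z) ^ 3
        + deriv (deriv w) (1 / z) * (1 / z) ^ 4)) +
      (c - (a + b + 1) * z) * (exp (- a * \<Lambda> z) * (- a * w (1 / z) * (1 / z) - deriv w (1 / z) * (1 / z)\<^sup>2)) -
      a * b * (exp (- a * \<Lambda> z) * w (1 / z)) = 0"
    by algebra
qed

text \<open>
  Removing the exponent \<open>c - a - b\<close> at \<open>1\<close> replaces \<open>a, b\<close> by \<open>c - a, c - b\<close>.
\<close>

lemma hg_euler:
  assumes y: "hg_sol a b c y S" "open S" "1 \<notin> S"
    and \<Lambda>: "\<And>z. z \<in> S \<Longrightarrow> (\<Lambda> has_field_derivative - (1 / (1 - z))) (at z)"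
  shows "hg_sol (c - a) (c - b) c (\<lambda>z. exp (- (c - a - b) * \<Lambda> z) * y z) S"
proof (rule hg_solI[OF y(2)])
  fix z assume z: "z \<in> S"
  define s where "s = c - a - b"
  have z1: "1 - z \<noteq> 0" using z y(3) by auto
  define E where "E = (\<lambda>z. exp (- s * \<Lambda> z))"
  define R where "R = (\<lambda>z::complex. 1 / (1 - z))"
  have dE: "(E has_field_derivative E z * (s * R z)) (at z)"
    unfolding E_def R_def using \<Lambda>[OF z] by (auto intro!: derivative_eq_intros simp: algebra_simps)
  have dr: "(R has_field_derivative (R z)\<^sup>2) (at z)"
    unfolding R_def using z1 by (auto intro!: derivative_eq_intros simp: power2_eq_square)
  note [derivative_intros] = hg_sol_has_derivs[OF y(2,1) z] dE dr
  have "((\<lambda>z. E z * y z) has_field_derivative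
      E z * (s * y z * R z + deriv y z)) (at z)"
    by (rule derivative_eq_intros refl | simp add: algebra_simps power2_eq_square)+
  then show "((\<lambda>z. exp (- (c - a - b) * \<Lambda> z) * y z) has_field_derivative
      E z * (s * y z * R z + deriv y z)) (at z)" by (simp add: E_def s_def)
  show "((\<lambda>z. E z * (s * y z * R z + deriv y z)) has_field_derivative
      E z * (s * (s + 1) * y z * (R z)\<^sup>2 + 2 * s * deriv y z * R z + deriv (deriv y) z)) (at z)"
    by (rule derivative_eq_intros refl | simp add: algebra_simps power2_eq_square)+
  have r: "R z * (1 - z) = 1" using z1 by (simp add: R_def)
  have E: "exp (- (c - a - b) * \<Lambda> z) = E z" by (simp add: E_def s_def)
  have "z * (1 - z) * deriv (deriv y) z + (c - (a + b + 1) * z) * deriv y z - a * b * y z = 0"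
    by (rule hg_sol_eq[OF y(1) z])
  with r show "z * (1 - z) * (E z * (s * (s + 1) * y z * (R z)\<^sup>2 + 2 * s * deriv y z * R z + deriv (deriv y) z)) +
      (c - (c - a + (c - b) + 1) * z) * (E z * (s * y z * R z + deriv y z)) -
      (c - a) * (c - b) * (exp (- (c - a - b) * \<Lambda> z) * y z) = 0"
    unfolding E s_def by algebra
qed

text \<open>
  If neither coefficient is zero, differentiating the relation and eliminating the exponentials gives
  \<open>(\<mu>1 - \<mu>2) g1 g2 + w (g1' g2 - g1 g2') = 0\<close>, which fails in the limit \<open>w \<rightarrow> 0\<close>.
\<close>

lemma local_exponents_independent:
  fixes \<Lambda> g1 g2 :: "complex \<Rightarrow> complex"
  assumes U: "open U" "0 \<in> closure U" "0 \<notin> U"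
    and \<Lambda>: "\<And>w. w \<in> U \<Longrightarrow> (\<Lambda> has_field_derivative 1 / w) (at w)"
    and g: "g1 holomorphic_on ball 0 r" "g2 holomorphic_on ball 0 r" "r > 0"
    and nz: "g1 0 \<noteq> 0" "g2 0 \<noteq> 0" and ne: "\<mu>1 \<noteq> \<mu>2"
    and eq: "\<And>w. w \<in> U \<Longrightarrow> norm w < r \<Longrightarrow> k1 * (exp (\<mu>1 * \<Lambda> w) * g1 w) + k2 * (exp (\<mu>2 * \<Lambda> w) * g2 w) = 0"
  shows "k1 = 0 \<and> k2 = 0"
proof -
  have cont: "isCont g1 0" "isCont g2 0"
    using g by (auto dest!: holomorphic_on_imp_continuous_on continuous_on_interior)
  have cont': "isCont (deriv g1) 0" "isCont (deriv g2) 0"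
    using holomorphic_deriv[OF g(1) open_ball] holomorphic_deriv[OF g(2) open_ball] g(3)
    by (auto dest!: holomorphic_on_imp_continuous_on continuous_on_interior)
  obtain X where X: "\<And>n. X n \<in> U" "X \<longlonglongrightarrow> 0"
    using U(2) unfolding closure_sequential by blast
  have lim: "(\<lambda>n. f (X n)) \<longlonglongrightarrow> f 0" if "isCont f 0" for f :: "complex \<Rightarrow> complex"
    using isCont_tendsto_compose[OF that X(2)] .
  have ev_r: "\<forall>\<^sub>F n in sequentially. norm (X n) < r"
    using X(2) g(3) unfolding tendsto_iff by (simp add: dist_norm)
  have ev1: "\<forall>\<^sub>F n in sequentially. g1 (X n) \<noteq> 0" and ev2: "\<forall>\<^sub>F n in sequentially. g2 (X n) \<noteq> 0"
    using lim[OF cont(1)] lim[OF cont(2)] nz tendsto_imp_eventually_ne by blast+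
  have iff: "k1 = 0 \<longleftrightarrow> k2 = 0"
  proof -
    obtain n where "norm (X n) < r" "g1 (X n) \<noteq> 0" "g2 (X n) \<noteq> 0"
      using eventually_happens[OF eventually_conj[OF ev_r eventually_conj[OF ev1 ev2]]] by auto
    with eq[OF X(1)[of n]] show ?thesis by auto
  qed
  have "k1 = 0"
  proof (rule ccontr)
    assume k1: "k1 \<noteq> 0"
    define H where "H = (\<lambda>w. (\<mu>1 - \<mu>2) * g1 w * g2 w + w * (deriv g1 w * g2 w - g1 w * deriv g2 w))"
    have "H (X n) = 0" if n: "norm (X n) < r" "g2 (X n) \<noteq> 0" for n
    proof -
      define w where "w = X n"
      have w: "w \<in> U" "w \<in> ball 0 r" "g2 w \<noteq> 0" using X n by (auto simp: w_def)
      have w0: "w \<noteq> 0" using w U by auto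
      define e1 where "e1 = exp (\<mu>1 * \<Lambda> w)"
      define e2 where "e2 = exp (\<mu>2 * \<Lambda> w)"
      note [derivative_intros] = has_derivative_exp_log[OF \<Lambda>[OF w(1)]]
        holomorphic_derivI[OF g(1) open_ball w(2)] holomorphic_derivI[OF g(2) open_ball w(2)]
      have "((\<lambda>w. k1 * (exp (\<mu>1 * \<Lambda> w) * g1 w) + k2 * (exp (\<mu>2 * \<Lambda> w) * g2 w)) has_field_derivative
         k1 * e1 * (\<mu>1 * (1 / w) * g1 w + deriv g1 w) + k2 * e2 * (\<mu>2 * (1 / w) * g2 w + deriv g2 w)) (at w)"
        unfolding e1_def e2_def by (rule derivative_eq_intros refl | simp add: algebra_simps)+
      moreover have "((\<lambda>w. k1 * (exp (\<mu>1 * \<Lambda> w) * g1 w) + k2 * (exp (\<mu>2 * \<Lambda> w) * g2 w)) has_field_derivative 0) (at w)"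
        by (rule has_field_derivative_transform_within_open[OF DERIV_const[of 0], of "U \<inter> ball 0 r"])
          (use U w eq in \<open>auto\<close>)
      ultimately have d: "k1 * e1 * (\<mu>1 * (1 / w) * g1 w + deriv g1 w) + k2 * e2 * (\<mu>2 * (1 / w) * g2 w + deriv g2 w) = 0"
        using DERIV_unique by blast
      have "k1 * (e1 * g1 w) + k2 * (e2 * g2 w) = 0"
        unfolding e1_def e2_def using eq w by auto
      then have "k1 * e1 * H w = 0"
        using d w0 unfolding H_def
        by (auto simp: field_simps) algebra
      then show ?thesis using k1 by (simp add: e1_def w_def)
    qed
    then have "\<forall>\<^sub>F n in sequentially. H (X n) = 0"
      using eventually_conj[OF ev_r ev2] by (auto elim!: eventually_mono)
    then have "(\<lambda>n. H (X n)) \<longlonglongrightarrow> 0" by (rule tendsto_eventually)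
    moreover have "isCont H 0" unfolding H_def by (intro continuous_intros cont cont')
    then have "(\<lambda>n. H (X n)) \<longlonglongrightarrow> H 0" by (rule lim)
    ultimately have "H 0 = 0" using LIMSEQ_unique by blast
    then show False using nz ne by (simp add: H_def)
  qed
  with iff show ?thesis by simp
qed

section \<open>Continuation to the slit plane\<close>

text \<open>
  The plane without \<open>[1, \<infinity>)\<close>.
\<close>

definition slit :: "complex set" where "slit = {z. Im z = 0 \<longrightarrow> Re z < 1}"

lemma slit_alt: "slit = {z. 1 - z \<notin> \<real>\<^sub>\<le>\<^sub>0}"
  by (auto simp: slit_def complex_nonpos_Reals_iff)

lemma open_slit: "open slit"
proof -
  have "slit = - ((\<lambda>z. 1 - z) -` \<real>\<^sub>\<le>\<^sub>0)" by (auto simp: slit_alt)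
  moreover have "closed ((\<lambda>z::complex. 1 - z) -` \<real>\<^sub>\<le>\<^sub>0)"
    by (intro continuous_closed_vimage) auto
  ultimately show ?thesis by (metis open_Compl)
qed

lemma disc_subset_slit: "ball 0 1 \<subseteq> slit"
proof
  fix z :: complex assume "z \<in> ball 0 1"
  moreover have "Re z \<le> norm z" by (rule complex_Re_le_cmod)
  ultimately show "z \<in> slit" by (auto simp: slit_def)
qed

lemma one_not_in_slit: "1 \<notin> slit" by (simp add: slit_def)

text \<open>
  The slit plane is covered by the unit disc, the left half-plane and the upper and lower half-planes; the
  half-planes are convex and avoid \<open>0\<close> and \<open>1\<close>.
\<close>

lemma gauss_continuation:
  assumes c: "c \<notin> \<int>\<^sub>\<le>\<^sub>0"
  obtains f where "hg_sol a b c f slit" "\<And>z. z \<in> ball 0 1 \<Longrightarrow> f z = gauss_F a b c z"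
proof -
  define L where "L = {z::complex. Re z < 0}"
  define P where "P = {z::complex. Im z > 0}"
  define N where "N = {z::complex. Im z < 0}"
  define Dc where "Dc = (ball 0 1 :: complex set)"
  have op: "open L" "open P" "open N" "open Dc"
    by (auto simp: L_def P_def N_def Dc_def open_halfspace_Re_lt open_halfspace_Im_gt open_halfspace_Im_lt)
  have cv: "convex L" "convex P" "convex N" "convex Dc"
    by (auto simp: L_def P_def N_def Dc_def convex_halfspace_Re_lt convex_halfspace_Im_gt convex_halfspace_Im_lt)
  have avoid: "0 \<notin> L" "1 \<notin> L" "0 \<notin> P" "1 \<notin> P" "0 \<notin> N" "1 \<notin> N"
    by (auto simp: L_def P_def N_def)
  \<comment> \<open>\<open>w\<close> and its conjugate lie in the overlaps of the pieces and witness that these are connected\<close>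
  define w where "w = Complex (-1/4) (1/4)"
  have "norm w < 1"
    unfolding w_def by (simp add: cmod_def power2_eq_square)
  then have w: "w \<in> Dc" "cnj w \<in> Dc" "w \<in> L" "cnj w \<in> L" "w \<in> P" "cnj w \<in> N"
    by (auto simp: Dc_def L_def P_def N_def w_def)
  have f0: "hg_sol a b c (gauss_F a b c) Dc" using gauss_hg_sol[OF c] by (simp add: Dc_def)
  obtain f1 where f1: "hg_sol a b c f1 (Dc \<union> L)" "\<And>z. z \<in> Dc \<Longrightarrow> f1 z = gauss_F a b c z"
    by (rule hg_extend[OF op(4) f0 op(1) cv(1) avoid(1,2)])
      (use w cv in \<open>auto intro!: convex_connected convex_Int\<close>)
  have conP: "connected ((Dc \<union> L) \<inter> P)" and conN: "connected ((Dc \<union> L) \<inter> N)"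
    unfolding Int_Un_distrib2
    by (rule connected_Un; use w cv in \<open>auto intro!: convex_connected convex_Int\<close>)+
  obtain f2 where f2: "hg_sol a b c f2 (Dc \<union> L \<union> P)" "\<And>z. z \<in> Dc \<union> L \<Longrightarrow> f2 z = f1 z"
    by (rule hg_extend[OF _ f1(1) op(2) cv(2) avoid(3,4) conP]) (use w op in auto)
  have *: "(Dc \<union> L \<union> P) \<inter> N = (Dc \<union> L) \<inter> N" by (auto simp: P_def N_def)
  obtain f3 where f3: "hg_sol a b c f3 (Dc \<union> L \<union> P \<union> N)" "\<And>z. z \<in> Dc \<union> L \<union> P \<Longrightarrow> f3 z = f2 z"
    by (rule hg_extend[OF _ f2(1) op(3) cv(3) avoid(5,6), unfolded *, OF _ conN]) (use w op in auto)
  have "slit \<subseteq> Dc \<union> L \<union> P \<union> N"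
  proof
    fix z assume z: "z \<in> slit"
    have "norm z < 1" if "Im z = 0" "0 \<le> Re z" using that z by (simp add: slit_def cmod_def)
    then show "z \<in> Dc \<union> L \<union> P \<union> N" unfolding Dc_def L_def P_def N_def
      by (cases "Im z = 0"; cases "0 \<le> Re z") auto
  qed
  then have "hg_sol a b c f3 slit" using f3(1) hg_sol_subset by blast
  then show ?thesis using that f1 f2 f3 by (auto simp: Dc_def)
qed

text \<open>
  On the circle of convergence \<open>1\<close> is the only point outside the slit plane: \<open>g\<close> and \<open>H\<close> together
  would be holomorphic on the disc of radius \<open>2\<close>.
\<close>

lemma gauss_not_regular_at_1:
  assumes "c \<notin> \<int>\<^sub>\<le>\<^sub>0" "a \<notin> \<int>\<^sub>\<le>\<^sub>0" "b \<notin> \<int>\<^sub>\<le>\<^sub>0"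
    and g: "g holomorphic_on slit" "\<And>z. z \<in> ball 0 1 \<Longrightarrow> g z = gauss_F a b c z"
    and H: "H holomorphic_on ball 1 1" "\<And>z. z \<in> ball 1 1 \<Longrightarrow> z \<in> slit \<Longrightarrow> g z = H z"
  shows False
proof -
  define G where "G = (\<lambda>z. if z \<in> slit then g z else H z)"
  have "G holomorphic_on slit \<union> ball 1 1"
    unfolding G_def by (rule holomorphic_on_If_Un) (use g H open_slit in auto)
  moreover have "ball 0 2 \<subseteq> slit \<union> ball 1 1"
  proof
    fix z :: complex assume z: "z \<in> ball 0 2"
    show "z \<in> slit \<union> ball 1 1"
    proof (rule UnCI)
      assume "z \<notin> ball 1 1"
      then have n: "norm (1 - z) \<ge> 1" by (simp add: dist_norm)
      have "Re z < 1" if "Im z = 0"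
      proof -
        have "\<bar>Re z\<bar> < 2" using z that by (simp add: cmod_def)
        moreover have "\<bar>1 - Re z\<bar> \<ge> 1" using n that by (simp add: cmod_def)
        ultimately show ?thesis by linarith
      qed
      then show "z \<in> slit" by (simp add: slit_def)
    qed
  qed
  ultimately have "G holomorphic_on ball 0 2" using holomorphic_on_subset by blast
  then show False
    by (rule gauss_F_not_extendable[OF assms(1-3), of 2 G, rotated])
      (use g(2) disc_subset_slit in \<open>auto simp: G_def subset_iff\<close>)
qed

lemma gauss_F_holomorphic: "c \<notin> \<int>\<^sub>\<le>\<^sub>0 \<Longrightarrow> gauss_F a b c holomorphic_on ball 0 1"
  using gauss_hg_sol hg_sol_holo by blast

lemma Ints_minus_nonpos: "z \<notin> \<int> \<Longrightarrow> z \<notin> \<int>\<^sub>\<le>\<^sub>0" for z :: complex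
  using nonpos_Ints_Int by blast

section \<open>The solutions at infinity\<close>

text \<open>
  The branch of \<open>z\<^sup>-\<^sup>a F(a, a-c+1, a-b+1, 1/z)\<close> belonging to the logarithm \<open>\<Lambda>\<close>. The second solution at
  infinity arises by exchanging \<open>a\<close> and \<open>b\<close>.
\<close>

definition inf_sol :: "complex \<Rightarrow> complex \<Rightarrow> complex \<Rightarrow> (complex \<Rightarrow> complex) \<Rightarrow> complex \<Rightarrow> complex"
  where "inf_sol a b c \<Lambda> z = exp (- a * \<Lambda> z) * gauss_F a (a - c + 1) (a - b + 1) (1 / z)"

lemma hg_inf_sol:
  assumes ab: "a - b \<notin> \<int>" and S: "open S" "\<And>z. z \<in> S \<Longrightarrow> norm z > 1"
    and \<Lambda>: "\<And>z. z \<in> S \<Longrightarrow> (\<Lambda> has_field_derivative 1 / z) (at z)"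
  shows "hg_sol a b c (inf_sol a b c \<Lambda>) S"
proof -
  have "a - b + 1 \<notin> \<int>" using ab by (metis Ints_1 Ints_diff add_diff_cancel_right')
  then have w: "hg_sol a (a - c + 1) (a - b + 1) (gauss_F a (a - c + 1) (a - b + 1)) (ball 0 1)"
    by (intro gauss_hg_sol Ints_minus_nonpos)
  show ?thesis unfolding inf_sol_def[abs_def]
  proof (rule hg_exponent_at_infinity[OF w open_ball S(1) _ _ \<Lambda>])
    show "0 \<notin> S" using S(2) by force
    show "1 / z \<in> ball 0 1" if "z \<in> S" for z
      using S(2)[OF that] by (simp add: norm_divide divide_less_eq)
  qed
qed

lemma hg_inf_sol':
  assumes ab: "a - b \<notin> \<int>" and S: "open S" "\<And>z. z \<in> S \<Longrightarrow> norm z > 1"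
    and \<Lambda>: "\<And>z. z \<in> S \<Longrightarrow> (\<Lambda> has_field_derivative 1 / z) (at z)"
  shows "hg_sol a b c (inf_sol b a c \<Lambda>) S"
  by (rule hg_sol_commute, rule hg_inf_sol[OF _ S \<Lambda>]) (use ab in \<open>metis Ints_minus minus_diff_eq\<close>)

text \<open>
  In the variable \<open>w = 1/z\<close> the two solutions have the different exponents \<open>a\<close> and \<open>b\<close> at \<open>0\<close>, hence are
  independent; that \<open>S\<close> is unbounded means that \<open>w\<close> comes arbitrarily close to \<open>0\<close>.
\<close>

lemma inf_span:
  assumes ab: "a - b \<notin> \<int>" and S: "open S" "connected S" "\<And>z. z \<in> S \<Longrightarrow> norm z > 1"
    and unb: "\<not> bounded S"
    and \<Lambda>: "\<And>z. z \<in> S \<Longrightarrow> (\<Lambda> has_field_derivative 1 / z) (at z)"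
    and T: "open T" "connected T" "T \<subseteq> S" "T \<noteq> {}" "hg_sol a b c y T"
  obtains k1 k2 where "\<And>z. z \<in> T \<Longrightarrow> y z = k1 * inf_sol a b c \<Lambda> z + k2 * inf_sol b a c \<Lambda> z"
proof -
  have av: "0 \<notin> S" "1 \<notin> S" using S(3) by force+
  have nint: "a - b + 1 \<notin> \<int>\<^sub>\<le>\<^sub>0" "b - a + 1 \<notin> \<int>\<^sub>\<le>\<^sub>0"
    using ab by (metis Ints_1 Ints_diff add_diff_cancel_right' Ints_minus_nonpos)
      (metis ab Ints_1 Ints_diff add_diff_cancel_right' Ints_minus_nonpos Ints_minus minus_diff_eq)
  have ind: "k1 = 0 \<and> k2 = 0" if *: "\<And>z. z \<in> S \<Longrightarrow> k1 * inf_sol a b c \<Lambda> z + k2 * inf_sol b a c \<Lambda> z = 0" for k1 k2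
  proof -
    define U where "U = {w. w \<noteq> 0 \<and> 1 / w \<in> S}"
    have U: "w \<noteq> 0" "1 / w \<in> S" if "w \<in> U" for w using that by (auto simp: U_def)
    have "U = (\<lambda>w. 1 / w) -` S \<inter> (- {0})" by (auto simp: U_def)
    moreover have "open ((\<lambda>w::complex. 1 / w) -` S \<inter> (- {0}))"
      unfolding Int_commute[of "_ -` _"]
      by (rule continuous_open_preimage) (use S in \<open>auto intro!: continuous_intros\<close>)
    ultimately have opU: "open U" by simp
    have clU: "0 \<in> closure U"
      unfolding closure_approachable
    proof (intro allI impI)
      fix e :: real assume e: "e > 0"
      obtain z where z: "z \<in> S" "norm z > 1 / e"
        using unb unfolding bounded_iff by (meson not_le)
      have "norm z > 0" using z(2) e by (smt (verit) divide_pos_pos)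
      then have "1 / z \<in> U" "dist (1 / z) 0 < e"
        using z e by (auto simp: U_def norm_divide field_simps)
      then show "\<exists>y\<in>U. dist y 0 < e" by blast
    qed
    have der: "((\<lambda>w. - \<Lambda> (1 / w)) has_field_derivative 1 / w) (at w)" if "w \<in> U" for w
    proof -
      have "((\<lambda>w. 1 / w) has_field_derivative - (1 / w\<^sup>2)) (at w)"
        using U[OF that] by (auto intro!: derivative_eq_intros simp: power2_eq_square)
      from DERIV_minus[OF DERIV_chain2[OF \<Lambda>[OF U(2)[OF that]] this]] show ?thesis
        using U[OF that] by (simp add: power2_eq_square)
    qed
    show ?thesis
    proof (rule local_exponents_independent[OF opU clU _ der gauss_F_holomorphic[OF nint(1)] gauss_F_holomorphic[OF nint(2)]])
      show "0 \<notin> U" by (simp add: U_def)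
      show "a \<noteq> b" using ab by auto
      fix w assume "w \<in> U" "norm w < 1"
      show "k1 * (exp (a * - \<Lambda> (1 / w)) * gauss_F a (a - c + 1) (a - b + 1) w) +
         k2 * (exp (b * - \<Lambda> (1 / w)) * gauss_F b (b - c + 1) (b - a + 1) w) = 0"
        using *[OF U(2)[OF \<open>w \<in> U\<close>]] by (simp add: inf_sol_def)
    qed auto
  qed
  show ?thesis
    using hg_span[OF hg_inf_sol[OF ab S(1,3) \<Lambda>] hg_inf_sol'[OF ab S(1,3) \<Lambda>] S(1,2) av ind T] that
    by (metis (no_types, lifting))
qed

section \<open>The solutions at 1\<close>

definition one_sol :: "complex \<Rightarrow> complex \<Rightarrow> complex \<Rightarrow> complex \<Rightarrow> complex"
  where "one_sol a b c z = gauss_F a b (a + b - c + 1) (1 - z)"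

text \<open>
  The holomorphic factor of the solution with exponent \<open>c - a - b\<close> at \<open>1\<close>.
\<close>

definition one_sol' :: "complex \<Rightarrow> complex \<Rightarrow> complex \<Rightarrow> complex \<Rightarrow> complex"
  where "one_sol' a b c z = gauss_F (c - a) (c - b) (c - a - b + 1) (1 - z)"

lemma one_sol_1 [simp]: "one_sol a b c 1 = 1" "one_sol' a b c 1 = 1"
  by (simp_all add: one_sol_def one_sol'_def)

lemma one_params:
  fixes a b c :: complex
  assumes "c - a - b \<notin> \<int>"
  shows "a + b - c + 1 \<notin> \<int>\<^sub>\<le>\<^sub>0" "c - a - b + 1 \<notin> \<int>\<^sub>\<le>\<^sub>0"
proof -
  have "a + b - c + 1 \<notin> \<int>"
  proof
    assume "a + b - c + 1 \<in> \<int>"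
    then have "1 - (a + b - c + 1) \<in> \<int>" by (intro Ints_diff Ints_1)
    with assms show False by (simp add: algebra_simps)
  qed
  moreover have "c - a - b + 1 \<notin> \<int>"
  proof
    assume "c - a - b + 1 \<in> \<int>"
    then have "(c - a - b + 1) - 1 \<in> \<int>" by (intro Ints_diff Ints_1)
    with assms show False by simp
  qed
  ultimately show "a + b - c + 1 \<notin> \<int>\<^sub>\<le>\<^sub>0" "c - a - b + 1 \<notin> \<int>\<^sub>\<le>\<^sub>0" by (simp_all add: Ints_minus_nonpos)
qed

lemma one_sol_holomorphic:
  assumes "c - a - b \<notin> \<int>"
  shows "one_sol a b c holomorphic_on ball 1 1" "one_sol' a b c holomorphic_on ball 1 1"
proof -
  have "(gauss_F a b (a + b - c + 1) \<circ> (\<lambda>z. 1 - z)) holomorphic_on ball 1 1"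
    "(gauss_F (c - a) (c - b) (c - a - b + 1) \<circ> (\<lambda>z. 1 - z)) holomorphic_on ball 1 1"
    by (rule holomorphic_on_compose_gen[OF _ gauss_F_holomorphic];
      use one_params[OF assms] in \<open>auto intro!: holomorphic_intros simp: dist_norm norm_minus_commute\<close>)+
  then show "one_sol a b c holomorphic_on ball 1 1" "one_sol' a b c holomorphic_on ball 1 1"
    by (simp_all add: o_def one_sol_def[abs_def] one_sol'_def[abs_def])
qed

lemma hg_one_sol:
  assumes "c - a - b \<notin> \<int>"
  shows "hg_sol a b c (one_sol a b c) (ball 1 1)"
  unfolding one_sol_def[abs_def]
  by (rule hg_reflect[OF gauss_hg_sol[OF one_params(1)[OF assms]]]) (auto simp: dist_norm norm_minus_commute)

text \<open>
  In the variable \<open>u = 1 - z\<close> this is the solution with the nonzero exponent at \<open>0\<close>.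
\<close>

lemma hg_one_sol':
  assumes s: "c - a - b \<notin> \<int>" and S: "open S" "S \<subseteq> ball 1 1" "1 \<notin> S"
    and \<Lambda>: "\<And>z. z \<in> S \<Longrightarrow> (\<Lambda> has_field_derivative - (1 / (1 - z))) (at z)"
  shows "hg_sol a b c (\<lambda>z. exp ((c - a - b) * \<Lambda> z) * one_sol' a b c z) S"
proof -
  define T where "T = (\<lambda>u. 1 - u) -` S"
  have opT: "open T" unfolding T_def by (intro continuous_open_vimage S) auto
  have T: "T \<subseteq> ball 0 1" "0 \<notin> T" using S by (force simp: T_def dist_norm)+
  define C where "C = a + b - c + 1"
  have C: "1 - C = c - a - b" "a - C + 1 = c - b" "b - C + 1 = c - a" "2 - C = c - a - b + 1"
    by (simp_all add: C_def)
  have "hg_sol a b C (\<lambda>u. exp ((1 - C) * \<Lambda> (1 - u)) * gauss_F (c - b) (c - a) (c - a - b + 1) u) T"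
  proof (rule hg_exponent_at_0[OF _ opT T(2)])
    show "hg_sol (a - C + 1) (b - C + 1) (2 - C) (gauss_F (c - b) (c - a) (c - a - b + 1)) T"
      unfolding C by (rule hg_sol_subset[OF gauss_hg_sol[OF one_params(2)[OF s]] T(1)])
    fix u assume u: "u \<in> T"
    have m: "((\<lambda>u. 1 - u) has_field_derivative - 1) (at u)"
      by (auto intro!: derivative_eq_intros)
    show "((\<lambda>u. \<Lambda> (1 - u)) has_field_derivative 1 / u) (at u)"
      using DERIV_chain2[OF \<Lambda> m] u by (simp add: T_def)
  qed
  from hg_reflect[OF this[unfolded C_def] opT S(1)]
  show ?thesis by (simp add: C[unfolded C_def] one_sol'_def gauss_F_commute[of "c - a"] T_def)
qed

lemma one_independent:
  assumes s: "c - a - b \<notin> \<int>" and S: "open S" "S \<subseteq> ball 1 1" "1 \<notin> S" "1 \<in> closure S"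
    and \<Lambda>: "\<And>z. z \<in> S \<Longrightarrow> (\<Lambda> has_field_derivative - (1 / (1 - z))) (at z)"
    and eq: "\<And>z. z \<in> S \<Longrightarrow> k1 * one_sol a b c z + k2 * (exp ((c - a - b) * \<Lambda> z) * one_sol' a b c z) = 0"
  shows "k1 = 0 \<and> k2 = 0"
proof -
  define T where "T = (\<lambda>u. 1 - u) -` S"
  have opT: "open T" unfolding T_def by (intro continuous_open_vimage S) auto
  have clT: "0 \<in> closure T"
    unfolding closure_approachable
  proof (intro allI impI)
    fix e :: real assume "e > 0"
    then obtain z where "z \<in> S" "dist z 1 < e" using S(4) unfolding closure_approachable by blast
    then show "\<exists>y\<in>T. dist y 0 < e"
      by (intro bexI[of _ "1 - z"]) (auto simp: T_def dist_norm norm_minus_commute)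
  qed
  show ?thesis
  proof (rule local_exponents_independent[OF opT clT _ _ gauss_F_holomorphic[OF one_params(1)[OF s]]
        gauss_F_holomorphic[OF one_params(2)[OF s]]])
    show "0 \<notin> T" using S by (simp add: T_def)
    show "(0::complex) \<noteq> c - a - b" using s by (metis Ints_0)
    fix u assume u: "u \<in> T"
    have m: "((\<lambda>u. 1 - u) has_field_derivative - 1) (at u)"
      by (auto intro!: derivative_eq_intros)
    show "((\<lambda>u. \<Lambda> (1 - u)) has_field_derivative 1 / u) (at u)"
      using DERIV_chain2[OF \<Lambda> m] u by (simp add: T_def)
    show "k1 * (exp (0 * \<Lambda> (1 - u)) * gauss_F a b (a + b - c + 1) u) +
      k2 * (exp ((c - a - b) * \<Lambda> (1 - u)) * gauss_F (c - a) (c - b) (c - a - b + 1) u) = 0"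
      using eq[of "1 - u"] u by (simp add: T_def one_sol_def one_sol'_def)
  qed auto
qed

lemma has_derivative_Ln_one_minus:
  "z \<in> slit \<Longrightarrow> ((\<lambda>z. Ln (1 - z)) has_field_derivative - (1 / (1 - z))) (at z)"
  by (auto intro!: derivative_eq_intros simp: slit_alt inverse_eq_divide)

text \<open>
  Both sides solve the equation with parameters \<open>c - a, c - b, c\<close> and have the value \<open>1\<close> at \<open>0\<close>.
\<close>

lemma gauss_euler:
  assumes c: "c \<notin> \<int>\<^sub>\<le>\<^sub>0" and f: "hg_sol a b c f slit" "f 0 = 1" and z: "z \<in> ball 0 1"
  shows "exp (- (c - a - b) * Ln (1 - z)) * f z = gauss_F (c - a) (c - b) c z"
proof (rule hg_unique_at_0[OF _ gauss_hg_sol[OF c] _ _ _ c _ z])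
  show "hg_sol (c - a) (c - b) c (\<lambda>z. exp (- (c - a - b) * Ln (1 - z)) * f z) (ball 0 1)"
    by (rule hg_euler[OF hg_sol_subset[OF f(1) disc_subset_slit]])
      (use disc_subset_slit in \<open>auto intro!: has_derivative_Ln_one_minus\<close>)
qed (use f in auto)

section \<open>Connection between the singular points\<close>

text \<open>
  The part of the exterior of the unit disc on which \<open>Ln (- z)\<close> is holomorphic.
\<close>

definition cut_inf :: "complex set" where "cut_inf = {z\<in>slit. norm z > 1}"

lemma open_cut_inf: "open cut_inf"
proof -
  have "cut_inf = slit \<inter> - cball 0 1" by (auto simp: cut_inf_def)
  moreover have "open (slit \<inter> - cball 0 1)" by (intro open_Int open_slit open_Compl closed_cball)
  ultimately show ?thesis by metis
qed

lemma cut_inf_not_real: "z \<in> cut_inf \<Longrightarrow> - z \<notin> \<real>\<^sub>\<le>\<^sub>0"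
  by (auto simp: cut_inf_def slit_def complex_nonpos_Reals_iff cmod_eq_Re)

text \<open>
  The map \<open>\<xi> \<mapsto> - exp \<xi>\<close> sends a convex half-strip onto this region.
\<close>

lemma connected_cut_inf: "connected cut_inf"
proof -
  define R where "R = {\<xi>::complex. Re \<xi> > 0} \<inter> {\<xi>. Im \<xi> < pi} \<inter> {\<xi>. Im \<xi> > - pi}"
  have "convex R" unfolding R_def
    by (intro convex_Int convex_halfspace_Re_gt convex_halfspace_Im_lt convex_halfspace_Im_gt)
  moreover have "cut_inf = (\<lambda>\<xi>. - exp \<xi>) ` R"
  proof (intro equalityI subsetI)
    fix z assume z: "z \<in> cut_inf"
    then have z1: "norm z > 1" and nr: "- z \<notin> \<real>\<^sub>\<le>\<^sub>0" using cut_inf_not_real by (auto simp: cut_inf_def)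
    then have "- z \<noteq> 0" by auto
    moreover have "Im (Ln (- z)) < pi" "Im (Ln (- z)) > - pi"
      using Im_Ln_less_pi[OF nr] mpi_less_Im_Ln[OF \<open>- z \<noteq> 0\<close>] by auto
    moreover have "Re (Ln (- z)) > 0" using z1 \<open>- z \<noteq> 0\<close> by simp
    ultimately show "z \<in> (\<lambda>\<xi>. - exp \<xi>) ` R"
      by (intro image_eqI[of _ _ "Ln (- z)"]) (auto simp: R_def)
  next
    fix z assume "z \<in> (\<lambda>\<xi>. - exp \<xi>) ` R"
    then obtain \<xi> where \<xi>: "\<xi> \<in> R" "z = - exp \<xi>" by blast
    have "z \<in> slit" unfolding slit_def
    proof (simp, intro impI)
      assume "Im z = 0"
      then have "sin (Im \<xi>) = 0" using \<xi>(2) by (simp add: Im_exp)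
      then have "Im \<xi> = 0"
        using \<xi>(1) sin_eq_0_pi unfolding R_def by (metis (no_types, lifting) IntD1 IntD2 mem_Collect_eq)
      then show "Re z < 1" using \<xi>(2) by (simp add: Re_exp less_trans[of _ 0])
    qed
    then show "z \<in> cut_inf" using \<xi> by (simp add: cut_inf_def R_def)
  qed
  moreover have "connected ((\<lambda>\<xi>. - exp \<xi>) ` R)"
    using \<open>convex R\<close> by (intro connected_continuous_image continuous_intros convex_connected)
  ultimately show ?thesis by simp
qed

lemma unbounded_cut_inf: "\<not> bounded cut_inf"
  unfolding bounded_iff
proof
  assume "\<exists>B. \<forall>z\<in>cut_inf. norm z \<le> B"
  then obtain B where B: "\<And>z. z \<in> cut_inf \<Longrightarrow> norm z \<le> B" by blast
  define z where "z = - complex_of_real (\<bar>B\<bar> + 2)"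
  have z: "norm z = \<bar>B\<bar> + 2" "Re z = - (\<bar>B\<bar> + 2)"
    unfolding z_def norm_minus_cancel norm_of_real by simp_all
  then have "z \<in> cut_inf" by (auto simp: cut_inf_def slit_def)
  from B[OF this] z(1) show False by simp
qed

lemma connected_slit_near_1: "connected (slit \<inter> ball 1 1)"
proof (rule starlike_imp_connected, unfold starlike_def, intro bexI[of _ "1/2"] ballI subsetI)
  fix z p :: complex assume z: "z \<in> slit \<inter> ball 1 1" and "p \<in> closed_segment (1/2) z"
  then obtain t :: real where t: "0 \<le> t" "t \<le> 1" "p = (1 - of_real t) * (1/2) + of_real t * z"
    by (auto simp: closed_segment_def scaleR_conv_of_real)
  have "p \<in> ball 1 1"
    using \<open>p \<in> closed_segment (1/2) z\<close> z closed_segment_subset[of "1/2" "ball 1 1 :: complex set" z]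
    by (auto simp: dist_norm)
  moreover have "p \<in> slit" unfolding slit_def
  proof (simp, intro impI)
    assume "Im p = 0"
    show "Re p < 1"
    proof (cases "t = 0")
      case False
      with \<open>Im p = 0\<close> t z have "Re z < 1" by (auto simp: slit_def)
      then have "t * Re z < t" using t False by simp
      then have "(1 - t) / 2 + t * Re z < 1" using t by argo
      then show ?thesis using t by simp
    next
      case True
      then have "p = 1 / 2" using t(3) by simp
      then show ?thesis by (simp only:) simp
    qed
  qed
  ultimately show "p \<in> slit \<inter> ball 1 1" by blast
qed (auto simp: slit_def dist_norm)

lemma exp_pi_i_eq_Ints:
  assumes "exp (- (of_real pi * \<i> * e)) = exp (of_real pi * \<i> * e)"
  shows "e \<in> \<int>"
proof -
  from assms obtain n :: int where "- (of_real pi * \<i> * e) = of_real pi * \<i> * e + of_int (2 * n) * of_real pi * \<i>"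
    unfolding exp_eq by (auto simp: mult_ac)
  then have "of_real pi * \<i> * (2 * (e + of_int n)) = 0" by (simp add: algebra_simps)
  then have "e = - of_int n" by (simp add: add_eq_0_iff2)
  then show ?thesis by simp
qed

text \<open>
  Across \<open>(1, 2)\<close> the function \<open>f\<close> continues from above and from below to the right half \<open>U\<close> of the disc
  around \<open>1\<close>. By the expansion at infinity the two continuations are \<open>exp (\<plusminus> \<pi> i e)\<close> times the same function
  \<open>y\<close>; by the expansion at \<open>1\<close> they are \<open>A h + B exp (\<mp> \<pi> i s) k\<close> with \<open>s = c - a - b\<close>. Elimination of \<open>y\<close> gives a linear
  relation between the independent functions \<open>h\<close> and \<open>k\<close>. If \<open>A\<close> and \<open>B\<close> were both nonzero, \<open>e\<close> and \<open>e + s\<close>, and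
  therefore \<open>s\<close>, would be integers.
\<close>

lemma pure_exponent_at_infinity:
  assumes s: "c - a - b \<notin> \<int>"
    and near1: "\<And>z. z \<in> slit \<inter> ball 1 1 \<Longrightarrow>
      f z = A * one_sol a b c z + B * (exp ((c - a - b) * Ln (1 - z)) * one_sol' a b c z)"
    and G: "G holomorphic_on ball 0 1"
    and inf: "\<And>z. z \<in> cut_inf \<Longrightarrow> f z = exp (- e * Ln (- z)) * G (1 / z)"
  shows "A = 0 \<or> B = 0"
proof -
  define U where "U = ball 1 1 \<inter> {z::complex. Re z > 1}"
  have opU: "open U" and cvU: "convex U"
    unfolding U_def by (auto intro!: open_Int convex_Int simp: open_halfspace_Re_gt convex_halfspace_Re_gt)
  define s where "s = c - a - b"
  define k where "k = (\<lambda>z. exp (s * Ln (z - 1)) * one_sol' a b c z)"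
  define y where "y = (\<lambda>z. exp (- e * Ln z) * G (1 / z))"
  have Un: "norm z > 1" "z \<notin> \<real>\<^sub>\<le>\<^sub>0" "z - 1 \<notin> \<real>\<^sub>\<le>\<^sub>0" "z \<in> ball 1 1" if "z \<in> U" for z
    using that complex_Re_le_cmod[of z] by (auto simp: U_def complex_nonpos_Reals_iff)
  have h1: "one_sol a b c holomorphic_on U"
    by (rule holomorphic_on_subset[OF one_sol_holomorphic(1)[OF assms(1)]]) (auto simp: U_def)
  have h2: "k holomorphic_on U" unfolding k_def using Un
    by (intro holomorphic_intros holomorphic_on_subset[OF one_sol_holomorphic(2)[OF assms(1)]]) (auto simp: U_def)
  have "(G \<circ> (\<lambda>z. 1 / z)) holomorphic_on U"
  proof (rule holomorphic_on_compose_gen[OF _ G])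
    show "(\<lambda>z. 1 / z) holomorphic_on U" using Un(1) by (intro holomorphic_intros) force
    show "(\<lambda>z. 1 / z) ` U \<subseteq> ball 0 1"
    proof
      fix w assume "w \<in> (\<lambda>z. 1 / z) ` U"
      then obtain z where "z \<in> U" "w = 1 / z" by blast
      then show "w \<in> ball 0 1" using Un(1)[of z] by (simp add: norm_divide divide_less_eq)
    qed
  qed
  then have h3: "y holomorphic_on U" unfolding y_def using Un
    by (intro holomorphic_intros) (auto simp: o_def)
  have rel: "A * one_sol a b c z + B * (exp (- (\<sigma> * pi * \<i> * s)) * k z) = exp (\<sigma> * pi * \<i> * e) * y z"
    if \<sigma>: "\<sigma> = 1 \<or> \<sigma> = -1" and z: "z \<in> U" for \<sigma> :: real and z
  proof -
    define V where "V = U \<inter> {z. \<sigma> * Im z > 0}"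
    have V: "\<sigma> * Im z > 0" "z \<in> U" if "z \<in> V" for z using that by (auto simp: V_def)
    have "{z. \<sigma> * Im z > 0} = {z. Im z > 0} \<or> {z. \<sigma> * Im z > 0} = {z. Im z < 0}"
      using \<sigma> by auto
    then have opV: "open V" using opU unfolding V_def
      by (metis open_Int open_halfspace_Im_gt open_halfspace_Im_lt)
    have "Complex (5/4) (\<sigma> / 4) \<in> V" using \<sigma> by (auto simp: V_def U_def dist_norm cmod_def power2_eq_square)
    then have neV: "V \<noteq> {}" by blast
    define P where "P = (\<lambda>z. A * one_sol a b c z + B * (exp (- (\<sigma> * pi * \<i> * s)) * k z) - exp (\<sigma> * pi * \<i> * e) * y z)"
    have hP: "P holomorphic_on U" unfolding P_def by (intro holomorphic_intros h1 h2 h3)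
    have LnV: "Ln (- w) = Ln w - \<sigma> * pi * \<i>" if "\<sigma> * Im w > 0" for w
    proof -
      have "w \<noteq> 0" using that by auto
      then show ?thesis using that \<sigma> by (auto simp: Ln_minus)
    qed
    have P0: "P z = 0" if z: "z \<in> V" for z
    proof -
      have sl: "z \<in> slit" using V[OF z] by (auto simp: slit_def)
      have 1: "Ln (1 - z) = Ln (z - 1) - \<sigma> * pi * \<i>" using LnV[of "z - 1"] V[OF z] by simp
      have 2: "Ln (- z) = Ln z - \<sigma> * pi * \<i>" using LnV V[OF z] by blast
      have e1: "exp (s * (Ln (z - 1) - \<sigma> * pi * \<i>)) = exp (- (\<sigma> * pi * \<i> * s)) * exp (s * Ln (z - 1))"
        by (simp add: exp_add[symmetric] algebra_simps)
      have e2: "exp (- e * (Ln z - \<sigma> * pi * \<i>)) = exp (\<sigma> * pi * \<i> * e) * exp (- e * Ln z)"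
        by (simp add: exp_add[symmetric] algebra_simps)
      have "f z = A * one_sol a b c z + B * (exp (- (\<sigma> * pi * \<i> * s)) * k z)"
        using near1[of z] sl Un(4)[OF V(2)[OF z]]
        unfolding 1 k_def s_def[symmetric] e1 by (simp add: mult.assoc)
      moreover have "f z = exp (\<sigma> * pi * \<i> * e) * y z"
        using inf[of z] sl Un(1)[OF V(2)[OF z]]
        unfolding 2 y_def e2 by (simp add: cut_inf_def mult.assoc)
      ultimately show "P z = 0" by (simp add: P_def)
    qed
    have "P z = 0"
      by (rule analytic_continuation_open[OF opV opU neV convex_connected[OF cvU] _ hP _ _ z, where g = "\<lambda>_. 0"])
        (auto simp: V_def[symmetric] P0 V(2))
    then show ?thesis by (simp add: P_def)
  qed
  define \<epsilon> where "\<epsilon> = of_real pi * \<i> * e"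
  define \<tau> where "\<tau> = of_real pi * \<i> * s"
  have comb: "A * (exp (- \<epsilon>) - exp \<epsilon>) * one_sol a b c z + B * (exp (- (\<epsilon> + \<tau>)) - exp (\<epsilon> + \<tau>)) * k z = 0"
    if z: "z \<in> U" for z
  proof -
    have r1: "A * one_sol a b c z + B * (exp (- \<tau>) * k z) = exp \<epsilon> * y z"
      using rel[of 1 z] z by (simp add: \<epsilon>_def \<tau>_def)
    have r2: "A * one_sol a b c z + B * (exp \<tau> * k z) = exp (- \<epsilon>) * y z"
      using rel[of "-1" z] z by (simp add: \<epsilon>_def \<tau>_def)
    have i: "exp (- \<epsilon>) * exp \<epsilon> = 1" by (simp add: exp_add[symmetric])
    have "exp (- \<epsilon>) * (A * one_sol a b c z + B * (exp (- \<tau>) * k z)) =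
       exp \<epsilon> * (A * one_sol a b c z + B * (exp \<tau> * k z))"
      unfolding r1 r2 using i by (simp add: mult_ac)
    then have "(A * (exp (- \<epsilon>) - exp \<epsilon>)) * one_sol a b c z + B * (exp (- \<epsilon>) * exp (- \<tau>) - exp \<epsilon> * exp \<tau>) * k z = 0"
      by (simp add: algebra_simps)
    moreover have "exp (- \<epsilon>) * exp (- \<tau>) = exp (- (\<epsilon> + \<tau>))" "exp \<epsilon> * exp \<tau> = exp (\<epsilon> + \<tau>)"
      by (simp_all add: exp_add[symmetric])
    ultimately show ?thesis by (simp only:)
  qed
  have zero: "A * (exp (- \<epsilon>) - exp \<epsilon>) = 0 \<and> B * (exp (- (\<epsilon> + \<tau>)) - exp (\<epsilon> + \<tau>)) = 0"
  proof (rule one_independent[OF assms(1) opU])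
    show "U \<subseteq> ball 1 1" "1 \<notin> U" by (auto simp: U_def)
    show "1 \<in> closure U" unfolding closure_approachable
    proof (intro allI impI)
      fix d :: real assume d: "d > 0"
      define z where "z = complex_of_real (1 + min (1/2) (d/2))"
      have "z - 1 = of_real (min (1/2) (d/2))" by (simp add: z_def)
      then have "norm (z - 1) = min (1/2) (d/2)" using d by simp
      then have "z \<in> U" "dist z 1 < d" using d
        by (auto simp: U_def dist_norm norm_minus_commute z_def)
      then show "\<exists>y\<in>U. dist y 1 < d" by blast
    qed
    fix z assume z: "z \<in> U"
    have "((\<lambda>z. Ln (z - 1)) has_field_derivative 1 / (z - 1)) (at z)"
      using Un(3)[OF z] by (auto intro!: derivative_eq_intros simp: inverse_eq_divide)
    moreover have "- (1 / (1 - z)) = 1 / (z - 1)" by (metis minus_diff_eq minus_divide_right)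
    ultimately show "((\<lambda>z. Ln (z - 1)) has_field_derivative - (1 / (1 - z))) (at z)" by simp
    show "A * (exp (- \<epsilon>) - exp \<epsilon>) * one_sol a b c z +
      B * (exp (- (\<epsilon> + \<tau>)) - exp (\<epsilon> + \<tau>)) * (exp ((c - a - b) * Ln (z - 1)) * one_sol' a b c z) = 0"
      using comb[OF z] by (simp add: k_def s_def)
  qed
  show ?thesis
  proof (rule ccontr)
    assume "\<not> (A = 0 \<or> B = 0)"
    with zero have z: "exp (- \<epsilon>) = exp \<epsilon>" "exp (- (\<epsilon> + \<tau>)) = exp (\<epsilon> + \<tau>)" by auto
    have "e \<in> \<int>" using z(1) unfolding \<epsilon>_def by (rule exp_pi_i_eq_Ints)
    moreover have "e + s \<in> \<int>" by (rule exp_pi_i_eq_Ints) (use z(2) in \<open>simp add: \<epsilon>_def \<tau>_def algebra_simps\<close>)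
    ultimately have "e + s - e \<in> \<int>" by (intro Ints_diff)
    then show False using assms(1) by (simp add: s_def)
  qed
qed

text \<open>
  \<open>B = 0\<close> would make \<open>f\<close> regular at \<open>1\<close>, and \<open>A = 0\<close> would do the same for its Euler transform; both
  contradict the exact radius of convergence unless a series terminates. With \<open>A\<close> and \<open>B\<close> nonzero, both
  exponents must occur at infinity.
\<close>

lemma gauss_connection:
  assumes c: "c \<notin> \<int>" and s: "c - a - b \<notin> \<int>" and ab: "a - b \<notin> \<int>"
  obtains f A B C\<^sub>1 C\<^sub>2 where "hg_sol a b c f slit" "\<And>z. z \<in> ball 0 1 \<Longrightarrow> f z = gauss_F a b c z"
    "\<And>z. z \<in> slit \<inter> ball 1 1 \<Longrightarrow>
      f z = A * one_sol a b c z + B * (exp ((c - a - b) * Ln (1 - z)) * one_sol' a b c z)"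
    "\<And>z. z \<in> cut_inf \<Longrightarrow>
      f z = C\<^sub>1 * inf_sol a b c (\<lambda>z. Ln (- z)) z + C\<^sub>2 * inf_sol b a c (\<lambda>z. Ln (- z)) z"
    "a \<notin> \<int>\<^sub>\<le>\<^sub>0 \<Longrightarrow> b \<notin> \<int>\<^sub>\<le>\<^sub>0 \<Longrightarrow> B \<noteq> 0"
    "a \<notin> \<int>\<^sub>\<le>\<^sub>0 \<Longrightarrow> b \<notin> \<int>\<^sub>\<le>\<^sub>0 \<Longrightarrow> c - a \<notin> \<int>\<^sub>\<le>\<^sub>0 \<Longrightarrow> c - b \<notin> \<int>\<^sub>\<le>\<^sub>0 \<Longrightarrow> C\<^sub>1 \<noteq> 0 \<and> C\<^sub>2 \<noteq> 0"
proof -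
  have c': "c \<notin> \<int>\<^sub>\<le>\<^sub>0" using c by (rule Ints_minus_nonpos)
  obtain f where f: "hg_sol a b c f slit" "\<And>z. z \<in> ball 0 1 \<Longrightarrow> f z = gauss_F a b c z"
    using gauss_continuation[OF c'] by metis
  have f0: "f 0 = 1" using f(2)[of 0] by simp
  have S1: "open (slit \<inter> ball 1 1)" "1 \<notin> slit \<inter> ball 1 1" "0 \<notin> slit \<inter> ball 1 1" "slit \<inter> ball 1 1 \<subseteq> ball 1 1"
    using open_slit one_not_in_slit by auto
  have d1: "((\<lambda>z. Ln (1 - z)) has_field_derivative - (1 / (1 - z))) (at z)" if "z \<in> slit \<inter> ball 1 1" for z
    using that has_derivative_Ln_one_minus by blast
  have "1 \<in> closure (slit \<inter> ball 1 1)" unfolding closure_approachable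
  proof (intro allI impI)
    fix d :: real assume d: "d > 0"
    define z where "z = complex_of_real (1 - min (1/2) (d/2))"
    have "1 - z = of_real (min (1/2) (d/2))" by (simp add: z_def)
    then have "norm (1 - z) = min (1/2) (d/2)" using d by simp
    then have "z \<in> slit \<inter> ball 1 1" "dist z 1 < d" using d
      by (auto simp: slit_def dist_norm norm_minus_commute z_def)
    then show "\<exists>y\<in>slit \<inter> ball 1 1. dist y 1 < d" by blast
  qed
  note ind = one_independent[OF s S1(1,4,2) this d1]
  obtain A B where AB: "\<And>z. z \<in> slit \<inter> ball 1 1 \<Longrightarrow>
      f z = A * one_sol a b c z + B * (exp ((c - a - b) * Ln (1 - z)) * one_sol' a b c z)"
  proof -
    have ne: "slit \<inter> ball 1 1 \<noteq> {}" using \<open>1 \<in> closure (slit \<inter> ball 1 1)\<close> by auto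
    show ?thesis
      by (rule hg_span[OF hg_sol_subset[OF hg_one_sol[OF s] S1(4)] hg_one_sol'[OF s S1(1,4,2) d1]
          S1(1) connected_slit_near_1 S1(3,2) ind S1(1) connected_slit_near_1 subset_refl ne
          hg_sol_subset[OF f(1) Int_lower1]]) (use that in blast)+
  qed
  have d2: "((\<lambda>z. Ln (- z)) has_field_derivative 1 / z) (at z)" if "z \<in> cut_inf" for z
    using cut_inf_not_real[OF that] by (auto intro!: derivative_eq_intros simp: inverse_eq_divide)
  have gt1: "norm z > 1" if "z \<in> cut_inf" for z using that by (simp add: cut_inf_def)
  obtain C\<^sub>1 C\<^sub>2 where C: "\<And>z. z \<in> cut_inf \<Longrightarrow>
      f z = C\<^sub>1 * inf_sol a b c (\<lambda>z. Ln (- z)) z + C\<^sub>2 * inf_sol b a c (\<lambda>z. Ln (- z)) z"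
  proof -
    have ne: "cut_inf \<noteq> {}" using unbounded_cut_inf by auto
    have sub: "cut_inf \<subseteq> slit" by (auto simp: cut_inf_def)
    show ?thesis
      by (rule inf_span[OF ab open_cut_inf connected_cut_inf gt1 unbounded_cut_inf d2 open_cut_inf connected_cut_inf
          subset_refl ne hg_sol_subset[OF f(1) sub]]) (use that in blast)+
  qed
  have Bnz: "B \<noteq> 0" if "a \<notin> \<int>\<^sub>\<le>\<^sub>0" "b \<notin> \<int>\<^sub>\<le>\<^sub>0"
  proof
    assume "B = 0"
    show False
      by (rule gauss_not_regular_at_1[OF c' that hg_sol_holo[OF f(1)] f(2), of "\<lambda>z. A * one_sol a b c z"])
        (use AB \<open>B = 0\<close> in \<open>auto intro!: holomorphic_intros one_sol_holomorphic[OF s]\<close>)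
  qed
  have Anz: "A \<noteq> 0" if "c - a \<notin> \<int>\<^sub>\<le>\<^sub>0" "c - b \<notin> \<int>\<^sub>\<le>\<^sub>0"
  proof
    assume A: "A = 0"
    define g where "g = (\<lambda>z. exp (- (c - a - b) * Ln (1 - z)) * f z)"
    show False
    proof (rule gauss_not_regular_at_1[OF c' that, of g "\<lambda>z. B * one_sol' a b c z"])
      show "g holomorphic_on slit"
        unfolding g_def using hg_sol_holo[OF f(1)] by (intro holomorphic_intros) (auto simp: slit_alt)
      show "g z = gauss_F (c - a) (c - b) c z" if "z \<in> ball 0 1" for z
        unfolding g_def by (rule gauss_euler[OF c' f(1) f0 that])
      show "(\<lambda>z. B * one_sol' a b c z) holomorphic_on ball 1 1"
        by (intro holomorphic_intros one_sol_holomorphic[OF s])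
      show "g z = B * one_sol' a b c z" if "z \<in> ball 1 1" "z \<in> slit" for z
      proof -
        have "exp (- (c - a - b) * Ln (1 - z)) * exp ((c - a - b) * Ln (1 - z)) = 1"
          by (simp add: exp_add[symmetric] algebra_simps)
        then show ?thesis using AB[of z] that A by (simp add: g_def mult_ac)
      qed
    qed
  qed
  have Cnz: "C\<^sub>1 \<noteq> 0 \<and> C\<^sub>2 \<noteq> 0"
    if "a \<notin> \<int>\<^sub>\<le>\<^sub>0" "b \<notin> \<int>\<^sub>\<le>\<^sub>0" "c - a \<notin> \<int>\<^sub>\<le>\<^sub>0" "c - b \<notin> \<int>\<^sub>\<le>\<^sub>0"
  proof -
    have nint: "a - b + 1 \<notin> \<int>\<^sub>\<le>\<^sub>0" "b - a + 1 \<notin> \<int>\<^sub>\<le>\<^sub>0"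
      using ab by (metis Ints_1 Ints_diff add_diff_cancel_right' Ints_minus_nonpos)
        (metis ab Ints_1 Ints_diff add_diff_cancel_right' Ints_minus_nonpos Ints_minus minus_diff_eq)
    have AB0: "\<not> (A = 0 \<or> B = 0)" using Anz Bnz that by blast
    have "C\<^sub>2 \<noteq> 0"
    proof
      assume "C\<^sub>2 = 0"
      have "A = 0 \<or> B = 0"
        by (rule pure_exponent_at_infinity[OF s AB, where e = a and G = "\<lambda>w. C\<^sub>1 * gauss_F a (a - c + 1) (a - b + 1) w"])
          (use C \<open>C\<^sub>2 = 0\<close> nint in \<open>auto simp: inf_sol_def intro!: holomorphic_intros gauss_F_holomorphic\<close>)
      with AB0 show False by blast
    qed
    moreover have "C\<^sub>1 \<noteq> 0"
    proof
      assume "C\<^sub>1 = 0"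
      have "A = 0 \<or> B = 0"
        by (rule pure_exponent_at_infinity[OF s AB, where e = b and G = "\<lambda>w. C\<^sub>2 * gauss_F b (b - c + 1) (b - a + 1) w"])
          (use C \<open>C\<^sub>1 = 0\<close> nint in \<open>auto simp: inf_sol_def intro!: holomorphic_intros gauss_F_holomorphic\<close>)
      with AB0 show False by blast
    qed
    ultimately show ?thesis by blast
  qed
  show ?thesis using that[OF f AB C Bnz Cnz] by blast
qed

section \<open>Holomorphic functions of two variables\<close>

lemma holo2_on_const: "holo2_on (\<lambda>_. k) S"
  unfolding holo2_on_def by (intro ballI exI[of _ 0]) (simp add: case_prod_unfold)

lemma holo2_on_fst: "holo2_on fst S"
  unfolding holo2_on_def
  by (intro ballI exI[of _ 1] exI[of _ 0]) (auto intro!: derivative_eq_intros simp: fun_eq_iff)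

lemma holo2_on_snd: "holo2_on snd S"
  unfolding holo2_on_def
  by (rule ballI, rule exI[of _ 0], rule exI[of _ 1]) (auto intro!: derivative_eq_intros simp: fun_eq_iff)

lemma holo2_on_add:
  assumes "holo2_on f S" "holo2_on g S"
  shows "holo2_on (\<lambda>P. f P + g P) S"
  unfolding holo2_on_def
proof
  fix P assume "P \<in> S"
  with assms obtain a b c d where
    "(f has_derivative (\<lambda>(h, k). a * h + b * k)) (at P)" "(g has_derivative (\<lambda>(h, k). c * h + d * k)) (at P)"
    unfolding holo2_on_def by meson
  from has_derivative_add[OF this]
  show "\<exists>d\<^sub>1 d\<^sub>2. ((\<lambda>P. f P + g P) has_derivative (\<lambda>(h, k). d\<^sub>1 * h + d\<^sub>2 * k)) (at P)"
    by (intro exI[of _ "a + c"] exI[of _ "b + d"]) (simp add: case_prod_unfold algebra_simps)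
qed

lemma holo2_on_mult:
  assumes "holo2_on f S" "holo2_on g S"
  shows "holo2_on (\<lambda>P. f P * g P) S"
  unfolding holo2_on_def
proof
  fix P assume "P \<in> S"
  with assms obtain a b c d where
    "(f has_derivative (\<lambda>(h, k). a * h + b * k)) (at P)" "(g has_derivative (\<lambda>(h, k). c * h + d * k)) (at P)"
    unfolding holo2_on_def by meson
  from has_derivative_mult[OF this]
  show "\<exists>d\<^sub>1 d\<^sub>2. ((\<lambda>P. f P * g P) has_derivative (\<lambda>(h, k). d\<^sub>1 * h + d\<^sub>2 * k)) (at P)"
    by (intro exI[of _ "f P * c + a * g P"] exI[of _ "f P * d + b * g P"])
      (simp add: case_prod_unfold algebra_simps)
qed

lemma holo2_on_compose:
  assumes "holo2_on f S" "\<And>P. P \<in> S \<Longrightarrow> g field_differentiable at (f P)"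
  shows "holo2_on (\<lambda>P. g (f P)) S"
  unfolding holo2_on_def
proof
  fix P assume P: "P \<in> S"
  with assms(1) obtain a b where
    f: "(f has_derivative (\<lambda>(h, k). a * h + b * k)) (at P)"
    unfolding holo2_on_def by meson
  obtain D where "(g has_field_derivative D) (at (f P))"
    using assms(2)[OF P] unfolding field_differentiable_def by blast
  then have "(g has_derivative (\<lambda>h. D * h)) (at (f P))" by (simp add: has_field_derivative_def)
  from has_derivative_compose[OF f this]
  show "\<exists>d\<^sub>1 d\<^sub>2. ((\<lambda>P. g (f P)) has_derivative (\<lambda>(h, k). d\<^sub>1 * h + d\<^sub>2 * k)) (at P)"
    by (intro exI[of _ "D * a"] exI[of _ "D * b"]) (simp add: case_prod_unfold algebra_simps)
qed

lemma holo2_on_power: "holo2_on f S \<Longrightarrow> holo2_on (\<lambda>P. f P ^ k) S"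
  by (rule holo2_on_compose[where g = "\<lambda>w. w ^ k"])
    (auto simp: field_differentiable_def intro!: derivative_eq_intros exI)

lemma holo2_on_inverse:
  "holo2_on f S \<Longrightarrow> (\<And>P. P \<in> S \<Longrightarrow> f P \<noteq> 0) \<Longrightarrow> holo2_on (\<lambda>P. inverse (f P)) S"
  by (rule holo2_on_compose[where g = inverse]) (auto intro!: field_differentiable_inverse)

lemma holo2_on_exp: "holo2_on f S \<Longrightarrow> holo2_on (\<lambda>P. exp (f P)) S"
  by (rule holo2_on_compose[where g = exp]) (auto simp: field_differentiable_within_exp)

lemma holo2_on_Ln:
  "holo2_on f S \<Longrightarrow> (\<And>P. P \<in> S \<Longrightarrow> f P \<notin> \<real>\<^sub>\<le>\<^sub>0) \<Longrightarrow> holo2_on (\<lambda>P. Ln (f P)) S"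
  by (rule holo2_on_compose[where g = Ln]) (auto intro!: field_differentiable_at_Ln)

lemmas holo2_intros = holo2_on_const holo2_on_fst holo2_on_snd holo2_on_add holo2_on_mult
  holo2_on_power holo2_on_inverse holo2_on_exp holo2_on_Ln

lemma holo2_on_subset: "holo2_on f S \<Longrightarrow> T \<subseteq> S \<Longrightarrow> holo2_on f T"
  by (auto simp: holo2_on_def)

lemma holo2_on_isCont: "holo2_on f S \<Longrightarrow> P \<in> S \<Longrightarrow> isCont f P"
  unfolding holo2_on_def using has_derivative_continuous by blast

text \<open>
  The complex line through \<open>P\<close> in direction \<open>V\<close>, in coordinates because pairs carry only real scalar
  multiplication.
\<close>

definition line2 :: "complex \<times> complex \<Rightarrow> complex \<times> complex \<Rightarrow> complex \<Rightarrow> complex \<times> complex"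
  where "line2 P V s = (fst P + s * fst V, snd P + s * snd V)"

lemma line2_has_derivative: "(line2 P V has_derivative (\<lambda>h. (h * fst V, h * snd V))) (at s)"
  unfolding line2_def[abs_def] by (auto intro!: derivative_eq_intros)

lemma continuous_line2: "continuous_on S (line2 P V)"
  unfolding line2_def[abs_def] by (intro continuous_intros)

lemma open_line2_vimage: "open S \<Longrightarrow> open (line2 P V -` S)"
  using continuous_line2[of UNIV] by (intro continuous_open_vimage) (auto simp: continuous_on_eq_continuous_at)

lemma convex_line2_vimage: "convex S \<Longrightarrow> convex (line2 P V -` S)"
proof (rule convexI)
  fix s t :: complex and u v :: real
  assume S: "convex S" and st: "s \<in> line2 P V -` S" "t \<in> line2 P V -` S" and uv: "0 \<le> u" "0 \<le> v" "u + v = 1"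
  have v: "v = 1 - u" using uv by simp
  have "line2 P V (u *\<^sub>R s + v *\<^sub>R t) = u *\<^sub>R line2 P V s + v *\<^sub>R line2 P V t"
    unfolding v by (simp add: line2_def prod_eq_iff scaleR_conv_of_real algebra_simps)
  then show "u *\<^sub>R s + v *\<^sub>R t \<in> line2 P V -` S"
    using convexD[OF S _ _ uv] st by simp
qed

lemma holo2_line:
  assumes "holo2_on f S"
  shows "(\<lambda>s. f (line2 P V s)) holomorphic_on line2 P V -` S"
  unfolding holomorphic_on_def
proof
  fix s assume "s \<in> line2 P V -` S"
  then have "line2 P V s \<in> S" by simp
  with assms obtain a b where
    f: "(f has_derivative (\<lambda>(h, k). a * h + b * k)) (at (line2 P V s))"
    unfolding holo2_on_def by meson
  from has_derivative_compose[OF line2_has_derivative this]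
  moreover have "(\<lambda>h. case (h * fst V, h * snd V) of (h, k) \<Rightarrow> a * h + b * k) = (*) (a * fst V + b * snd V)"
    by (simp add: fun_eq_iff algebra_simps)
  ultimately have "((\<lambda>s. f (line2 P V s)) has_field_derivative (a * fst V + b * snd V)) (at s)"
    unfolding has_field_derivative_def by simp
  then show "(\<lambda>s. f (line2 P V s)) field_differentiable at s within line2 P V -` S"
    using field_differentiable_at_within field_differentiable_def by blast
qed

text \<open>
  On the complex line that joins \<open>Q\<close> to \<open>R\<close> this is the identity theorem in one variable.
\<close>

lemma holo2_identity:
  assumes B: "open B" "convex B" and fg: "holo2_on f B" "holo2_on g B"
    and Q: "Q \<in> B" "\<forall>\<^sub>F R in nhds Q. f R = g R" and R: "R \<in> B"
  shows "f R = g R"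
proof -
  define V where "V = (fst R - fst Q, snd R - snd Q)"
  have l: "line2 Q V 0 = Q" "line2 Q V 1 = R" by (simp_all add: line2_def V_def)
  obtain S where S: "open S" "Q \<in> S" "\<And>R. R \<in> S \<Longrightarrow> f R = g R"
    using Q(2) unfolding eventually_nhds by blast
  define T where "T = line2 Q V -` B"
  have T: "open T" "convex T" "0 \<in> T" "1 \<in> T"
    using B Q R l by (auto simp: T_def open_line2_vimage convex_line2_vimage)
  have "f (line2 Q V 1) = g (line2 Q V 1)"
  proof (rule analytic_continuation_open[of "T \<inter> line2 Q V -` S" T
        "\<lambda>s. f (line2 Q V s)" "\<lambda>s. g (line2 Q V s)"])
    show "open (T \<inter> line2 Q V -` S)" using T S by (intro open_Int open_line2_vimage)
    show "T \<inter> line2 Q V -` S \<noteq> {}" using T(3) S(2) l by auto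
    show "(\<lambda>s. f (line2 Q V s)) holomorphic_on T" "(\<lambda>s. g (line2 Q V s)) holomorphic_on T"
      unfolding T_def by (rule holo2_line[OF fg(1)], rule holo2_line[OF fg(2)])
  qed (use T S in \<open>auto simp: convex_connected\<close>)
  then show ?thesis by (simp add: l)
qed

text \<open>
  On the complex line through two points of the set, the first coordinate is constant or vanishes at a
  single point, and a convex open subset of the plane stays connected when one point is removed.
\<close>

lemma connected_minus_fst_0:
  assumes B: "open B" "convex (B :: (complex \<times> complex) set)"
  shows "connected {P\<in>B. fst P \<noteq> 0}"
  unfolding connected_iff_connected_component
proof (intro ballI)
  fix Q R assume QR: "Q \<in> {P\<in>B. fst P \<noteq> 0}" "R \<in> {P\<in>B. fst P \<noteq> 0}"
  define V where "V = (fst R - fst Q, snd R - snd Q)"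
  have l: "line2 Q V 0 = Q" "line2 Q V 1 = R" by (simp_all add: line2_def V_def)
  define s0 where "s0 = - fst Q / fst V"
  define T where "T = line2 Q V -` B - {s0}"
  have zero: "fst (line2 Q V s) = 0 \<Longrightarrow> s = s0" for s
    using QR by (cases "fst V = 0") (auto simp: line2_def s0_def field_simps add_eq_0_iff)
  have zero': "fst (line2 Q V s0) \<noteq> 0 \<Longrightarrow> fst V = 0"
    by (cases "fst V = 0") (auto simp: line2_def s0_def)
  show "connected_component {P\<in>B. fst P \<noteq> 0} Q R"
  proof (cases "fst V = 0")
    case True
    then have c: "fst (line2 Q V s) = fst Q" for s by (simp add: line2_def)
    have "connected (line2 Q V ` (line2 Q V -` B))"
      by (intro connected_continuous_image continuous_line2 convex_connected convex_line2_vimage B)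
    then show ?thesis unfolding connected_component_def
      by (rule_tac exI[of _ "line2 Q V ` (line2 Q V -` B)"])
        (use QR c l in \<open>auto intro: image_eqI[of _ _ 0] image_eqI[of _ _ 1]\<close>)
  next
    case False
    have "connected T" unfolding T_def
      by (intro connected_open_delete open_line2_vimage B convex_connected convex_line2_vimage) simp
    then have "connected (line2 Q V ` T)"
      by (intro connected_continuous_image continuous_line2)
    moreover have "0 \<in> T" "1 \<in> T" using QR l zero' False unfolding T_def by auto
    moreover have "line2 Q V ` T \<subseteq> {P\<in>B. fst P \<noteq> 0}" using zero by (auto simp: T_def)
    ultimately show ?thesis unfolding connected_component_def
      by (rule_tac exI[of _ "line2 Q V ` T"]) (use l in \<open>force\<close>)
  qed
qed

section \<open>Branches generated by a local system\<close>

definition zmap :: "nat \<Rightarrow> nat \<Rightarrow> complex \<times> complex \<Rightarrow> complex"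
  where "zmap n q P = z_var n q (fst P) (snd P)"

definition pullback :: "nat \<Rightarrow> nat \<Rightarrow> nat \<Rightarrow> (complex \<Rightarrow> complex) \<Rightarrow> complex \<times> complex \<Rightarrow> complex"
  where "pullback n q l y P = snd P ^ l * y (zmap n q P)"

lemma U_sol_pullback: "U_sol n q l a b c = pullback n q l (gauss_F a b c)"
  by (simp add: U_sol_def pullback_def zmap_def fun_eq_iff)

lemma zmap_eq: "zmap n q P = (of_nat q / of_nat (n + 2))\<^sup>2 * (fst P ^ (n + 2) * inverse (snd P ^ q))"
  by (simp add: zmap_def z_var_def divide_inverse)

lemma holo2_on_zmap: "(\<And>P. P \<in> S \<Longrightarrow> snd P \<noteq> 0) \<Longrightarrow> holo2_on (zmap n q) S"
  unfolding zmap_eq[abs_def] by (intro holo2_intros) auto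

lemma holo2_on_pullback:
  assumes "y holomorphic_on A" "open A" "\<And>P. P \<in> S \<Longrightarrow> snd P \<noteq> 0 \<and> zmap n q P \<in> A"
  shows "holo2_on (pullback n q l y) S"
  unfolding pullback_def[abs_def]
  by (intro holo2_intros holo2_on_compose[where g = y] holo2_on_zmap)
    (use assms holomorphic_on_imp_differentiable_at in \<open>auto\<close>)

definition Kset :: "nat \<Rightarrow> nat \<Rightarrow> (complex \<times> complex) set"
  where "Kset n q = K\<^sub>1 \<union> K\<^sub>2 n q"

lemma of_nat_plus_2_nonzero: "of_nat n + 2 \<noteq> (0::complex)" "2 + of_nat n \<noteq> (0::complex)"
  by (metis of_nat_add of_nat_numeral of_nat_eq_0_iff add_is_0 zero_neq_numeral)+

lemma not_in_Kset:
  assumes "q > 0"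
  shows "P \<notin> Kset n q \<longleftrightarrow> snd P \<noteq> 0 \<and> zmap n q P \<noteq> 1"
proof (cases P)
  case (Pair t x)
  then show ?thesis
    by (auto simp: Kset_def K\<^sub>1_def K\<^sub>2_def zmap_def z_var_def field_simps of_nat_plus_2_nonzero)
qed

lemma zmap_eq_0_iff: "q > 0 \<Longrightarrow> snd P \<noteq> 0 \<Longrightarrow> zmap n q P = 0 \<longleftrightarrow> fst P = 0"
  by (auto simp: zmap_def z_var_def of_nat_plus_2_nonzero)

lemma closed_Kset: "closed (Kset n q)"
proof -
  have "Kset n q = {P. snd P = 0} \<union> {P. snd P ^ q - (of_nat q / of_nat (n + 2))\<^sup>2 * fst P ^ (n + 2) = 0}"
    by (auto simp: Kset_def K\<^sub>1_def K\<^sub>2_def)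
  then show ?thesis
    by (auto intro!: closed_Un closed_Collect_eq continuous_intros)
qed

lemma open_\<Omega>: "open (\<Omega> n q r)"
proof -
  have "\<Omega> n q r = {P. norm (snd P ^ q - (of_nat q / of_nat (n + 2))\<^sup>2 * fst P ^ (n + 2)) < r}"
    by (auto simp: \<Omega>_def)
  then show ?thesis
    by (auto intro!: open_Collect_less continuous_intros)
qed

text \<open>
  Germs are represented by functions; \<open>Y z y\<close> means that the germ of \<open>y\<close> at \<open>z\<close> belongs to the system. Around
  every point of \<open>\<complex> - {0, 1}\<close> there is a disc on which all germs of the system extend within the system.
\<close>

definition local_system :: "(complex \<Rightarrow> (complex \<Rightarrow> complex) \<Rightarrow> bool) \<Rightarrow> bool"
  where "local_system Y \<longleftrightarrow> (\<forall>z0. z0 \<noteq> 0 \<longrightarrow> z0 \<noteq> 1 \<longrightarrow> (\<exists>\<epsilon>>0. \<forall>z1\<in>ball z0 \<epsilon>. \<forall>y. Y z1 y \<longrightarrow>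
    (\<exists>y'. y' holomorphic_on ball z0 \<epsilon> \<and> (\<forall>\<^sub>F w in nhds z1. y' w = y w) \<and> (\<forall>z\<in>ball z0 \<epsilon>. Y z y'))))"

definition comes_from ::
  "nat \<Rightarrow> nat \<Rightarrow> nat \<Rightarrow> (complex \<Rightarrow> (complex \<Rightarrow> complex) \<Rightarrow> bool) \<Rightarrow> complex \<times> complex \<Rightarrow>
    (complex \<times> complex \<Rightarrow> complex) \<Rightarrow> bool"
  where "comes_from n q l Y Q g \<longleftrightarrow> (\<exists>y. Y (zmap n q Q) y \<and> same_germ Q g (pullback n q l y))"

lemma comes_from_germ:
  assumes "comes_from n q l Y Q g" "same_germ Q g h"
  shows "comes_from n q l Y Q h"
proof -
  from assms(1) obtain y where y: "Y (zmap n q Q) y" "same_germ Q g (pullback n q l y)"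
    by (auto simp: comes_from_def)
  have "same_germ Q h (pullback n q l y)"
    using y(2) assms(2) unfolding same_germ_def by eventually_elim simp
  with y(1) show ?thesis by (auto simp: comes_from_def)
qed

lemma same_germ_sym: "same_germ P f g \<Longrightarrow> same_germ P g f"
  unfolding same_germ_def by (simp add: eq_commute)

lemma isCont_zmap: "snd P \<noteq> 0 \<Longrightarrow> isCont (zmap n q) P"
  by (rule holo2_on_isCont[OF holo2_on_zmap[of "{P}"]]) auto

text \<open>
  Away from \<open>t = 0\<close>, that is \<open>z = 0\<close>, having the form \<open>x\<^sup>l y(z)\<close> with \<open>y\<close> in the system is both an open and a
  closed condition, and the rest of \<open>B\<close> is connected.
\<close>

lemma comes_from_propagates:
  assumes Y: "local_system Y" and q: "q > 0" and B: "open B" "convex B" "B \<inter> Kset n q = {}"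
    and f: "holo2_on f B"
    and Q: "Q \<in> B" "fst Q \<noteq> 0" "comes_from n q l Y Q f" and R: "R \<in> B" "fst R \<noteq> 0"
  shows "comes_from n q l Y R f"
proof (rule connected_induction_simple[OF connected_minus_fst_0[OF B(1,2)], of Q R "\<lambda>P. comes_from n q l Y P f"])
  fix P assume P: "P \<in> {P\<in>B. fst P \<noteq> 0}"
  define z0 where "z0 = zmap n q P"
  have sndB: "snd P \<noteq> 0" if "P \<in> B" for P
    using B(3) that not_in_Kset[OF q] by blast
  have "z0 \<noteq> 0" "z0 \<noteq> 1"
    using P B(3) not_in_Kset[OF q, of P n] zmap_eq_0_iff[OF q, of P n] by (auto simp: z0_def)
  then obtain \<epsilon> where \<epsilon>: "\<epsilon> > 0" and Y\<epsilon>: "\<And>z1 y. z1 \<in> ball z0 \<epsilon> \<Longrightarrow> Y z1 y \<Longrightarrow>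
    \<exists>y'. y' holomorphic_on ball z0 \<epsilon> \<and> (\<forall>\<^sub>F w in nhds z1. y' w = y w) \<and> (\<forall>z\<in>ball z0 \<epsilon>. Y z y')"
    using Y unfolding local_system_def by meson
  define N where "N = {P\<in>B. fst P \<noteq> 0}"
  have opN: "open N"
  proof -
    have "N = B \<inter> {P. fst P \<noteq> 0}" by (auto simp: N_def)
    then show ?thesis using B by (auto intro!: open_Int open_Collect_neq continuous_intros)
  qed
  have "continuous_on N (zmap n q)"
    by (intro continuous_at_imp_continuous_on ballI isCont_zmap sndB) (auto simp: N_def)
  then have "open (N \<inter> zmap n q -` ball z0 \<epsilon>)"
    by (rule continuous_open_preimage[OF _ opN open_ball])
  moreover have "P \<in> N \<inter> zmap n q -` ball z0 \<epsilon>" using P \<epsilon> by (auto simp: N_def z0_def)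
  ultimately obtain \<eta> where \<eta>: "\<eta> > 0" "ball P \<eta> \<subseteq> N \<inter> zmap n q -` ball z0 \<epsilon>"
    by (meson open_contains_ball)
  have step: "comes_from n q l Y T f" if S: "S \<in> ball P \<eta>" and T: "T \<in> ball P \<eta>" and cS: "comes_from n q l Y S f" for S T
  proof -
    from cS obtain y where y: "Y (zmap n q S) y" "same_germ S f (pullback n q l y)"
      by (auto simp: comes_from_def)
    obtain y' where y': "y' holomorphic_on ball z0 \<epsilon>" "\<forall>\<^sub>F w in nhds (zmap n q S). y' w = y w"
      "\<And>z. z \<in> ball z0 \<epsilon> \<Longrightarrow> Y z y'"
      using Y\<epsilon>[OF _ y(1)] S \<eta>(2) by blast
    have "S \<in> N" using S \<eta>(2) by blast
    then have "snd S \<noteq> 0" using sndB by (simp add: N_def)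
    then have "(zmap n q \<longlongrightarrow> zmap n q S) (nhds S)"
      using isCont_zmap[of S n q] by (simp add: isCont_def tendsto_at_iff_tendsto_nhds)
    then have "\<forall>\<^sub>F R in nhds S. y' (zmap n q R) = y (zmap n q R)"
      by (rule eventually_compose_filterlim[OF y'(2)])
    then have ev: "\<forall>\<^sub>F R in nhds S. f R = pullback n q l y' R"
      using y(2) unfolding same_germ_def pullback_def by eventually_elim simp
    have hol: "holo2_on (pullback n q l y') (ball P \<eta>)"
      by (rule holo2_on_pullback[OF y'(1) open_ball]) (use \<eta>(2) sndB in \<open>auto simp: N_def\<close>)
    have "f R = pullback n q l y' R" if "R \<in> ball P \<eta>" for R
      by (rule holo2_identity[OF open_ball convex_ball _ hol S ev that])
        (use f \<eta>(2) in \<open>auto simp: N_def intro: holo2_on_subset\<close>)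
    then have "same_germ T f (pullback n q l y')"
      unfolding same_germ_def using eventually_nhds_in_open[OF open_ball T] by (auto elim: eventually_mono)
    moreover have "Y (zmap n q T) y'" using y'(3) T \<eta>(2) by blast
    ultimately show ?thesis by (auto simp: comes_from_def)
  qed
  have "openin (top_of_set {P \<in> B. fst P \<noteq> 0}) (ball P \<eta>)"
    unfolding N_def[symmetric] openin_open_eq[OF opN] using \<eta>(2) by simp
  then show "\<exists>T. openin (top_of_set {P \<in> B. fst P \<noteq> 0}) T \<and> P \<in> T \<and>
      (\<forall>x\<in>T. \<forall>y\<in>T. comes_from n q l Y x f \<longrightarrow> comes_from n q l Y y f)"
    using \<eta>(1) step by (intro exI[of _ "ball P \<eta>"]) (simp only: centre_in_ball simp_thms, blast)
qed (use Q R in auto)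

lemma exists_fst_nonzero:
  fixes B :: "(complex \<times> complex) set"
  assumes "open B" "P \<in> B"
  obtains Q where "Q \<in> B" "fst Q \<noteq> 0"
proof -
  obtain e where e: "e > 0" "ball P e \<subseteq> B" using assms open_contains_ball by blast
  define Q where "Q = (if fst P = 0 then (of_real (e / 2), snd P) else P)"
  have "dist P Q < e" using e by (auto simp: Q_def dist_prod_def dist_norm)
  then have "Q \<in> B" "fst Q \<noteq> 0" using e by (auto simp: Q_def)
  then show ?thesis by (rule that)
qed

text \<open>
  The property carried along the path is the form \<open>x\<^sup>l y(z)\<close> at all nearby points with \<open>t \<noteq> 0\<close>. In this
  way a path may cross \<open>t = 0\<close>, where the local system has a singularity: the germ is holomorphic on a whole ball
  there, and its form spreads around the line \<open>t = 0\<close> inside the ball.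
\<close>

lemma continuation_comes_from:
  assumes Y: "local_system Y" and q: "q > 0"
    and cont: "continues_along W \<gamma> f g" and W: "W \<inter> Kset n q = {}"
    and start: "\<forall>\<^sub>F Q in nhds (pathstart \<gamma>). fst Q \<noteq> 0 \<longrightarrow> comes_from n q l Y Q f"
    and fin: "fst (pathfinish \<gamma>) \<noteq> 0"
  shows "comes_from n q l Y (pathfinish \<gamma>) g"
proof -
  obtain F where path: "path \<gamma>" "path_image \<gamma> \<subseteq> W"
    and F: "same_germ (pathstart \<gamma>) (F 0) f" "same_germ (pathfinish \<gamma>) (F 1) g"
    and loc: "\<And>s. s \<in> {0..1} \<Longrightarrow> \<exists>\<epsilon>>0. holo2_on (F s) (ball (\<gamma> s) \<epsilon>) \<and>
          (\<exists>\<delta>>0. \<forall>s'\<in>{0..1}. \<bar>s' - s\<bar> < \<delta> \<longrightarrow>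
             \<gamma> s' \<in> ball (\<gamma> s) \<epsilon> \<and> same_germ (\<gamma> s') (F s') (F s))"
    using cont unfolding continues_along_def by blast
  define good where "good P f \<longleftrightarrow> (\<forall>\<^sub>F Q in nhds P. fst Q \<noteq> 0 \<longrightarrow> comes_from n q l Y Q f)" for P f
  have good_germ: "good P h" if "good P f" "same_germ P f h" for P f h
  proof -
    have "\<forall>\<^sub>F Q in nhds P. same_germ Q f h"
      using that(2) unfolding same_germ_def eventually_eventually .
    with that(1) show ?thesis unfolding good_def
      by eventually_elim (auto intro: comes_from_germ)
  qed
  have "good (\<gamma> 1) (F 1)"
  proof (rule connected_induction_simple[of "{0..1::real}" 0 1 "\<lambda>s. good (\<gamma> s) (F s)"])
    show "good (\<gamma> 0) (F 0)"
      using good_germ[of "\<gamma> 0" f "F 0"] start same_germ_sym[OF F(1)] by (simp add: good_def pathstart_def)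
    fix s :: real assume s: "s \<in> {0..1}"
    from loc[OF s] obtain \<epsilon>' \<delta>' where \<epsilon>': "\<epsilon>' > 0" "holo2_on (F s) (ball (\<gamma> s) \<epsilon>')"
      and \<delta>': "\<delta>' > 0" "\<And>s'. s' \<in> {0..1} \<Longrightarrow> \<bar>s' - s\<bar> < \<delta>' \<Longrightarrow> same_germ (\<gamma> s') (F s') (F s)"
      by blast
    have "\<gamma> s \<in> W" using path(2) s unfolding path_image_def by blast
    then have "\<gamma> s \<in> - Kset n q" using W by blast
    then obtain \<epsilon>'' where \<epsilon>'': "\<epsilon>'' > 0" "ball (\<gamma> s) \<epsilon>'' \<subseteq> - Kset n q"
      using closed_Kset open_Compl open_contains_ball by metis
    define B where "B = ball (\<gamma> s) (min \<epsilon>' \<epsilon>'')"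
    have B: "open B" "convex B" "B \<inter> Kset n q = {}" "holo2_on (F s) B" "\<gamma> s \<in> B"
      using \<epsilon>' \<epsilon>'' by (auto simp: B_def intro: holo2_on_subset)
    define T where "T = {s'\<in>{0..1}. \<bar>s' - s\<bar> < \<delta>' \<and> \<gamma> s' \<in> B}"
    have T: "openin (top_of_set {0..1}) T"
    proof -
      have "T = ({0..1} \<inter> \<gamma> -` B) \<inter> ball s \<delta>'"
        by (auto simp: T_def dist_real_def abs_minus_commute)
      moreover have "openin (top_of_set {0..1}) ({0..1} \<inter> \<gamma> -` B)"
        using path(1) B(1) by (auto simp: path_def intro: continuous_openin_preimage_gen)
      ultimately show ?thesis by (auto simp: openin_Int_open)
    qed
    have "good (\<gamma> y) (F y)" if x: "x \<in> T" and y: "y \<in> T" and gx: "good (\<gamma> x) (F x)" for x y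
    proof -
      have "good (\<gamma> x) (F s)" by (rule good_germ[OF gx]) (use x \<delta>' in \<open>auto simp: T_def\<close>)
      then have "\<forall>\<^sub>F Q in nhds (\<gamma> x). Q \<in> B \<and> (fst Q \<noteq> 0 \<longrightarrow> comes_from n q l Y Q (F s))"
        unfolding good_def using x B(1) by (intro eventually_conj eventually_nhds_in_open) (auto simp: T_def)
      then obtain N where N: "open N" "\<gamma> x \<in> N" "\<And>Q. Q \<in> N \<Longrightarrow> Q \<in> B \<and> (fst Q \<noteq> 0 \<longrightarrow> comes_from n q l Y Q (F s))"
        unfolding eventually_nhds by blast
      obtain Q where Q: "Q \<in> N" "fst Q \<noteq> 0" using exists_fst_nonzero[OF N(1,2)] by blast
      have "comes_from n q l Y R (F s)" if "R \<in> B" "fst R \<noteq> 0" for R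
        by (rule comes_from_propagates[OF Y q B(1-4) _ Q(2) _ that]) (use N(3)[OF Q(1)] Q in auto)
      then have "good (\<gamma> y) (F s)" unfolding good_def
        using eventually_nhds_in_open[OF B(1), of "\<gamma> y"] y by (auto simp: T_def elim: eventually_mono)
      then show ?thesis
        by (rule good_germ) (use y \<delta>' in \<open>auto simp: T_def intro: same_germ_sym\<close>)
    qed
    moreover have "s \<in> T" using s \<delta>' B by (auto simp: T_def)
    ultimately show "\<exists>T. openin (top_of_set {0..1}) T \<and> s \<in> T \<and>
       (\<forall>x\<in>T. \<forall>y\<in>T. good (\<gamma> x) (F x) \<longrightarrow> good (\<gamma> y) (F y))"
      using T by blast
  qed auto
  then have "good (pathfinish \<gamma>) g" using good_germ F(2) by (simp add: pathfinish_def)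
  then show ?thesis using fin eventually_nhds_x_imp_x unfolding good_def by fastforce
qed

text \<open>
  On the initial region the function has the required form by assumption.
\<close>

lemma branch_comes_from:
  assumes Y: "local_system Y" and q: "q > 0"
    and f0: "\<And>z. z \<noteq> 0 \<Longrightarrow> norm z < 1 \<Longrightarrow> Y z f0"
    and br: "branch_at (\<Omega> n q r - Kset n q) (initial_region n q \<inter> \<Omega> n q r) (pullback n q l f0) Q g"
    and Q: "fst Q \<noteq> 0"
  shows "comes_from n q l Y Q g"
proof -
  obtain \<gamma> where \<gamma>: "pathstart \<gamma> \<in> initial_region n q" "pathfinish \<gamma> = Q"
    "continues_along (\<Omega> n q r - Kset n q) \<gamma> (pullback n q l f0) g"
    using br unfolding branch_at_def by blast
  have "comes_from n q l Y (pathfinish \<gamma>) g"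
  proof (rule continuation_comes_from[OF Y q \<gamma>(3)])
    define P where "P = pathstart \<gamma>"
    have P: "snd P \<noteq> 0" "norm (zmap n q P) < 1"
      using \<gamma>(1) by (auto simp: initial_region_def P_def zmap_def split: prod.splits)
    have "((\<lambda>R. norm (zmap n q R)) \<longlongrightarrow> norm (zmap n q P)) (nhds P)"
      using isCont_zmap[OF P(1), of n q] by (intro tendsto_norm) (metis isCont_def tendsto_at_iff_tendsto_nhds)
    then have 1: "\<forall>\<^sub>F R in nhds P. norm (zmap n q R) < 1" using P(2) order_tendstoD by blast
    have "(snd \<longlongrightarrow> snd P) (nhds P)" by (intro tendsto_snd) (simp add: filterlim_ident)
    then have 2: "\<forall>\<^sub>F R in nhds P. snd R \<noteq> 0" using P(1) tendsto_imp_eventually_ne by blast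
    show "\<forall>\<^sub>F Q in nhds (pathstart \<gamma>). fst Q \<noteq> 0 \<longrightarrow> comes_from n q l Y Q (pullback n q l f0)"
      unfolding P_def[symmetric] using 1 2
    proof eventually_elim
      case (elim R)
      show ?case
      proof
        assume "fst R \<noteq> 0"
        then have "Y (zmap n q R) f0" using f0 elim zmap_eq_0_iff[OF q] by blast
        then show "comes_from n q l Y R (pullback n q l f0)"
          unfolding comes_from_def same_germ_def by auto
      qed
    qed
  qed (use \<gamma> Q in auto)
  then show ?thesis by (simp add: \<gamma>)
qed

section \<open>Extension across the line x = 0\<close>

definition \<kappa> :: "nat \<Rightarrow> nat \<Rightarrow> complex"
  where "\<kappa> n q = (of_nat q / of_nat (n + 2))\<^sup>2"

lemma zmap_Pair: "zmap n q (t, x) = \<kappa> n q * t ^ (n + 2) / x ^ q"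
  by (simp add: zmap_def z_var_def \<kappa>_def)

lemma kappa_nonzero: "q > 0 \<Longrightarrow> \<kappa> n q \<noteq> 0"
  by (simp add: \<kappa>_def of_nat_plus_2_nonzero)

lemma mem_\<Omega>: "(t, x) \<in> \<Omega> n q r \<longleftrightarrow> norm (x ^ q - \<kappa> n q * t ^ (n + 2)) < r"
  by (simp add: \<Omega>_def \<kappa>_def)

lemma mem_K1_minus_K2:
  assumes "q > 0"
  shows "P \<in> K\<^sub>1 - K\<^sub>2 n q \<longleftrightarrow> snd P = 0 \<and> fst P \<noteq> 0"
  using assms by (cases P) (auto simp: K\<^sub>1_def K\<^sub>2_def of_nat_plus_2_nonzero zero_power)

lemma mem_K2_minus_K1:
  assumes "q > 0"
  shows "P \<in> K\<^sub>2 n q - K\<^sub>1 \<longleftrightarrow> snd P \<noteq> 0 \<and> zmap n q P = 1"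
  using not_in_Kset[OF assms, of P n] by (cases P) (auto simp: Kset_def K\<^sub>1_def)

text \<open>
  Applied to differences of logarithms, which by continuity cannot jump by a multiple of \<open>2 \<pi> i\<close>.
\<close>

lemma logs_differ_by_constant:
  fixes D :: "'a :: t2_space \<Rightarrow> complex"
  assumes "isCont D Q" "\<forall>\<^sub>F R in nhds Q. exp (D R) = k"
  shows "\<forall>\<^sub>F R in nhds Q. D R = D Q"
proof -
  have "(D \<longlongrightarrow> D Q) (nhds Q)" using assms(1) by (simp add: isCont_def tendsto_at_iff_tendsto_nhds)
  then have "\<forall>\<^sub>F R in nhds Q. dist (D R) (D Q) < 1" by (rule tendstoD) simp
  then show ?thesis using assms(2)
  proof eventually_elim
    case (elim R)
    have "exp (D Q) = k" using assms(2) eventually_nhds_x_imp_x by blast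
    moreover have "\<bar>Im (D R) - Im (D Q)\<bar> < 2 * pi"
    proof -
      have "\<bar>Im (D R - D Q)\<bar> < 1"
        using elim(1) le_less_trans[OF abs_Im_le_cmod] unfolding dist_norm by blast
      also have "1 < 2 * pi" using pi_gt3 by linarith
      finally show ?thesis by simp
    qed
    ultimately show ?case using elim(2) exp_complex_eqI by metis
  qed
qed

lemma eventually_zmap:
  assumes "snd Q \<noteq> 0" "\<forall>\<^sub>F w in nhds (zmap n q Q). P w"
  shows "\<forall>\<^sub>F R in nhds Q. P (zmap n q R)"
proof -
  have "(zmap n q \<longlongrightarrow> zmap n q Q) (nhds Q)"
    using isCont_zmap[OF assms(1), of n q] by (simp add: isCont_def tendsto_at_iff_tendsto_nhds)
  then show ?thesis by (rule eventually_compose_filterlim[OF assms(2)])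
qed

text \<open>
  Near a point \<open>(t\<^sub>0, 0)\<close> with \<open>t\<^sub>0 \<noteq> 0\<close>, the function \<open>1/z\<close> and a logarithm of \<open>t\<close> are holomorphic. There
  \<open>x\<^sup>l z\<^sup>-\<^sup>a\<close> is a constant times \<open>t\<^bsup>-(n+2)a\<^esup> x\<^bsup>l+aq\<^esup>\<close>, which is holomorphic if \<open>l + a q\<close> is a natural number.
  The disjunctions in the premise say that a summand occurs only if this is the case for its exponent.
\<close>

lemma holomorphic_on_K\<^sub>1I:
  assumes Y: "local_system Y" and q: "q > 0"
    and f0: "\<And>z. z \<noteq> 0 \<Longrightarrow> norm z < 1 \<Longrightarrow> Y z f0"
    and G: "G1 holomorphic_on ball 0 1" "G2 holomorphic_on ball 0 1"
    and inf: "\<And>z y. norm z > 1 \<Longrightarrow> Y z y \<Longrightarrow> \<exists>k1 k2 \<Lambda>. isCont \<Lambda> z \<and>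
      (\<forall>\<^sub>F w in nhds z. exp (\<Lambda> w) = w \<and>
        y w = k1 * (exp (- a * \<Lambda> w) * G1 (1 / w)) + k2 * (exp (- b * \<Lambda> w) * G2 (1 / w))) \<and>
      (k1 = 0 \<or> of_nat l + a * of_nat q \<in> \<nat>) \<and> (k2 = 0 \<or> of_nat l + b * of_nat q \<in> \<nat>)"
  shows "holomorphic_on_K\<^sub>1 n q r (pullback n q l f0)"
  unfolding holomorphic_on_K\<^sub>1_def
proof
  fix P assume P: "P \<in> (K\<^sub>1 - K\<^sub>2 n q) \<inter> \<Omega> n q r"
  then have P0: "snd P = 0" "fst P \<noteq> 0" using mem_K1_minus_K2[OF q, of P n] by blast+
  define t0 where "t0 = fst P"
  define V where "V = \<Omega> n q r \<inter> {Q. Re (fst Q / t0) > 0} \<inter> {Q. norm (snd Q ^ q) < norm (\<kappa> n q * fst Q ^ (n + 2))}"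
  have opV: "open V" unfolding V_def using P0
    by (intro open_Int open_\<Omega> open_Collect_less continuous_intros) (auto simp: t0_def)
  have PV: "P \<in> V" using P P0 q kappa_nonzero[OF q] by (simp add: V_def t0_def norm_mult zero_power)
  define T where "T = (\<lambda>Q::complex\<times>complex. Ln (fst Q / t0) + Ln t0)"
  have VT: "fst Q / t0 \<notin> \<real>\<^sub>\<le>\<^sub>0" "fst Q \<noteq> 0" if "Q \<in> V" for Q
    using that by (auto simp: V_def complex_nonpos_Reals_iff)
  have hT: "holo2_on T V" unfolding T_def divide_inverse
    by (intro holo2_intros) (use VT in \<open>auto simp: divide_inverse\<close>)
  have eT: "exp (T Q) = fst Q" if "Q \<in> V" for Q
    using VT[OF that] P0 by (simp add: T_def exp_add t0_def)
  define I where "I = (\<lambda>Q::complex\<times>complex. inverse (\<kappa> n q) * (snd Q ^ q * inverse (fst Q ^ (n + 2))))"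
  have hI: "holo2_on I V" unfolding I_def by (intro holo2_intros) (use VT in auto)
  have IV: "I Q \<in> ball 0 1" if "Q \<in> V" for Q
  proof -
    have "I Q = snd Q ^ q / (\<kappa> n q * fst Q ^ (n + 2))"
      by (simp add: I_def divide_inverse mult_ac)
    moreover have "norm (snd Q ^ q) < norm (\<kappa> n q * fst Q ^ (n + 2))" using that by (simp add: V_def)
    moreover from this have "norm (\<kappa> n q * fst Q ^ (n + 2)) > 0" by (rule le_less_trans[OF norm_ge_zero])
    ultimately show ?thesis by (simp only: mem_ball_0 norm_divide divide_less_eq) simp
  qed
  have Iz: "I Q = 1 / zmap n q Q" if "snd Q \<noteq> 0" for Q
    using that by (cases Q) (simp add: I_def zmap_Pair divide_inverse mult_ac)
  have hG: "holo2_on (\<lambda>Q. G (I Q)) V" if "G holomorphic_on ball 0 1" for G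
    by (rule holo2_on_compose[OF hI])
      (use IV that holomorphic_on_imp_differentiable_at[OF that open_ball] in auto)
  show "holomorphic_across (\<Omega> n q r) (K\<^sub>1 \<union> K\<^sub>2 n q) (initial_region n q) (pullback n q l f0) P"
    unfolding holomorphic_across_def Kset_def[symmetric]
  proof (intro exI[of _ V] conjI ballI allI impI opV PV)
    show "V \<subseteq> \<Omega> n q r" by (auto simp: V_def)
    fix Q g assume Q: "Q \<in> V - Kset n q"
      and br: "branch_at (\<Omega> n q r - Kset n q) (initial_region n q \<inter> \<Omega> n q r) (pullback n q l f0) Q g"
    have QV: "Q \<in> V" and x0: "snd Q \<noteq> 0" using Q not_in_Kset[OF q] by auto
    have z1: "norm (zmap n q Q) > 1"
    proof -
      have "zmap n q Q \<noteq> 0" using zmap_eq_0_iff[OF q x0] VT(2)[OF QV] by blast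
      then show ?thesis using IV[OF QV] Iz[OF x0] by (simp add: norm_divide divide_less_eq)
    qed
    obtain y where y: "Y (zmap n q Q) y" "same_germ Q g (pullback n q l y)"
      using branch_comes_from[OF Y q f0 br VT(2)[OF QV]] by (auto simp: comes_from_def)
    obtain k1 k2 \<Lambda> where k: "isCont \<Lambda> (zmap n q Q)"
      "\<forall>\<^sub>F w in nhds (zmap n q Q). exp (\<Lambda> w) = w \<and>
        y w = k1 * (exp (- a * \<Lambda> w) * G1 (1 / w)) + k2 * (exp (- b * \<Lambda> w) * G2 (1 / w))"
      "k1 = 0 \<or> of_nat l + a * of_nat q \<in> \<nat>" "k2 = 0 \<or> of_nat l + b * of_nat q \<in> \<nat>"
      using inf[OF z1 y(1)] by blast
    define X where "X = (\<lambda>R::complex\<times>complex. Ln (snd R / snd Q) + Ln (snd Q))"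
    \<comment> \<open>a logarithm of the constant \<open>z x\<^sup>q / t\<^sup>n\<^sup>+\<^sup>2\<close>; it relates the given logarithm of \<open>z\<close> to those of \<open>t\<close> and \<open>x\<close>\<close>
    define D where "D = (\<lambda>R. \<Lambda> (zmap n q R) - of_nat (n + 2) * T R + of_nat q * X R)"
    have contX: "isCont X Q" unfolding X_def using x0 by (intro continuous_intros) auto
    have contD: "isCont D Q" unfolding D_def
      by (intro continuous_intros isCont_o2[OF isCont_zmap[OF x0]] k(1) contX holo2_on_isCont[OF hT QV])
    have evx: "\<forall>\<^sub>F R in nhds Q. snd R \<noteq> 0"
      using x0 by (intro eventually_nhds_in_open[of "{R. snd R \<noteq> 0}", simplified] open_Collect_neq continuous_intros) auto
    have evV: "\<forall>\<^sub>F R in nhds Q. R \<in> V" by (rule eventually_nhds_in_open[OF opV QV])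
    have evz: "\<forall>\<^sub>F R in nhds Q. exp (\<Lambda> (zmap n q R)) = zmap n q R \<and>
        y (zmap n q R) = k1 * (exp (- a * \<Lambda> (zmap n q R)) * G1 (1 / zmap n q R)) + k2 * (exp (- b * \<Lambda> (zmap n q R)) * G2 (1 / zmap n q R))"
      by (rule eventually_zmap[OF x0 k(2)])
    have eX: "exp (X R) = snd R" if "snd R \<noteq> 0" for R using that x0 by (simp add: X_def exp_add)
    have "\<forall>\<^sub>F R in nhds Q. exp (D R) = \<kappa> n q"
      using evx evV evz
    proof eventually_elim
      case (elim R)
      have "exp (D R) = zmap n q R / fst R ^ (n + 2) * snd R ^ q"
        using elim by (simp only: D_def exp_add exp_diff exp_of_nat_mult eT eX[OF elim(1)])
      also have "\<dots> = \<kappa> n q" using elim(1) VT(2)[OF elim(2)]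
        by (cases R) (simp add: zmap_Pair del: power_Suc power_add_numeral2)
      finally show ?case .
    qed
    then have evD: "\<forall>\<^sub>F R in nhds Q. D R = D Q" by (rule logs_differ_by_constant[OF contD])
    \<comment> \<open>the value \<open>0\<close> is taken only where the summand has coefficient \<open>0\<close>\<close>
    define M where "M = (\<lambda>e. if of_nat l + e * of_nat q \<in> (\<nat>::complex set) then (SOME N. of_nat l + e * of_nat q = (of_nat N::complex)) else 0)"
    have M: "of_nat (M e) = of_nat l + e * of_nat q" if "of_nat l + e * of_nat q \<in> (\<nat>::complex set)" for e
      using that someI_ex[of "\<lambda>N. of_nat l + e * of_nat q = (of_nat N::complex)"]
      by (auto simp: M_def elim!: Nats_cases)
    define h where "h = (\<lambda>k e G R. k * exp (- e * D Q) * (exp (- e * of_nat (n + 2) * T R) * (snd R ^ M e * (G (I R) :: complex))))"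
    have hh: "holo2_on (h k e G) V" if "G holomorphic_on ball 0 1" for k e G
      unfolding h_def by (intro holo2_intros hT hG that)
    have summand: "snd R ^ l * (k * (exp (- e * \<Lambda> (zmap n q R)) * G (1 / zmap n q R))) = h k e G R"
      if "k = 0 \<or> of_nat l + e * of_nat q \<in> \<nat>" "snd R \<noteq> 0" "D R = D Q" for k e G R
    proof (cases "k = 0")
      case True then show ?thesis by (simp add: h_def)
    next
      case False
      then have Me: "of_nat (M e) = of_nat l + e * of_nat q" using that(1) M by blast
      have "\<Lambda> (zmap n q R) = D Q + of_nat (n + 2) * T R - of_nat q * X R"
        unfolding that(3)[symmetric] by (simp add: D_def)
      then have "snd R ^ l * exp (- e * \<Lambda> (zmap n q R)) =
          exp (of_nat l * X R) * exp (- e * (D Q + of_nat (n + 2) * T R - of_nat q * X R))"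
        by (simp only: exp_of_nat_mult eX[OF that(2)])
      also have "\<dots> = exp (- e * D Q) * (exp (- e * of_nat (n + 2) * T R) * exp ((of_nat l + e * of_nat q) * X R))"
        by (simp add: exp_add[symmetric] algebra_simps)
      also have "exp ((of_nat l + e * of_nat q) * X R) = snd R ^ M e"
        unfolding Me[symmetric] exp_of_nat_mult eX[OF that(2)] ..
      finally show ?thesis unfolding h_def Iz[OF that(2)] by (simp add: mult_ac)
    qed
    show "\<exists>h. holo2_on h V \<and> same_germ Q h g"
    proof (intro exI conjI)
      show "holo2_on (\<lambda>R. h k1 a G1 R + h k2 b G2 R) V"
        by (intro holo2_on_add hh G)
      show "same_germ Q (\<lambda>R. h k1 a G1 R + h k2 b G2 R) g"
        unfolding same_germ_def using evx evz evD y(2)[unfolded same_germ_def]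
      proof eventually_elim
        case (elim R)
        then show ?case
          using summand[OF k(3) elim(1,3), of G1] summand[OF k(4) elim(1,3), of G2]
          by (simp add: pullback_def distrib_left)
      qed
    qed
  qed
qed

lemma continues_along_germ:
  assumes "continues_along W \<gamma> f g" "same_germ (pathstart \<gamma>) f f'" "same_germ (pathfinish \<gamma>) g g'"
  shows "continues_along W \<gamma> f' g'"
proof -
  have tr: "same_germ P u v \<Longrightarrow> same_germ P v w \<Longrightarrow> same_germ P u w" for P u v w
    unfolding same_germ_def by (auto elim: eventually_elim2)
  show ?thesis using assms tr unfolding continues_along_def by blast
qed

text \<open>
  Continuation in two variables induced by a family of germs \<open>y u\<close> in the variable \<open>z\<close>. Any positive bound
  on \<open>\<bar>u' - u\<bar>\<close> would serve.
\<close>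

lemma continues_along_pullback:
  assumes \<gamma>: "path \<gamma>" "path_image \<gamma> \<subseteq> W"
    and D: "\<And>u. u \<in> {0..1} \<Longrightarrow> open (D u) \<and> y u holomorphic_on D u \<and> zmap n q (\<gamma> u) \<in> D u \<and> snd (\<gamma> u) \<noteq> 0"
    and eq: "\<And>u u' z. u \<in> {0..1} \<Longrightarrow> u' \<in> {0..1} \<Longrightarrow> \<bar>u' - u\<bar> < 1/4 \<Longrightarrow> z \<in> D u \<Longrightarrow> z \<in> D u' \<Longrightarrow> y u' z = y u z"
  shows "continues_along W \<gamma> (pullback n q l (y 0)) (pullback n q l (y 1))"
  unfolding continues_along_def
proof (intro conjI \<gamma> exI[of _ "\<lambda>u. pullback n q l (y u)"] ballI)
  fix u :: real assume u: "u \<in> {0..1}"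
  define O' where "O' v = {R. snd R \<noteq> 0} \<inter> zmap n q -` D v" for v
  have opO: "open (O' v)" if "v \<in> {0..1}" for v
    unfolding O'_def
    by (rule continuous_open_preimage)
      (use D[OF that] in \<open>auto intro!: open_Collect_neq continuous_intros continuous_at_imp_continuous_on isCont_zmap\<close>)
  have mem: "\<gamma> v \<in> O' v" if "v \<in> {0..1}" for v using D[OF that] by (simp add: O'_def)
  obtain \<epsilon> where \<epsilon>: "\<epsilon> > 0" "ball (\<gamma> u) \<epsilon> \<subseteq> O' u"
    using opO[OF u] mem[OF u] open_contains_ball by blast
  have "continuous_on {0..1} \<gamma>" using \<gamma>(1) by (simp add: path_def)
  then obtain \<delta> where \<delta>: "\<delta> > 0" "\<And>v. v \<in> {0..1} \<Longrightarrow> dist v u < \<delta> \<Longrightarrow> dist (\<gamma> v) (\<gamma> u) < \<epsilon>"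
    using u \<epsilon>(1) unfolding continuous_on_iff by metis
  show "\<exists>\<epsilon>>0. holo2_on (pullback n q l (y u)) (ball (\<gamma> u) \<epsilon>) \<and>
      (\<exists>\<delta>>0. \<forall>s'\<in>{0..1}. \<bar>s' - u\<bar> < \<delta> \<longrightarrow> \<gamma> s' \<in> ball (\<gamma> u) \<epsilon> \<and>
         same_germ (\<gamma> s') (pullback n q l (y s')) (pullback n q l (y u)))"
  proof (rule exI[of _ \<epsilon>], intro conjI, rule \<epsilon>(1), goal_cases)
    case 1
    show ?case
      by (rule holo2_on_pullback[of _ "D u"]) (use D[OF u] \<epsilon>(2) in \<open>auto simp: O'_def\<close>)
  next
    case 2
    show ?case
    proof (rule exI[of _ "min \<delta> (1/4)"], intro conjI ballI impI)
      fix v assume v: "v \<in> {0..1}" "\<bar>v - u\<bar> < min \<delta> (1/4)"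
      then have "dist (\<gamma> v) (\<gamma> u) < \<epsilon>" using \<delta>(2) by (simp add: dist_real_def)
      then show vb: "\<gamma> v \<in> ball (\<gamma> u) \<epsilon>" by (simp add: dist_commute)
      have "\<forall>\<^sub>F R in nhds (\<gamma> v). R \<in> O' u \<inter> O' v"
        using vb \<epsilon>(2) mem[OF v(1)] by (intro eventually_nhds_in_open open_Int opO u v) auto
      then show "same_germ (\<gamma> v) (pullback n q l (y v)) (pullback n q l (y u))"
        unfolding same_germ_def
      proof eventually_elim
        case (elim R)
        then show ?case using eq[OF u v(1)] v(2) by (simp add: O'_def pullback_def)
      qed
    qed (use \<delta> in auto)
  qed
qed (simp_all add: same_germ_def)

lemma same_germ_pullback:
  assumes "snd Q \<noteq> 0" "\<forall>\<^sub>F w in nhds (zmap n q Q). y w = y' w"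
  shows "same_germ Q (pullback n q l y) (pullback n q l y')"
  unfolding same_germ_def pullback_def using eventually_zmap[OF assms] by eventually_elim simp

lemma initial_region_iff: "P \<in> initial_region n q \<longleftrightarrow> snd P \<noteq> 0 \<and> norm (zmap n q P) < 1"
  by (cases P) (simp add: initial_region_def zmap_def)

text \<open>
  An entire \<open>f0\<close> generates a local system with a single germ at every point, so all branches are restrictions
  of \<open>x\<^sup>l f0(z)\<close>.
\<close>

lemma holomorphic_on_K\<^sub>2I:
  assumes q: "q > 0" and f0: "f0 holomorphic_on UNIV"
  shows "holomorphic_on_K\<^sub>2 n q r (pullback n q l f0)"
  unfolding holomorphic_on_K\<^sub>2_def
proof
  fix P assume P: "P \<in> (K\<^sub>2 n q - K\<^sub>1) \<inter> \<Omega> n q r"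
  define Y where "Y z y \<longleftrightarrow> (\<forall>\<^sub>F w in nhds z. y w = f0 w)" for z y
  have Y: "local_system Y" unfolding local_system_def
  proof (intro allI impI exI[of _ 1] conjI ballI exI[of _ f0])
    show "f0 holomorphic_on ball z0 1" for z0 using f0 by (rule holomorphic_on_subset) simp
  qed (auto simp: Y_def eq_commute)
  define V where "V = \<Omega> n q r \<inter> {R. fst R \<noteq> 0} \<inter> {R. snd R \<noteq> 0}"
  have opV: "open V" unfolding V_def
    by (intro open_Int open_\<Omega> open_Collect_neq continuous_intros)
  have PV: "P \<in> V" using P mem_K2_minus_K1[OF q, of P n] zmap_eq_0_iff[OF q, of P n] by (auto simp: V_def)
  show "holomorphic_across (\<Omega> n q r) (K\<^sub>1 \<union> K\<^sub>2 n q) (initial_region n q) (pullback n q l f0) P"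
    unfolding holomorphic_across_def Kset_def[symmetric]
  proof (intro exI[of _ V] conjI ballI allI impI opV PV exI[of _ "pullback n q l f0"])
    show "V \<subseteq> \<Omega> n q r" by (auto simp: V_def)
    show "holo2_on (pullback n q l f0) V"
      by (rule holo2_on_pullback[OF f0]) (auto simp: V_def)
    fix Q g assume Q: "Q \<in> V - Kset n q"
      and br: "branch_at (\<Omega> n q r - Kset n q) (initial_region n q \<inter> \<Omega> n q r) (pullback n q l f0) Q g"
    have "fst Q \<noteq> 0" "snd Q \<noteq> 0" using Q by (auto simp: V_def)
    then obtain y where y: "Y (zmap n q Q) y" "same_germ Q g (pullback n q l y)"
      using branch_comes_from[OF Y q _ br] by (auto simp: comes_from_def Y_def)
    have "same_germ Q (pullback n q l y) (pullback n q l f0)"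
      by (rule same_germ_pullback[OF \<open>snd Q \<noteq> 0\<close>]) (use y(1) in \<open>simp add: Y_def\<close>)
    with y(2) show "same_germ Q (pullback n q l f0) g"
      unfolding same_germ_def by eventually_elim simp
  qed
qed

section \<open>Exponents forced by an extension across x = 0\<close>

text \<open>
  The right-hand side has period \<open>2 \<pi> i\<close> in \<open>\<xi>\<close>, so \<open>\<mu>\<close> is an integer; it is bounded for
  \<open>\<xi> \<rightarrow> -\<infinity>\<close>, so \<open>\<mu>\<close> is not negative.
\<close>

lemma Nats_if_periodic_bounded:
  fixes \<mu> :: complex and g G :: "complex \<Rightarrow> complex"
  assumes eq: "\<And>\<xi>. Re \<xi> < R \<Longrightarrow> exp (\<mu> * \<xi>) * G (exp \<xi>) = g (exp \<xi>)"
    and G: "isCont G 0" "G 0 \<noteq> 0" and g: "isCont g 0"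
  shows "\<mu> \<in> \<nat>"
proof -
  define \<xi> where "\<xi> N = complex_of_real (- real N)" for N
  have lim0: "(\<lambda>N. exp (\<xi> N)) \<longlonglongrightarrow> 0"
  proof -
    have "(\<lambda>N. exp (- real N)) \<longlonglongrightarrow> 0"
      by (rule filterlim_compose[OF exp_at_bot]) (intro filterlim_uminus_at_bot_at_top filterlim_real_sequentially filterlim_compose[OF filterlim_uminus_at_bot_at_top])
    then have "(\<lambda>N. complex_of_real (exp (- real N))) \<longlonglongrightarrow> of_real 0" by (rule tendsto_of_real)
    then show ?thesis unfolding \<xi>_def by (simp only: exp_of_real of_real_0)
  qed
  have limG: "(\<lambda>N. G (exp (\<xi> N))) \<longlonglongrightarrow> G 0" using isCont_tendsto_compose[OF G(1) lim0] .
  have limg: "(\<lambda>N. g (exp (\<xi> N))) \<longlonglongrightarrow> g 0" using isCont_tendsto_compose[OF g lim0] .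
  obtain N0 :: nat where N0: "real N0 > \<bar>R\<bar>" using reals_Archimedean2 by blast
  have Re: "Re (\<xi> N) < R" if "N \<ge> N0" for N using N0 that by (simp add: \<xi>_def)
  have "\<forall>\<^sub>F N in sequentially. G (exp (\<xi> N)) \<noteq> 0" using limG G(2) tendsto_imp_eventually_ne by blast
  from eventually_happens'[OF sequentially_bot eventually_conj[OF this eventually_ge_at_top[of N0]]]
  obtain N where N: "N \<ge> N0" "G (exp (\<xi> N)) \<noteq> 0" by blast
  have e: "exp (\<xi> N + 2 * of_real pi * \<i>) = exp (\<xi> N)" by (simp add: exp_add)
  have "exp (\<mu> * (\<xi> N + 2 * of_real pi * \<i>)) * G (exp (\<xi> N)) = exp (\<mu> * \<xi> N) * G (exp (\<xi> N))"
    using eq[of "\<xi> N + 2 * of_real pi * \<i>"] eq[of "\<xi> N"] Re[OF N(1)] e by simp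
  then have "exp (\<mu> * (\<xi> N + 2 * of_real pi * \<i>)) = exp (\<mu> * \<xi> N)" using N(2) by simp
  then obtain k :: int where "\<mu> * (\<xi> N + 2 * of_real pi * \<i>) = \<mu> * \<xi> N + of_int (2 * k) * of_real pi * \<i>"
    unfolding exp_eq by (auto simp: mult_ac)
  then have k: "\<mu> = of_int k" by (simp add: algebra_simps)
  have "k \<ge> 0"
  proof (rule ccontr)
    assume "\<not> k \<ge> 0"
    then obtain j :: nat where j: "- k = int (Suc j)"
      by (metis add.inverse_inverse int_cases neg_0_le_iff_le nat_le_linear negative_zle of_nat_0_le_iff)
    have "(\<lambda>N. exp (\<xi> N) ^ Suc j * g (exp (\<xi> N))) \<longlonglongrightarrow> 0 ^ Suc j * g 0"
      by (intro tendsto_intros lim0 limg)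
    moreover have step: "exp (\<xi> N) ^ Suc j * g (exp (\<xi> N)) = G (exp (\<xi> N))" if "N \<ge> N0" for N
    proof -
      have \<mu>: "\<mu> = - of_nat (Suc j)" using k j by (metis minus_equation_iff of_int_minus of_int_of_nat_eq)
      have "exp (\<xi> N) ^ Suc j * exp (\<mu> * \<xi> N) = 1"
        unfolding \<mu> exp_of_nat_mult[symmetric] by (simp add: exp_add[symmetric] del: of_nat_Suc power_Suc)
      then show ?thesis using eq[OF Re[OF that], symmetric] by (metis mult.assoc mult.left_neutral)
    qed
    have "\<forall>\<^sub>F N in sequentially. exp (\<xi> N) ^ Suc j * g (exp (\<xi> N)) = G (exp (\<xi> N))"
      by (rule eventually_mono[OF eventually_ge_at_top[of N0] step])
    ultimately have "(\<lambda>N. G (exp (\<xi> N))) \<longlonglongrightarrow> 0"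
      by (simp add: tendsto_cong)
    with limG G(2) LIMSEQ_unique show False by blast
  qed
  then show ?thesis using k by (metis of_nat_in_Nats of_int_of_nat_eq nonneg_int_cases)
qed

lemma norm_exp_less:
  assumes "Re \<xi> < ln \<eta>" "\<eta> > 0"
  shows "norm (exp \<xi>) < \<eta>"
proof -
  have "exp (Re \<xi>) < exp (ln \<eta>)" using assms(1) by (simp only: exp_less_cancel_iff)
  then show ?thesis using assms(2) by simp
qed

text \<open>
  With \<open>x = exp \<xi>\<close>, rotating \<open>x\<close> by the angle \<open>2 \<pi> / q\<close> multiplies the two summands by different
  constants. A combination of \<open>\<phi>\<close> and its rotation therefore isolates the first summand. Comparing monodromy under a
  full turn would not suffice: \<open>\<mu>\<close> and \<open>\<nu>\<close> may differ by an integer that \<open>q\<close> does not divide.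
\<close>

lemma exponent_in_Nats:
  fixes \<phi> G1 G2 :: "complex \<Rightarrow> complex" and q :: nat
  assumes q: "q > 0" and \<phi>: "\<phi> holomorphic_on ball 0 \<eta>" "\<eta> > 0"
    and G: "G1 holomorphic_on ball 0 \<eta>" "G2 holomorphic_on ball 0 \<eta>" "G1 0 \<noteq> 0"
    and G_rot: "\<And>w. G1 (w * exp (2 * of_real pi * \<i> / of_nat q)) = G1 w"
      "\<And>w. G2 (w * exp (2 * of_real pi * \<i> / of_nat q)) = G2 w"
    and ne: "(\<mu> - \<nu>) / of_nat q \<notin> \<int>" and c1: "c1 \<noteq> 0"
    and S: "open S" "S \<noteq> {}" "\<And>\<xi>. \<xi> \<in> S \<Longrightarrow> Re \<xi> < ln \<eta>"
    and eq: "\<And>\<xi>. \<xi> \<in> S \<Longrightarrow>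
      \<phi> (exp \<xi>) = c1 * (exp (\<mu> * \<xi>) * G1 (exp \<xi>)) + c2 * (exp (\<nu> * \<xi>) * G2 (exp \<xi>))"
  shows "\<mu> \<in> \<nat>"
proof -
  define H where "H = {\<xi>::complex. Re \<xi> < ln \<eta>}"
  have H: "open H" "connected H"
    by (auto simp: H_def open_halfspace_Re_lt convex_connected convex_halfspace_Re_lt)
  have eH: "exp ` H \<subseteq> ball 0 \<eta>"
  proof
    fix w assume "w \<in> exp ` H"
    then obtain \<xi> where "Re \<xi> < ln \<eta>" "w = exp \<xi>" by (auto simp: H_def)
    then show "w \<in> ball 0 \<eta>" using norm_exp_less[OF _ \<phi>(2), of \<xi>] by (simp only: mem_ball_0)
  qed
  have hol: "(\<lambda>\<xi>. f (exp \<xi>)) holomorphic_on H" if "f holomorphic_on ball 0 \<eta>" for f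
    using holomorphic_on_compose_gen[OF holomorphic_on_exp that eH] by (simp only: o_def)
  have all: "\<phi> (exp \<xi>) = c1 * (exp (\<mu> * \<xi>) * G1 (exp \<xi>)) + c2 * (exp (\<nu> * \<xi>) * G2 (exp \<xi>))" if "\<xi> \<in> H" for \<xi>
    by (rule analytic_continuation_open[OF S(1) H(1) S(2) H(2) _ hol[OF \<phi>(1)] _ eq that])
      (use S(3) in \<open>auto simp: H_def intro!: holomorphic_intros hol[unfolded H_def] G\<close>)
  define \<omega> where "\<omega> = 2 * of_real pi * \<i> / of_nat q"
  define d where "d = c1 * (exp (\<mu> * \<omega>) - exp (\<nu> * \<omega>))"
  have "d \<noteq> 0"
  proof
    assume "d = 0"
    then have "exp (\<mu> * \<omega>) = exp (\<nu> * \<omega>)" using c1 by (simp add: d_def)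
    then obtain k :: int where "\<mu> * \<omega> = \<nu> * \<omega> + of_int (2 * k) * of_real pi * \<i>"
      unfolding exp_eq by (auto simp: mult_ac)
    then have "2 * of_real pi * \<i> * ((\<mu> - \<nu>) / of_nat q) = 2 * of_real pi * \<i> * of_int k"
      by (simp add: \<omega>_def algebra_simps diff_divide_distrib)
    then have "(\<mu> - \<nu>) / of_nat q = of_int k" by (subst (asm) mult_cancel_left) simp
    with ne show False by simp
  qed
  show ?thesis
  proof (rule Nats_if_periodic_bounded[where R = "ln \<eta>" and G = G1 and
        g = "\<lambda>w. (\<phi> (w * exp \<omega>) - exp (\<nu> * \<omega>) * \<phi> w) / d"])
    fix \<xi> :: complex assume "Re \<xi> < ln \<eta>"
    then have \<xi>: "\<xi> \<in> H" "\<xi> + \<omega> \<in> H" by (auto simp: H_def \<omega>_def)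
    have G': "G1 (exp (\<xi> + \<omega>)) = G1 (exp \<xi>)" "G2 (exp (\<xi> + \<omega>)) = G2 (exp \<xi>)"
      using G_rot by (simp_all add: exp_add \<omega>_def)
    have "\<phi> (exp \<xi> * exp \<omega>) - exp (\<nu> * \<omega>) * \<phi> (exp \<xi>) =
      \<phi> (exp (\<xi> + \<omega>)) - exp (\<nu> * \<omega>) * \<phi> (exp \<xi>)" by (simp add: exp_add)
    also have "\<dots> = d * (exp (\<mu> * \<xi>) * G1 (exp \<xi>))"
      unfolding all[OF \<xi>(1)] all[OF \<xi>(2)] G' d_def
      by (simp add: distrib_left exp_add) (simp add: algebra_simps)
    finally show "exp (\<mu> * \<xi>) * G1 (exp \<xi>) = (\<phi> (exp \<xi> * exp \<omega>) - exp (\<nu> * \<omega>) * \<phi> (exp \<xi>)) / d"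
      using \<open>d \<noteq> 0\<close> by simp
  next
    have c: "isCont f 0" if "f holomorphic_on ball 0 \<eta>" for f :: "complex \<Rightarrow> complex"
      using that \<phi>(2) by (auto dest!: holomorphic_on_imp_continuous_on continuous_on_interior)
    show "isCont G1 0" using c G(1) by blast
    have "isCont (\<lambda>w. \<phi> (w * exp \<omega>)) 0"
      by (rule isCont_o2[where g = \<phi>]) (use c[OF \<phi>(1)] in \<open>auto intro!: continuous_intros\<close>)
    then show "isCont (\<lambda>w. (\<phi> (w * exp \<omega>) - exp (\<nu> * \<omega>) * \<phi> w) / d) 0"
      using c[OF \<phi>(1)] \<open>d \<noteq> 0\<close> by (intro continuous_intros)
  qed (use G in auto)
qed

lemma exists_small_powers:
  fixes \<tau> r \<delta> :: real
  assumes "q > 0" "\<tau> > 0" "\<delta> > 0"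
  obtains \<eta> where "\<eta> > 0" "\<eta> \<le> \<delta>" "\<And>x. 0 \<le> x \<Longrightarrow> x \<le> \<eta> \<Longrightarrow> x ^ q < \<tau>"
proof -
  define \<eta> where "\<eta> = min \<delta> (min (1/2) (\<tau> / 2))"
  have 1: "\<eta> > 0" "\<eta> \<le> \<delta>" "\<eta> \<le> 1" "\<eta> < \<tau>" using assms by (auto simp: \<eta>_def)
  have "x ^ q < \<tau>" if "0 \<le> x" "x \<le> \<eta>" for x
  proof -
    have "x ^ q \<le> x ^ 1" using that 1 assms(1) by (intro power_decreasing) auto
    then show ?thesis using that 1 by simp
  qed
  with 1 that show ?thesis by blast
qed

text \<open>
  Along the segment from \<open>(0, x1)\<close> to \<open>(t0, x1)\<close>, with \<open>x1\<close> chosen such that \<open>z\<close> is negative, \<open>U\<close> continues as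
  \<open>x\<^sup>l f(z)\<close>. On the line \<open>t = t0\<close>, the assumed extension is a holomorphic function of \<open>x\<close> near \<open>0\<close> with the
  two-term expansion of exponents \<open>l + a q\<close> and \<open>l + b q\<close>.
\<close>

lemma K\<^sub>1_exponent:
  assumes q: "q > 0" and r: "r > 0"
    and hol: "holomorphic_on_K\<^sub>1 n q r (pullback n q l f0)"
    and f: "f holomorphic_on slit" "\<And>z. z \<in> ball 0 1 \<Longrightarrow> f z = f0 z"
    and inf: "\<And>z. norm z > 1 \<Longrightarrow> Re z < 0 \<Longrightarrow>
      f z = C1 * (exp (- a * Ln (- z)) * G1 (1 / z)) + C2 * (exp (- b * Ln (- z)) * G2 (1 / z))"
    and G: "G1 holomorphic_on ball 0 1" "G2 holomorphic_on ball 0 1" "G1 0 \<noteq> 0"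
    and ab: "a - b \<notin> \<int>" and C1: "C1 \<noteq> 0"
  shows "of_nat l + a * of_nat q \<in> \<nat>"
proof -
  define k where "k = (real q / real (n + 2))\<^sup>2"
  have k0: "k > 0" using q by (simp add: k_def)
  have \<kappa>k: "\<kappa> n q = of_real k" by (simp add: \<kappa>_def k_def)
  \<comment> \<open>small enough that the path lies in \<open>\<Omega>\<close>\<close>
  obtain t0 where t0: "t0 > 0" "t0 \<le> 1" "\<And>x. 0 \<le> x \<Longrightarrow> x \<le> t0 \<Longrightarrow> x ^ (n + 2) < r / (2 * k)"
    using exists_small_powers[of "n + 2" "r / (2 * k)" 1] r k0 by auto
  define \<tau> where "\<tau> = k * t0 ^ (n + 2)"
  have \<tau>: "\<tau> > 0" "\<tau> < r / 2" using t0(1) t0(3)[of t0] k0 by (auto simp: \<tau>_def field_simps)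
  define P where "P = (complex_of_real t0, 0 :: complex)"
  have small: "norm (x ^ q - \<kappa> n q * of_real t ^ (n + 2)) < r"
    if "norm x ^ q < r / 2" "0 \<le> t" "t \<le> t0" for x and t :: real
  proof -
    have "norm (x ^ q - \<kappa> n q * of_real t ^ (n + 2)) \<le> norm (x ^ q) + norm (\<kappa> n q * of_real t ^ (n + 2))"
      by (rule norm_triangle_ineq4)
    also have "norm (\<kappa> n q * of_real t ^ (n + 2)) = k * t ^ (n + 2)"
      unfolding \<kappa>k using that k0 by (simp add: norm_mult norm_power)
    also have "\<dots> \<le> \<tau>" unfolding \<tau>_def using that k0 by (intro mult_left_mono power_mono) auto
    finally show ?thesis using that \<tau> by (simp add: norm_power)
  qed
  have "P \<in> (K\<^sub>1 - K\<^sub>2 n q) \<inter> \<Omega> n q r"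
    using mem_K1_minus_K2[OF q, of P n] t0 small[of 0 t0] r q by (simp add: P_def mem_\<Omega> zero_power)
  then have "holomorphic_across (\<Omega> n q r) (K\<^sub>1 \<union> K\<^sub>2 n q) (initial_region n q) (pullback n q l f0) P"
    using hol unfolding holomorphic_on_K\<^sub>1_def by blast
  then obtain V where V: "open V" "P \<in> V" "V \<subseteq> \<Omega> n q r"
    and ext: "\<And>Q g. Q \<in> V - Kset n q \<Longrightarrow> branch_at (\<Omega> n q r - Kset n q) (initial_region n q \<inter> \<Omega> n q r) (pullback n q l f0) Q g \<Longrightarrow>
         \<exists>h. holo2_on h V \<and> same_germ Q h g"
    unfolding holomorphic_across_def Kset_def[symmetric] by metis
  obtain \<delta> where \<delta>: "\<delta> > 0" "ball P \<delta> \<subseteq> V" using V open_contains_ball by blast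
  have inV: "(of_real t0, x) \<in> V" if "norm x < \<delta>" for x
    using \<delta>(2) that by (auto simp: P_def dist_prod_def dist_norm subset_iff)
  obtain \<eta> where \<eta>: "\<eta> > 0" "\<eta> \<le> \<delta>" "\<And>x. 0 \<le> x \<Longrightarrow> x \<le> \<eta> \<Longrightarrow> x ^ q < \<tau>"
    using exists_small_powers[OF q \<tau>(1) \<delta>(1)] by metis
  define \<rho> where "\<rho> = \<eta> / 2"
  have \<rho>: "\<rho> > 0" "\<rho> < \<eta>" using \<eta> by (auto simp: \<rho>_def)
  \<comment> \<open>an argument for which \<open>x1 ^ q\<close> is negative\<close>
  define \<xi>1 where "\<xi>1 = of_real (ln \<rho>) + of_real pi * \<i> / of_nat q"
  define x1 where "x1 = exp \<xi>1"
  have nx1: "norm x1 = \<rho>" using \<rho> by (simp add: x1_def \<xi>1_def)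
  have x1q: "x1 ^ q = - of_real (\<rho> ^ q)"
  proof -
    have "x1 ^ q = exp (of_nat q * \<xi>1)" by (simp add: x1_def exp_of_nat_mult)
    also have "of_nat q * \<xi>1 = of_real (real q * ln \<rho>) + of_real pi * \<i>"
      using q by (simp add: \<xi>1_def algebra_simps)
    also have "exp \<dots> = - of_real (exp (real q * ln \<rho>))"
      by (simp only: exp_add exp_pi_i exp_of_real) simp
    also have "exp (real q * ln \<rho>) = \<rho> ^ q" using \<rho> by (simp add: exp_of_nat_mult)
    finally show ?thesis .
  qed
  have x10: "x1 \<noteq> 0" by (simp add: x1_def)
  have \<rho>q: "\<rho> ^ q < \<tau>" using \<eta>(3) \<rho> by simp
  define Q where "Q = (complex_of_real t0, x1)"
  define \<gamma> where "\<gamma> = linepath (0, x1) Q"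
  have \<gamma>s: "\<gamma> u = (of_real (u * t0), x1)" for u
    by (simp add: \<gamma>_def linepath_def Q_def scaleR_conv_of_real algebra_simps)
  have z\<gamma>: "zmap n q (\<gamma> u) = - of_real (k * (u * t0) ^ (n + 2) / \<rho> ^ q)" for u
    unfolding \<gamma>s zmap_Pair x1q \<kappa>k by simp
  have z\<gamma>': "zmap n q (\<gamma> u) \<in> slit" if "0 \<le> u" for u
  proof -
    have "0 \<le> k * (u * t0) ^ (n + 2) / \<rho> ^ q" using k0 that t0 \<rho> by simp
    then show ?thesis unfolding z\<gamma> slit_def by simp
  qed
  have img: "path_image \<gamma> \<subseteq> \<Omega> n q r - Kset n q"
  proof
    fix R assume "R \<in> path_image \<gamma>"
    then obtain u where u: "u \<in> {0..1}" "R = \<gamma> u" by (auto simp: path_image_def)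
    have "R \<in> \<Omega> n q r" unfolding u \<gamma>s mem_\<Omega>
      by (rule small) (use u(1) nx1 \<rho>q \<tau> t0 in \<open>auto simp: mult_left_le_one_le\<close>)
    moreover have "zmap n q (\<gamma> u) \<noteq> 1" using z\<gamma>'[of u] u one_not_in_slit by auto
    then have "R \<notin> Kset n q" using not_in_Kset[OF q, of R n] u x10 \<gamma>s[of u] by simp
    ultimately show "R \<in> \<Omega> n q r - Kset n q" by blast
  qed
  have start: "pathstart \<gamma> = (0, x1)" and fin: "pathfinish \<gamma> = Q" by (simp_all add: \<gamma>_def)
  have zstart: "zmap n q (0, x1) = 0" by (simp add: zmap_Pair)
  have cont: "continues_along (\<Omega> n q r - Kset n q) \<gamma> (pullback n q l f0) (pullback n q l f)"
  proof (rule continues_along_germ)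
    show "continues_along (\<Omega> n q r - Kset n q) \<gamma> (pullback n q l f) (pullback n q l f)"
      by (rule continues_along_pullback[where D = "\<lambda>_. slit" and y = "\<lambda>_. f"])
        (use img f(1) open_slit z\<gamma>' x10 \<gamma>s in \<open>auto simp: \<gamma>_def[symmetric]\<close>, simp add: \<gamma>_def)
    have "\<forall>\<^sub>F w in nhds 0. f w = f0 w"
      using eventually_nhds_in_open[of "ball 0 1 :: complex set" 0] by (rule eventually_mono) (auto simp: f(2))
    then show "same_germ (pathstart \<gamma>) (pullback n q l f) (pullback n q l f0)"
      unfolding start using zstart x10 by (intro same_germ_pullback) auto
  qed (simp add: same_germ_def)
  have "(0, x1) \<in> initial_region n q \<inter> \<Omega> n q r"
    using img pathstart_in_path_image[of \<gamma>] x10 zstart start by (auto simp: initial_region_iff)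
  then have br: "branch_at (\<Omega> n q r - Kset n q) (initial_region n q \<inter> \<Omega> n q r) (pullback n q l f0) Q (pullback n q l f)"
    unfolding branch_at_def using cont start fin by metis
  have QV: "Q \<in> V" unfolding Q_def using inV nx1 \<rho> \<eta> by simp
  have "Q \<notin> Kset n q" using img pathfinish_in_path_image[of \<gamma>] fin by auto
  then obtain h where h: "holo2_on h V" "same_germ Q h (pullback n q l f)"
    using ext[OF _ br] QV by blast
  define \<phi> where "\<phi> = (\<lambda>x. h (of_real t0, x))"
  have \<phi>line: "\<phi> x = h (line2 P (0, 1) x)" for x by (simp add: \<phi>_def line2_def P_def)
  have \<phi>hol: "\<phi> holomorphic_on ball 0 \<eta>"
    unfolding \<phi>line[abs_def]
    by (rule holomorphic_on_subset[OF holo2_line[OF h(1)]])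
      (use inV \<eta>(2) in \<open>auto simp: line2_def P_def\<close>)
  obtain N where N: "open N" "Q \<in> N" "\<And>R. R \<in> N \<Longrightarrow> h R = pullback n q l f R"
    using h(2) unfolding same_germ_def eventually_nhds by blast
  \<comment> \<open>the logarithm of \<open>- z\<close> as a function of \<open>\<xi>\<close>; on \<open>S\<close> it is the principal one\<close>
  define m where "m \<xi> = of_real (ln \<tau>) + of_real pi * \<i> - of_nat q * \<xi>" for \<xi> :: complex
  define S where "S = {\<xi>. Re \<xi> < ln \<eta>} \<inter> (\<lambda>\<xi>. (of_real t0, exp \<xi>)) -` N \<inter> {\<xi>. \<bar>Im (m \<xi>)\<bar> < pi / 2}"
  have "open S" unfolding S_def m_def
    by (intro open_Int open_halfspace_Re_lt continuous_open_vimage N(1) open_Collect_less continuous_intros)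
  moreover have "\<xi>1 \<in> S"
    using N(2) \<rho> q by (auto simp: S_def m_def \<xi>1_def Q_def x1_def)
  ultimately have S: "open S" "S \<noteq> {}" by auto
  have expm: "exp (m \<xi>) = - of_real \<tau> / exp \<xi> ^ q" for \<xi>
    using \<tau> by (simp add: m_def exp_add exp_diff exp_of_nat_mult exp_of_real)
  define G1' where "G1' w = G1 (w ^ q / of_real \<tau>)" for w
  define G2' where "G2' w = G2 (w ^ q / of_real \<tau>)" for w
  have G': "(\<lambda>w. G (w ^ q / of_real \<tau>)) holomorphic_on ball 0 \<eta>" if "G holomorphic_on ball 0 1" for G
  proof -
    have "(G \<circ> (\<lambda>w. w ^ q / of_real \<tau>)) holomorphic_on ball 0 \<eta>"
    proof (rule holomorphic_on_compose_gen[OF _ that])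
      show "(\<lambda>w. w ^ q / of_real \<tau>) holomorphic_on ball 0 \<eta>" using \<tau> by (intro holomorphic_intros) auto
      show "(\<lambda>w::complex. w ^ q / of_real \<tau>) ` ball 0 \<eta> \<subseteq> ball 0 1"
      proof
        fix u :: complex assume "u \<in> (\<lambda>w. w ^ q / of_real \<tau>) ` ball 0 \<eta>"
        then obtain w :: complex where w: "norm w < \<eta>" "u = w ^ q / of_real \<tau>" by auto
        then show "u \<in> ball 0 1"
          using \<eta>(3)[of "norm w"] \<tau> by (simp add: norm_divide norm_power divide_less_eq)
      qed
    qed
    then show ?thesis by (simp add: o_def)
  qed
  define \<theta> where "\<theta> = of_real (ln \<tau>) + of_real pi * \<i>"
  show ?thesis
  proof (rule exponent_in_Nats[OF q \<phi>hol \<eta>(1), of G1' G2' _ "of_nat l + b * of_nat q" "C1 * exp (- a * \<theta>)" S "C2 * exp (- b * \<theta>)"])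
    show "G1' holomorphic_on ball 0 \<eta>" "G2' holomorphic_on ball 0 \<eta>"
      unfolding G1'_def G2'_def using G' G by auto
    show "G1' 0 \<noteq> 0" using G(3) q by (simp add: G1'_def zero_power)
    have "exp (2 * of_real pi * \<i> / of_nat q) ^ q = (1 :: complex)"
      using q by (simp add: exp_of_nat_mult[symmetric])
    then show "G1' (w * exp (2 * of_real pi * \<i> / of_nat q)) = G1' w"
      "G2' (w * exp (2 * of_real pi * \<i> / of_nat q)) = G2' w" for w
      by (simp_all add: G1'_def G2'_def power_mult_distrib)
    have "(of_nat l + a * of_nat q - (of_nat l + b * of_nat q)) / of_nat q = a - b"
      using q by (simp add: field_simps)
    then show "(of_nat l + a * of_nat q - (of_nat l + b * of_nat q)) / of_nat q \<notin> \<int>" using ab by simp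
    show "C1 * exp (- a * \<theta>) \<noteq> 0" using C1 by simp
    show "Re \<xi> < ln \<eta>" if "\<xi> \<in> S" for \<xi> using that by (simp add: S_def)
    fix \<xi> assume \<xi>: "\<xi> \<in> S"
    define x where "x = exp \<xi>"
    have nx: "norm x < \<eta>" using \<xi> norm_exp_less[OF _ \<eta>(1)] unfolding S_def x_def by blast
    have zx: "zmap n q (of_real t0, x) = of_real \<tau> / x ^ q" by (simp add: zmap_Pair \<kappa>k \<tau>_def)
    define z where "z = of_real \<tau> / x ^ q"
    have x0: "x \<noteq> 0" by (simp add: x_def)
    have mz: "exp (m \<xi>) = - z" by (simp add: expm z_def x_def)
    have Lnz: "Ln (- z) = m \<xi>"
      unfolding mz[symmetric] by (rule Ln_exp) (use \<xi> pi_gt_zero in \<open>auto simp: S_def\<close>)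
    have "Re (- z) > 0"
      unfolding mz[symmetric] Re_exp using \<xi> by (intro mult_pos_pos cos_gt_zero_pi) (auto simp: S_def)
    then have Rez: "Re z < 0" by simp
    have "norm z > 1" using \<eta>(3)[of "norm x"] nx x0 \<tau> by (simp add: z_def norm_divide norm_power field_simps)
    have iz: "1 / z = x ^ q / of_real \<tau>" by (simp add: z_def)
    have "(of_real t0, x) \<in> N" using \<xi> by (simp add: S_def x_def)
    then have "\<phi> x = x ^ l * f z" using N(3) by (simp add: \<phi>_def pullback_def zx z_def)
    also have "f z = C1 * (exp (- a * m \<xi>) * G1' x) + C2 * (exp (- b * m \<xi>) * G2' x)"
      using inf[OF \<open>norm z > 1\<close> Rez] by (simp add: Lnz iz G1'_def G2'_def)
    also have "x ^ l = exp (of_nat l * \<xi>)" by (simp add: x_def exp_of_nat_mult)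
    also have "m \<xi> = \<theta> - of_nat q * \<xi>" by (simp add: m_def \<theta>_def)
    also have "exp (of_nat l * \<xi>) * (C1 * (exp (- a * (\<theta> - of_nat q * \<xi>)) * G1' x) + C2 * (exp (- b * (\<theta> - of_nat q * \<xi>)) * G2' x)) =
        C1 * exp (- a * \<theta>) * (exp ((of_nat l + a * of_nat q) * \<xi>) * G1' x) + C2 * exp (- b * \<theta>) * (exp ((of_nat l + b * of_nat q) * \<xi>) * G2' x)"
    proof -
      have "exp (of_nat l * \<xi>) * exp (- e * (\<theta> - of_nat q * \<xi>)) = exp (- e * \<theta>) * exp ((of_nat l + e * of_nat q) * \<xi>)" for e
        by (simp add: exp_add[symmetric] algebra_simps)
      from this[of a] this[of b] show ?thesis by algebra
    qed
    finally show "\<phi> (exp \<xi>) = C1 * exp (- a * \<theta>) * (exp ((of_nat l + a * of_nat q) * \<xi>) * G1' (exp \<xi>)) +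
        C2 * exp (- b * \<theta>) * (exp ((of_nat l + b * of_nat q) * \<xi>) * G2' (exp \<xi>))" by (simp add: x_def)
  qed (use S in auto)
qed

section \<open>Ramification around the second curve\<close>

text \<open>
  Keep \<open>x\<close> fixed and let \<open>1 - z\<close> run once around a small circle about \<open>0\<close>, by means of
  \<open>t = t0 (1 - \<epsilon> exp (2 \<pi> i u))\<^bsup>1/(n+2)\<^esup>\<close>. The summand with exponent \<open>s\<close> is multiplied by \<open>exp (2 \<pi> i s) \<noteq> 1\<close>.
\<close>

lemma ramified_around_K\<^sub>2I:
  assumes q: "q > 0" and s: "s \<notin> \<int>" and B: "B \<noteq> 0"
    and hol: "h1 holomorphic_on ball 1 1" "k holomorphic_on ball 1 1" "k 1 \<noteq> 0" "f0 holomorphic_on ball 0 1"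
    and near: "\<And>z. z \<in> ball 0 1 \<Longrightarrow> z \<in> ball 1 1 \<Longrightarrow> f0 z = h1 z + B * (exp (s * Ln (1 - z)) * k z)"
  shows "ramified_around_K\<^sub>2 n q r (pullback n q l f0)"
  unfolding ramified_around_K\<^sub>2_def ramified_at_def
proof (intro ballI allI impI)
  fix P V assume P: "P \<in> (K\<^sub>2 n q - K\<^sub>1) \<inter> \<Omega> n q r" and V: "open V \<and> P \<in> V \<and> V \<subseteq> \<Omega> n q r"
  obtain t0 x0 where P_eq: "P = (t0, x0)" by (cases P)
  have x0: "x0 \<noteq> 0" and zP: "zmap n q P = 1" using P mem_K2_minus_K1[OF q, of P n] by (auto simp: P_eq)
  \<comment> \<open>the point on the line \<open>x = x0\<close> near \<open>P\<close> at which \<open>z = 1 - w\<close>\<close>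
  define pt where "pt = (\<lambda>w. (t0 * exp (Ln (1 - w) / of_nat (n + 2)), x0))"
  have zpt: "zmap n q (pt w) = 1 - w" if "w \<noteq> 1" for w
  proof -
    have "zmap n q (pt w) = zmap n q P * exp (Ln (1 - w) / of_nat (n + 2)) ^ (n + 2)"
      by (simp only: pt_def P_eq zmap_Pair power_mult_distrib) simp
    also have "exp (Ln (1 - w) / of_nat (n + 2)) ^ (n + 2) = exp (Ln (1 - w))"
      by (metis exp_divide_power_eq zero_less_Suc add_2_eq_Suc')
    finally show ?thesis using that zP by simp
  qed
  have "isCont pt 0" unfolding pt_def by (intro continuous_intros) (auto simp: of_nat_plus_2_nonzero)
  moreover have "pt 0 = P" by (simp add: pt_def P_eq)
  ultimately have "\<forall>\<^sub>F w in nhds 0. pt w \<in> V"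
    using V by (metis isCont_def tendsto_at_iff_tendsto_nhds topological_tendstoD)
  then obtain \<epsilon>1 where \<epsilon>1: "\<epsilon>1 > 0" "\<And>w. norm w < \<epsilon>1 \<Longrightarrow> pt w \<in> V"
    unfolding eventually_nhds_metric by (auto simp: dist_norm)
  have "isCont k 1" using hol(2) by (auto dest!: holomorphic_on_imp_continuous_on continuous_on_interior)
  then have "\<forall>\<^sub>F z in nhds 1. k z \<noteq> 0"
    using hol(3) tendsto_imp_eventually_ne by (metis isCont_def tendsto_at_iff_tendsto_nhds)
  then obtain \<epsilon>2 where \<epsilon>2: "\<epsilon>2 > 0" "\<And>z. norm (z - 1) < \<epsilon>2 \<Longrightarrow> k z \<noteq> 0"
    unfolding eventually_nhds_metric by (auto simp: dist_norm)
  define \<epsilon> where "\<epsilon> = min (1/2) (min (\<epsilon>1 / 2) (\<epsilon>2 / 2))"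
  have \<epsilon>: "\<epsilon> > 0" "\<epsilon> \<le> 1/2" "\<epsilon> < \<epsilon>1" "\<epsilon> < \<epsilon>2" using \<epsilon>1 \<epsilon>2 by (auto simp: \<epsilon>_def)
  define e where "e u = exp (2 * of_real pi * \<i> * of_real u)" for u :: real
  have ne: "norm (e u) = 1" for u by (simp add: e_def)
  define loop where "loop u = pt (of_real \<epsilon> * e u)" for u
  have small: "norm (of_real \<epsilon> * e u) = \<epsilon>" for u using \<epsilon> ne by (simp add: norm_mult)
  have w1: "of_real \<epsilon> * e u \<noteq> 1" for u using small[of u] \<epsilon> by (metis norm_one not_le one_less_numeral_iff divide_less_eq_1_pos zero_less_numeral semiring_norm(76))
  have zl: "zmap n q (loop u) = 1 - of_real \<epsilon> * e u" for u unfolding loop_def by (rule zpt[OF w1])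
  have sl: "snd (loop u) = x0" for u by (simp add: loop_def pt_def)
  have lV: "loop u \<in> V" for u unfolding loop_def by (rule \<epsilon>1(2)) (use small \<epsilon> in simp)
  have lK: "loop u \<notin> Kset n q" for u
    unfolding not_in_Kset[OF q] zl sl using x0 \<epsilon> by (simp add: e_def)
  have nr: "1 - of_real \<epsilon> * e u \<notin> \<real>\<^sub>\<le>\<^sub>0" for u
  proof -
    have "Re (of_real \<epsilon> * e u) \<le> \<epsilon>" using complex_Re_le_cmod[of "of_real \<epsilon> * e u"] small by simp
    then have "Re (of_real \<epsilon> * e u) < 1" using \<epsilon> by linarith
    then have "Re (1 - of_real \<epsilon> * e u) > 0" by (simp only: minus_complex.sel one_complex.sel)
    then show ?thesis by (auto simp: complex_nonpos_Reals_iff)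
  qed
  have path: "path loop"
    unfolding path_def loop_def pt_def e_def using nr[unfolded e_def]
    by (intro continuous_intros) (auto simp: of_nat_plus_2_nonzero)
  have e01: "e 0 = 1" "e 1 = 1" by (simp_all add: e_def)
  define Q where "Q = loop 0"
  have zQ: "zmap n q Q = 1 - of_real \<epsilon>" using zl[of 0] by (simp add: Q_def e01)
  have Q: "Q \<in> V - Kset n q" using lV lK by (simp add: Q_def)
  have sQ: "snd Q \<noteq> 0" using sl x0 by (simp add: Q_def)
  have zQ01: "zmap n q Q \<in> ball 0 1 \<inter> ball 1 1"
  proof -
    have "norm (1 - of_real \<epsilon> :: complex) = \<bar>1 - \<epsilon>\<bar>"
      by (metis norm_of_real of_real_1 of_real_diff)
    moreover from this have "norm (of_real \<epsilon> - 1 :: complex) = \<bar>1 - \<epsilon>\<bar>" by (simp only: norm_minus_commute)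
    ultimately show ?thesis unfolding zQ using \<epsilon> by (simp add: dist_norm)
  qed
  have br: "branch_at (\<Omega> n q r - Kset n q) (initial_region n q \<inter> \<Omega> n q r) (pullback n q l f0) Q (pullback n q l f0)"
    unfolding branch_at_def
  proof (intro exI[of _ "linepath Q Q"] conjI)
    show "pathstart (linepath Q Q) \<in> initial_region n q \<inter> \<Omega> n q r"
      using sQ zQ01 Q V by (auto simp: initial_region_iff)
    show "continues_along (\<Omega> n q r - Kset n q) (linepath Q Q) (pullback n q l f0) (pullback n q l f0)"
      by (rule continues_along_pullback[where D = "\<lambda>_. ball 0 1" and y = "\<lambda>_. f0"])
        (use Q V sQ zQ01 hol(4) in \<open>auto simp: linepath_refl path_def\<close>)
  qed simp
  \<comment> \<open>the branch of \<open>log (1 - z)\<close> that follows the loop: the principal one, after rotating back by \<open>e u\<close>\<close>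
  define y where "y u z = h1 z + B * (exp (s * (Ln ((1 - z) / e u) + 2 * of_real pi * \<i> * of_real u)) * k z)" for u z
  define D where "D u = ball 1 1 \<inter> {z. Re ((1 - z) / e u) > 0}" for u
  have cont: "continues_along (V - Kset n q) loop (pullback n q l (y 0)) (pullback n q l (y 1))"
  proof (rule continues_along_pullback[OF path])
    show "path_image loop \<subseteq> V - Kset n q" using lV lK by (auto simp: path_image_def)
    fix u :: real
    have e0: "e u \<noteq> 0" by (simp add: e_def)
    have "open (D u)" unfolding D_def using e0
      by (intro open_Int open_ball open_Collect_less continuous_intros) auto
    moreover have "y u holomorphic_on D u"
      unfolding y_def D_def
      by (intro holomorphic_intros holomorphic_on_subset[OF hol(1)] holomorphic_on_subset[OF hol(2)])
        (use e0 in \<open>auto simp: complex_nonpos_Reals_iff\<close>)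
    moreover have "zmap n q (loop u) \<in> D u"
      unfolding D_def zl using small[of u] \<epsilon> e0 by (simp add: dist_norm)
    ultimately show "open (D u) \<and> y u holomorphic_on D u \<and> zmap n q (loop u) \<in> D u \<and> snd (loop u) \<noteq> 0"
      using sl x0 by simp
    fix u' :: real and z assume u': "\<bar>u' - u\<bar> < 1/4" and z: "z \<in> D u" "z \<in> D u'"
    define v where "v = (1 - z) / e u"
    define v' where "v' = (1 - z) / e u'"
    have v: "Re v > 0" "Re v' > 0" using z by (auto simp: D_def v_def v'_def)
    have v0: "v \<noteq> 0" "v' \<noteq> 0" using v by auto
    have "Ln v' + 2 * of_real pi * \<i> * of_real u' = Ln v + 2 * of_real pi * \<i> * of_real u"
    proof (rule exp_complex_eqI)
      show "exp (Ln v' + 2 * of_real pi * \<i> * of_real u') = exp (Ln v + 2 * of_real pi * \<i> * of_real u)"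
        using v0 by (simp add: exp_add e_def[symmetric]) (simp add: v_def v'_def e_def)
      have "\<bar>Im (Ln v)\<bar> < pi / 2" "\<bar>Im (Ln v')\<bar> < pi / 2"
        using v v0 Re_Ln_pos_lt by blast+
      moreover have "2 * pi * \<bar>u' - u\<bar> < pi / 2" using u' pi_gt_zero by simp
      then have "\<bar>2 * pi * (u' - u)\<bar> < pi / 2" by (simp add: abs_mult)
      then have "\<bar>2 * pi * u' - 2 * pi * u\<bar> < pi / 2" by (simp add: right_diff_distrib)
      moreover have "Im (Ln x + 2 * of_real pi * \<i> * of_real t) = Im (Ln x) + 2 * pi * t" for x and t :: real
        by simp
      ultimately show "\<bar>Im (Ln v' + 2 * of_real pi * \<i> * of_real u') - Im (Ln v + 2 * of_real pi * \<i> * of_real u)\<bar> < 2 * pi"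
        by (simp only:)
    qed
    then show "y u' z = y u z" unfolding y_def v_def v'_def by simp
  qed
  have y0: "\<forall>\<^sub>F w in nhds (zmap n q Q). y 0 w = f0 w"
  proof -
    have "\<forall>\<^sub>F w in nhds (zmap n q Q). w \<in> ball 0 1 \<inter> ball 1 1"
      by (rule eventually_nhds_in_open[OF _ zQ01]) auto
    then show ?thesis by eventually_elim (use near in \<open>simp add: y_def e01\<close>)
  qed
  have "\<not> same_germ Q (pullback n q l (y 1)) (pullback n q l f0)"
  proof
    assume "same_germ Q (pullback n q l (y 1)) (pullback n q l f0)"
    then have "pullback n q l (y 1) Q = pullback n q l f0 Q"
      unfolding same_germ_def using eventually_nhds_x_imp_x by fast
    moreover have "f0 (zmap n q Q) = y 0 (zmap n q Q)" using y0 eventually_nhds_x_imp_x by fastforce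
    ultimately have "y 1 (zmap n q Q) = y 0 (zmap n q Q)" using sQ by (simp add: pullback_def)
    moreover have "k (zmap n q Q) \<noteq> 0" by (rule \<epsilon>2(2)) (use \<epsilon> in \<open>simp add: zQ\<close>)
    ultimately have "exp (s * (Ln (1 - zmap n q Q) + 2 * of_real pi * \<i>)) = exp (s * Ln (1 - zmap n q Q))"
      using B by (simp add: y_def e01)
    then obtain j :: int where "s * (Ln (1 - zmap n q Q) + 2 * of_real pi * \<i>) = s * Ln (1 - zmap n q Q) + of_int (2 * j) * of_real pi * \<i>"
      unfolding exp_eq by (auto simp: mult_ac)
    then have "s = of_int j" by (simp add: algebra_simps)
    with s show False by simp
  qed
  moreover have "continues_along (V - Kset n q) loop (pullback n q l f0) (pullback n q l (y 1))"
    by (rule continues_along_germ[OF cont])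
      (use same_germ_pullback[OF sQ y0] in \<open>auto simp: pathstart_def Q_def same_germ_def\<close>)
  moreover have "pathstart loop = Q" "pathfinish loop = Q"
    by (simp_all add: pathstart_def pathfinish_def Q_def loop_def e01)
  ultimately show "\<exists>Q\<in>V - (K\<^sub>1 \<union> K\<^sub>2 n q). \<exists>g \<gamma> g'.
      branch_at (\<Omega> n q r - (K\<^sub>1 \<union> K\<^sub>2 n q)) (initial_region n q \<inter> \<Omega> n q r) (pullback n q l f0) Q g \<and>
      pathstart \<gamma> = Q \<and> pathfinish \<gamma> = Q \<and> continues_along (V - (K\<^sub>1 \<union> K\<^sub>2 n q)) \<gamma> g g' \<and> \<not> same_germ Q g' g"
    unfolding Kset_def[symmetric] using Q br by blast
qed

section \<open>The Cauchy problem\<close>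

lemma has_derivative_power_div:
  fixes s :: complex
  assumes "s \<noteq> 0"
  shows "((\<lambda>s. s ^ k) has_field_derivative of_nat k * s ^ k / s) (at s)"
proof -
  have "of_nat k * (1 * s ^ (k - Suc 0)) = of_nat k * s ^ k / s"
    using assms by (cases k) auto
  then show ?thesis using DERIV_power[OF DERIV_ident, where n = k and x = s and s = UNIV] by metis
qed

text \<open>
  Put \<open>N = n + 2\<close>. The chain rule turns \<open>L U\<close> into \<open>N\<^sup>2 x\<^bsup>m+l\<^esup> t\<^sup>-\<^sup>2 z\<close> times the left-hand side of the Gauss
  equation for \<open>F\<close> at \<open>z\<close>: the relation \<open>q = m - p + 2\<close> makes the two halves of the operator homogeneous of the same
  degree, and \<open>\<alpha>\<close> is chosen such that \<open>q\<^sup>2 a b = l (l - 1) + A l + B\<close>.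
\<close>

lemma U_sol_solves:
  fixes m n p q l :: nat and \<gamma> A B \<alpha> a b c :: complex
  assumes q: "int q = int m - int p + 2" "q > 0"
    and \<alpha>: "\<alpha> * (\<alpha> - A + 1) = - B"
    and a: "a = - (\<alpha> + of_nat l) / of_nat q"
    and b: "b = (1 + \<alpha> - A - of_nat l) / of_nat q"
    and c: "c = (of_nat n + \<gamma> + 1) / of_nat (n + 2)"
    and c': "c \<notin> \<int>\<^sub>\<le>\<^sub>0"
  shows "solves_cauchy_problem m n p \<gamma> A B l (initial_region n q) (U_sol n q l a b c)"
  unfolding solves_cauchy_problem_def
proof (intro conjI ballI allI impI)
  define F where "F = gauss_F a b c"
  have F: "hg_sol a b c F (ball 0 1)" unfolding F_def by (rule gauss_hg_sol[OF c'])
  show "holo2_on (U_sol n q l a b c) (initial_region n q)"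
    unfolding U_sol_pullback F_def[symmetric]
    by (rule holo2_on_pullback[OF hg_sol_holo[OF F]]) (auto simp: initial_region_iff)
  define N where "N = (of_nat (n + 2) :: complex)"
  define qc where "qc = (of_nat q :: complex)"
  define lc where "lc = (of_nat l :: complex)"
  have N0: "N \<noteq> 0" unfolding N_def using of_nat_plus_2_nonzero by simp
  have q0: "qc \<noteq> 0" using q(2) by (simp add: qc_def)
  have \<kappa>: "\<kappa> n q = (qc / N)\<^sup>2" by (simp add: \<kappa>_def qc_def N_def)
  define zz where "zz t x = \<kappa> n q * t ^ (n + 2) / x ^ q" for t x
  have U: "U_sol n q l a b c (t, x) = x ^ l * F (zz t x)" for t x
    by (simp add: U_sol_pullback pullback_def F_def zmap_Pair zz_def)
  note dF = hg_sol_has_derivs[OF open_ball F]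
  {
    fix x assume "(0, x) \<in> initial_region n q"
    then have x: "x \<noteq> 0" by (simp add: initial_region_iff)
    show "U_sol n q l a b c (0, x) = x ^ l" by (simp add: U zz_def F_def)
    have "((\<lambda>s. zz s x) has_field_derivative 0) (at 0)"
      unfolding zz_def using x by (auto intro!: derivative_eq_intros)
    moreover have "(F has_field_derivative deriv F 0) (at (zz 0 x))" using dF(1)[of 0] by (simp add: zz_def)
    ultimately have "((\<lambda>s. F (zz s x)) has_field_derivative deriv F 0 * 0) (at 0)"
      by (rule DERIV_chain2[rotated])
    then have "((\<lambda>s. x ^ l * F (zz s x)) has_field_derivative x ^ l * 0) (at 0)"
      by (auto intro!: derivative_eq_intros)
    then show "deriv (\<lambda>s. U_sol n q l a b c (s, x)) 0 = 0"
      unfolding U by (simp add: DERIV_imp_deriv)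
  }
  fix tx assume tx: "tx \<in> initial_region n q"
  obtain t x where tx_eq: "tx = (t, x)" by (cases tx)
  show "case tx of (t, x) \<Rightarrow> t \<noteq> 0 \<longrightarrow> L_op m n p \<gamma> A B (U_sol n q l a b c) t x = 0"
    unfolding tx_eq prod.case
  proof
    assume t: "t \<noteq> 0"
    have x: "x \<noteq> 0" and z1: "norm (zz t x) < 1"
      using tx by (auto simp: tx_eq initial_region_iff zmap_Pair zz_def)
    define z where "z = zz t x"
    define w where "w = F z"
    define w1 where "w1 = deriv F z"
    define w2 where "w2 = deriv (deriv F) z"
    have ode: "z * (1 - z) * w2 + (c - (a + b + 1) * z) * w1 - a * b * w = 0"
      using hg_sol_eq[OF F, of z] z1 by (simp add: w_def w1_def w2_def z_def)
    have dzt: "((\<lambda>s. zz s x) has_field_derivative N * zz s x / s) (at s)" if "s \<noteq> 0" for s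
      using DERIV_cmult[OF has_derivative_power_div[OF that, of "n + 2"], of "\<kappa> n q / x ^ q"]
      unfolding zz_def N_def by (simp only: times_divide_eq_left times_divide_eq_right mult_ac)
    have dzx: "((\<lambda>y. zz t y) has_field_derivative - qc * zz t y / y) (at y)" if "y \<noteq> 0" for y
    proof -
      have "((\<lambda>y. \<kappa> n q * t ^ (n + 2) * inverse (y ^ q)) has_field_derivative
          \<kappa> n q * t ^ (n + 2) * - (inverse (y ^ q) * (of_nat q * y ^ q / y) * inverse (y ^ q))) (at y)"
        by (intro DERIV_cmult DERIV_inverse' has_derivative_power_div that) (use that in simp)
      moreover have "\<kappa> n q * t ^ (n + 2) * - (inverse (y ^ q) * (of_nat q * y ^ q / y) * inverse (y ^ q)) = - qc * zz t y / y"
        using that by (simp add: zz_def qc_def field_simps)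
      ultimately have "((\<lambda>y. \<kappa> n q * t ^ (n + 2) * inverse (y ^ q)) has_field_derivative - qc * zz t y / y) (at y)"
        by (simp only:)
      then show ?thesis by (simp only: zz_def divide_inverse)
    qed
    have dpow: "((\<lambda>y. y ^ l) has_field_derivative lc * y ^ l / y) (at y)" if "y \<noteq> 0" for y :: complex
      unfolding lc_def using that by (rule has_derivative_power_div)
    define S where "S = {s. s \<noteq> 0} \<inter> {s. norm (zz s x) < 1}"
    have opS: "open S" unfolding S_def zz_def using x
      by (intro open_Int open_Collect_neq open_Collect_less continuous_intros) auto
    have tS: "t \<in> S" using t z1 by (simp add: S_def)
    have ut: "((\<lambda>s. x ^ l * F (zz s x)) has_field_derivative x ^ l * (deriv F (zz s x) * (N * zz s x / s))) (at s)"
      if "s \<in> S" for s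
      by (intro DERIV_cmult DERIV_chain2[OF dF(1) dzt]) (use that in \<open>auto simp: S_def\<close>)
    have d1: "deriv (\<lambda>s. x ^ l * F (zz s x)) s = x ^ l * (deriv F (zz s x) * (N * zz s x / s))" if "s \<in> S" for s
      using ut[OF that] by (rule DERIV_imp_deriv)
    have utt: "((\<lambda>s. x ^ l * (deriv F (zz s x) * (N * zz s x / s))) has_field_derivative
        x ^ l * (N\<^sup>2 * z\<^sup>2 * w2 + N * (N - 1) * z * w1) / t\<^sup>2) (at t)"
    proof -
      note [derivative_intros] = DERIV_chain2[OF dF(2) dzt, of t] dzt[OF t]
      show ?thesis
        by (rule derivative_eq_intros refl | (use t z1 in \<open>simp add: z_def[symmetric] w1_def[symmetric] w2_def[symmetric]\<close>; fail) |
          (use t in \<open>simp add: z_def[symmetric] w1_def[symmetric] w2_def[symmetric] field_simps power2_eq_square\<close>))+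
    qed
    have dd1: "deriv (deriv (\<lambda>s. x ^ l * F (zz s x))) t = x ^ l * (N\<^sup>2 * z\<^sup>2 * w2 + N * (N - 1) * z * w1) / t\<^sup>2"
      by (rule DERIV_imp_deriv, rule has_field_derivative_transform_within_open[OF utt opS tS]) (simp add: d1)
    define S' where "S' = {y. y \<noteq> 0 \<and> norm (zz t y) < 1}"
    have opS': "open S'"
    proof -
      have "S' = {y. y \<noteq> 0} \<inter> {y. norm (\<kappa> n q * t ^ (n + 2)) < norm (y ^ q)}"
        unfolding S'_def zz_def by (auto simp: norm_divide divide_less_eq)
      moreover have "open ({y::complex. y \<noteq> 0} \<inter> {y. norm (\<kappa> n q * t ^ (n + 2)) < norm (y ^ q)})"
        by (intro open_Int open_Collect_neq open_Collect_less continuous_intros)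
      ultimately show ?thesis by simp
    qed
    have xS': "x \<in> S'" using x z1 by (simp add: S'_def)
    have ux: "((\<lambda>y. y ^ l * F (zz t y)) has_field_derivative
        y ^ l / y * (lc * F (zz t y) - qc * zz t y * deriv F (zz t y))) (at y)" if "y \<in> S'" for y
    proof -
      have y: "y \<noteq> 0" "norm (zz t y) < 1" using that by (auto simp: S'_def)
      have "((\<lambda>y. y ^ l * F (zz t y)) has_field_derivative
        lc * y ^ l / y * F (zz t y) + deriv F (zz t y) * (- qc * zz t y / y) * y ^ l) (at y)"
        by (intro DERIV_mult dpow DERIV_chain2[OF dF(1) dzx]) (use y in auto)
      then show ?thesis using y by (simp add: field_simps)
    qed
    have d2: "deriv (\<lambda>y. y ^ l * F (zz t y)) y = y ^ l / y * (lc * F (zz t y) - qc * zz t y * deriv F (zz t y))" if "y \<in> S'" for y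
      using ux[OF that] by (rule DERIV_imp_deriv)
    have uxx: "((\<lambda>y. y ^ l / y * (lc * F (zz t y) - qc * zz t y * deriv F (zz t y))) has_field_derivative
        x ^ l / x\<^sup>2 * (lc * (lc - 1) * w - (lc - 1) * qc * z * w1 - qc * z * (lc * w1 - qc * w1 - qc * z * w2))) (at x)"
    proof -
      have 1: "((\<lambda>y. y ^ l / y) has_field_derivative (lc - 1) * x ^ l / x\<^sup>2) (at x)"
      proof -
        have "((\<lambda>y. y ^ l / y) has_field_derivative (lc * x ^ l / x * x - x ^ l * 1) / (x * x)) (at x)"
          by (rule DERIV_divide[OF dpow[OF x] DERIV_ident x])
        moreover have "(lc * x ^ l / x * x - x ^ l * 1) / (x * x) = (lc - 1) * x ^ l / x\<^sup>2"
          using x by (simp add: field_simps power2_eq_square)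
        ultimately show ?thesis by simp
      qed
      have 2: "((\<lambda>y. lc * F (zz t y) - qc * zz t y * deriv F (zz t y)) has_field_derivative
        lc * (w1 * (- qc * z / x)) - (qc * (- qc * z / x) * w1 + (w2 * (- qc * z / x)) * (qc * z))) (at x)"
        unfolding w1_def w2_def z_def
        by (intro DERIV_diff DERIV_cmult DERIV_mult DERIV_chain2[OF dF(1) dzx] DERIV_chain2[OF dF(2) dzx] dzx x) (use z1 x in auto)
      have "(lc - 1) * x ^ l / x\<^sup>2 * (lc * w - qc * z * w1)
          + (lc * (w1 * (- qc * z / x)) - (qc * (- qc * z / x) * w1 + (w2 * (- qc * z / x)) * (qc * z))) * (x ^ l / x) =
        x ^ l / x\<^sup>2 * (lc * (lc - 1) * w - (lc - 1) * qc * z * w1 - qc * z * (lc * w1 - qc * w1 - qc * z * w2))"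
        using x by (simp add: field_simps power2_eq_square)
      then show ?thesis using DERIV_mult[OF 1 2]
        unfolding w_def[symmetric] w1_def[symmetric] z_def[symmetric] by (simp only:)
    qed
    have dd2: "deriv (deriv (\<lambda>y. y ^ l * F (zz t y))) x =
        x ^ l / x\<^sup>2 * (lc * (lc - 1) * w - (lc - 1) * qc * z * w1 - qc * z * (lc * w1 - qc * w1 - qc * z * w2))"
      by (rule DERIV_imp_deriv, rule has_field_derivative_transform_within_open[OF uxx opS' xS']) (simp add: d2)
    have pw: "t ^ n * x powi (int p - 2) = x ^ m / t\<^sup>2 * (N\<^sup>2 / qc\<^sup>2) * z"
    proof -
      have "int p - 2 = int m - int q" using q(1) by simp
      then have "x powi (int p - 2) = x ^ m / x ^ q" using x by (simp add: power_int_diff)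
      moreover have "z = (qc / N)\<^sup>2 * (t ^ n * t\<^sup>2) / x ^ q" by (simp add: z_def zz_def \<kappa> power_add power2_eq_square)
      ultimately show ?thesis using N0 q0 t x by (simp only:) (simp add: field_simps power2_eq_square)
    qed
    have qa: "qc * a = - (\<alpha> + lc)" using q0 by (simp add: a qc_def lc_def)
    have qb: "qc * b = 1 + \<alpha> - A - lc" using q0 by (simp add: b qc_def lc_def)
    have Nc: "N * c = N - 1 + \<gamma>" using N0 unfolding c N_def[symmetric] by (simp add: N_def)
    have ab: "qc\<^sup>2 * (a * b) = lc * (lc - 1) + A * lc + B" using qa qb \<alpha> by algebra
    have apb: "qc\<^sup>2 * (a + b + 1) = - ((lc - 1) * qc) - qc * lc + qc\<^sup>2 - A * qc" using qa qb by algebra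
    define r where "r = N\<^sup>2 / qc\<^sup>2"
    have r: "r * qc\<^sup>2 = N\<^sup>2" using q0 by (simp add: r_def)
    have xx: "x\<^sup>2 * (x ^ l / x\<^sup>2 * X) = x ^ l * X" "x * (x ^ l / x * X) = x ^ l * X" for X using x by simp_all
    have tt: "\<gamma> / t * (x ^ l * (w1 * (N * z / t))) = x ^ l * (\<gamma> * N * z * w1) / t\<^sup>2"
      using t by (simp add: power2_eq_square field_simps)
    have D2: "(deriv ^^ 2) f = deriv (deriv f)" for f :: "complex \<Rightarrow> complex"
      by (simp add: numeral_2_eq_2)
    have "L_op m n p \<gamma> A B (U_sol n q l a b c) t x =
      x ^ m * (x ^ l * (N\<^sup>2 * z\<^sup>2 * w2 + N * (N - 1) * z * w1) / t\<^sup>2 + \<gamma> / t * (x ^ l * (w1 * (N * z / t))))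
      - x ^ m / t\<^sup>2 * r * z * (x\<^sup>2 * (x ^ l / x\<^sup>2 * (lc * (lc - 1) * w - (lc - 1) * qc * z * w1 - qc * z * (lc * w1 - qc * w1 - qc * z * w2)))
        + A * (x * (x ^ l / x * (lc * w - qc * z * w1))) + B * (x ^ l * w))"
      unfolding L_op_def U D2 dd1 dd2 d1[OF tS] d2[OF xS'] pw r_def[symmetric]
        z_def[symmetric] w_def[symmetric] w1_def[symmetric]
      by (simp only: mult.assoc)
    also have "\<dots> = x ^ m * x ^ l / t\<^sup>2 * (N\<^sup>2 * z\<^sup>2 * w2 + N * (N - 1 + \<gamma>) * z * w1
       - r * z * ((lc * (lc - 1) + A * lc + B) * w + (- ((lc - 1) * qc) - qc * lc + qc\<^sup>2 - A * qc) * z * w1 + qc\<^sup>2 * z\<^sup>2 * w2))"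
      unfolding xx tt by (simp add: algebra_simps power2_eq_square add_divide_distrib diff_divide_distrib)
    also have "\<dots> = x ^ m * x ^ l / t\<^sup>2 * (N\<^sup>2 * z * (z * (1 - z) * w2 + (c - (a + b + 1) * z) * w1 - a * b * w))"
      unfolding ab[symmetric] apb[symmetric] Nc[symmetric]
    proof -
      have "N\<^sup>2 * z\<^sup>2 * w2 + N * (N * c) * z * w1 - r * z * (qc\<^sup>2 * (a * b) * w + qc\<^sup>2 * (a + b + 1) * z * w1 + qc\<^sup>2 * z\<^sup>2 * w2)
        = N\<^sup>2 * z\<^sup>2 * w2 + N\<^sup>2 * c * z * w1 - (r * qc\<^sup>2) * z * ((a * b) * w + (a + b + 1) * z * w1 + z\<^sup>2 * w2)"
        by (simp add: algebra_simps power2_eq_square)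
      also have "\<dots> = N\<^sup>2 * z * (z * (1 - z) * w2 + (c - (a + b + 1) * z) * w1 - a * b * w)"
        unfolding r by (simp add: algebra_simps power2_eq_square)
      finally show "x ^ m * x ^ l / t\<^sup>2 * (N\<^sup>2 * z\<^sup>2 * w2 + N * (N * c) * z * w1 - r * z * (qc\<^sup>2 * (a * b) * w + qc\<^sup>2 * (a + b + 1) * z * w1 + qc\<^sup>2 * z\<^sup>2 * w2)) =
       x ^ m * x ^ l / t\<^sup>2 * (N\<^sup>2 * z * (z * (1 - z) * w2 + (c - (a + b + 1) * z) * w1 - a * b * w))"
        by simp
    qed
    finally show "L_op m n p \<gamma> A B (U_sol n q l a b c) t x = 0" by (simp add: ode)
  qed
qed

section \<open>The local system of solutions\<close>

lemma has_derivative_Ln_quotient: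
  assumes "z \<noteq> 0" "Re (w / z) > 0"
  shows "((\<lambda>w. Ln (w / z) + Ln z) has_field_derivative 1 / w) (at w)" "exp (Ln (w / z) + Ln z) = w"
proof -
  have "w / z \<notin> \<real>\<^sub>\<le>\<^sub>0" "w \<noteq> 0" using assms(2) by (auto simp: complex_nonpos_Reals_iff)
  then show "((\<lambda>w. Ln (w / z) + Ln z) has_field_derivative 1 / w) (at w)"
    using assms(1) by (auto intro!: derivative_eq_intros simp: field_simps)
  show "exp (Ln (w / z) + Ln z) = w" using assms(1) \<open>w \<noteq> 0\<close> by (simp add: exp_add)
qed

definition hg_germ :: "complex \<Rightarrow> complex \<Rightarrow> complex \<Rightarrow> complex \<Rightarrow> (complex \<Rightarrow> complex) \<Rightarrow> bool"
  where "hg_germ a b c z y \<longleftrightarrow> (\<exists>\<epsilon>>0. hg_sol a b c y (ball z \<epsilon>))"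

lemma hg_germI: "hg_sol a b c y S \<Longrightarrow> open S \<Longrightarrow> z \<in> S \<Longrightarrow> hg_germ a b c z y"
  unfolding hg_germ_def by (meson hg_sol_subset openE)

text \<open>
  Local existence and uniqueness on a disc around \<open>z0\<close> that avoids \<open>0\<close> and \<open>1\<close>.
\<close>

lemma local_system_hg: "local_system (hg_germ a b c)"
  unfolding local_system_def
proof (intro allI impI)
  fix z0 :: complex assume "z0 \<noteq> 0" "z0 \<noteq> 1"
  define \<epsilon> where "\<epsilon> = min (norm z0) (norm (z0 - 1))"
  have \<epsilon>: "\<epsilon> > 0" using \<open>z0 \<noteq> 0\<close> \<open>z0 \<noteq> 1\<close> by (simp add: \<epsilon>_def)
  have av: "0 \<notin> ball z0 \<epsilon>" "1 \<notin> ball z0 \<epsilon>" by (auto simp: \<epsilon>_def dist_norm)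
  show "\<exists>\<epsilon>>0. \<forall>z1\<in>ball z0 \<epsilon>. \<forall>y. hg_germ a b c z1 y \<longrightarrow>
    (\<exists>y'. y' holomorphic_on ball z0 \<epsilon> \<and> (\<forall>\<^sub>F w in nhds z1. y' w = y w) \<and> (\<forall>z\<in>ball z0 \<epsilon>. hg_germ a b c z y'))"
  proof (intro exI[of _ \<epsilon>] conjI \<epsilon> ballI allI impI)
    fix z1 y assume z1: "z1 \<in> ball z0 \<epsilon>" and "hg_germ a b c z1 y"
    then obtain e where e: "e > 0" "hg_sol a b c y (ball z1 e)" by (auto simp: hg_germ_def)
    obtain d where d: "d > 0" "ball z1 d \<subseteq> ball z0 \<epsilon>" using z1 open_contains_ball open_ball by metis
    define m where "m = min d e"
    have m: "m > 0" "ball z1 m \<subseteq> ball z0 \<epsilon>" "ball z1 m \<subseteq> ball z1 e"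
      using d e by (auto simp: m_def)
    obtain y' where y': "hg_sol a b c y' (ball z0 \<epsilon>)" "y' z1 = y z1" "deriv y' z1 = deriv y z1"
      using hg_exists[OF open_ball convex_ball av z1] by metis
    have avm: "0 \<notin> ball z1 m" "1 \<notin> ball z1 m" using m(2) av by blast+
    have "y' w = y w" if "w \<in> ball z1 m" for w
      by (rule hg_unique[OF hg_sol_subset[OF y'(1) m(2)] hg_sol_subset[OF e(2) m(3)] open_ball _ avm _ y'(2,3) that])
        (use m(1) in auto)
    then have "\<forall>\<^sub>F w in nhds z1. y' w = y w"
      using eventually_nhds_in_open[of "ball z1 m" z1] m(1) by (auto elim: eventually_mono)
    then show "\<exists>y'. y' holomorphic_on ball z0 \<epsilon> \<and> (\<forall>\<^sub>F w in nhds z1. y' w = y w) \<and> (\<forall>z\<in>ball z0 \<epsilon>. hg_germ a b c z y')"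
      using y'(1) hg_sol_holo hg_germI by blast
  qed
qed

text \<open>
  The half-plane \<open>Re (w/z) > 1/\<bar>z\<bar>\<close> contains \<open>z\<close>, lies in \<open>\<bar>w\<bar> > 1\<close>, is unbounded and carries a
  logarithm.
\<close>

lemma hg_germ_at_infinity:
  assumes ab: "a - b \<notin> \<int>" and z: "norm z > 1" and y: "hg_germ a b c z y"
  shows "\<exists>k1 k2 \<Lambda>. isCont \<Lambda> z \<and> (\<forall>\<^sub>F w in nhds z. exp (\<Lambda> w) = w \<and>
    y w = k1 * inf_sol a b c \<Lambda> w + k2 * inf_sol b a c \<Lambda> w)"
proof -
  have z0: "z \<noteq> 0" using z by auto
  define S where "S = {w. Re (w * inverse z) > 1 / norm z}"
  have opS: "open S" unfolding S_def by (intro open_Collect_less continuous_intros)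
  have "S = (\<lambda>w. w * inverse z) -` {u. Re u > 1 / norm z}" by (auto simp: S_def)
  moreover have "convex ((\<lambda>w. w * inverse z) -` {u. Re u > 1 / norm z})"
    by (intro convex_linear_vimage convex_halfspace_Re_gt bounded_linear.linear bounded_linear_mult_left)
  ultimately have cvS: "convex S" by simp
  have pos: "Re (w / z) > 0" if "w \<in> S" for w
  proof -
    have "0 < 1 / norm z" using z0 by simp
    also have "\<dots> < Re (w / z)" using that by (simp add: S_def divide_inverse)
    finally show ?thesis .
  qed
  have gt1: "norm w > 1" if "w \<in> S" for w
  proof -
    have "1 / norm z < Re (w / z)" using that by (simp add: S_def divide_inverse)
    also have "\<dots> \<le> norm w / norm z" using complex_Re_le_cmod[of "w / z"] by (simp add: norm_divide)
    finally show ?thesis using z0 by (simp add: divide_less_cancel)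
  qed
  have zz: "z * inverse z = 1" using z0 by simp
  have zS: "z \<in> S" unfolding S_def mem_Collect_eq zz using z z0 by (simp add: divide_less_eq)
  define \<Lambda> where "\<Lambda> w = Ln (w / z) + Ln z" for w
  have \<Lambda>: "(\<Lambda> has_field_derivative 1 / w) (at w)" "exp (\<Lambda> w) = w" if "w \<in> S" for w
    unfolding \<Lambda>_def[abs_def] using has_derivative_Ln_quotient[OF z0 pos[OF that]] by auto
  have unb: "\<not> bounded S" unfolding bounded_iff
  proof
    assume "\<exists>M. \<forall>w\<in>S. norm w \<le> M"
    then obtain M where M: "\<And>w. w \<in> S \<Longrightarrow> norm w \<le> M" by blast
    define w where "w = of_real (\<bar>M\<bar> + 1) * z"
    have "Re (w * inverse z) = \<bar>M\<bar> + 1" using z0 by (simp add: w_def mult.assoc)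
    moreover have "1 / norm z < 1" using z by (simp add: divide_less_eq)
    ultimately have "w \<in> S" unfolding S_def by simp
    moreover have "norm w > M"
    proof -
      have "M < (\<bar>M\<bar> + 1) * 1" by simp
      also have "\<dots> \<le> (\<bar>M\<bar> + 1) * norm z" using z by (intro mult_left_mono) auto
      also have "\<dots> = norm w" unfolding w_def norm_mult norm_of_real by simp
      finally show ?thesis .
    qed
    ultimately show False using M by fastforce
  qed
  obtain e where e: "e > 0" "hg_sol a b c y (ball z e)" using y by (auto simp: hg_germ_def)
  define T where "T = ball z e \<inter> S"
  have T: "open T" "connected T" "T \<subseteq> S" "z \<in> T" "hg_sol a b c y T"
    using e opS cvS zS by (auto simp: T_def intro!: convex_connected convex_Int intro: hg_sol_subset)
  obtain k1 k2 where "\<And>w. w \<in> T \<Longrightarrow> y w = k1 * inf_sol a b c \<Lambda> w + k2 * inf_sol b a c \<Lambda> w"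
    by (rule inf_span[OF ab opS convex_connected[OF cvS] gt1 unb \<Lambda>(1) T(1,2,3) _ T(5)]) (use T(4) in blast)+
  then have "\<forall>\<^sub>F w in nhds z. exp (\<Lambda> w) = w \<and> y w = k1 * inf_sol a b c \<Lambda> w + k2 * inf_sol b a c \<Lambda> w"
    using eventually_nhds_in_open[OF T(1,4)] \<Lambda>(2) T(3) by (auto elim!: eventually_mono)
  moreover have "isCont \<Lambda> z" using DERIV_isCont[OF \<Lambda>(1)[OF zS]] .
  ultimately show ?thesis by blast
qed

section \<open>Elementary solutions\<close>

text \<open>
  The germs of constant multiples of \<open>(1 - z)\<^sup>s R(z)\<close>. This local system is smaller than that of all solutions
  of the Gauss equation and so excludes the second exponent at infinity.
\<close>

definition elem_germ :: "complex \<Rightarrow> (complex \<Rightarrow> complex) \<Rightarrow> complex \<Rightarrow> (complex \<Rightarrow> complex) \<Rightarrow> bool"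
  where "elem_germ s R z y \<longleftrightarrow> (\<exists>C \<Lambda>. isCont \<Lambda> z \<and>
    (\<forall>\<^sub>F w in nhds z. exp (\<Lambda> w) = 1 - w \<and> y w = C * (exp (s * \<Lambda> w) * R w)))"

lemma local_system_elem:
  assumes R: "R holomorphic_on UNIV"
  shows "local_system (elem_germ s R)"
  unfolding local_system_def
proof (intro allI impI)
  fix z0 :: complex assume "z0 \<noteq> 0" "z0 \<noteq> 1"
  define \<epsilon> where "\<epsilon> = norm (1 - z0)"
  have z01: "1 - z0 \<noteq> 0" using \<open>z0 \<noteq> 1\<close> by simp
  have \<epsilon>: "\<epsilon> > 0" using z01 unfolding \<epsilon>_def by simp
  define \<Lambda>0 where "\<Lambda>0 w = Ln ((1 - w) / (1 - z0)) + Ln (1 - z0)" for w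
  have pos: "Re ((1 - w) / (1 - z0)) > 0" if "w \<in> ball z0 \<epsilon>" for w
  proof -
    have "(1 - w) / (1 - z0) = 1 - (w - z0) / (1 - z0)" using z01 by (simp add: field_simps)
    moreover have "Re ((w - z0) / (1 - z0)) < 1"
    proof -
      have "norm ((w - z0) / (1 - z0)) < 1"
        using that \<epsilon> by (simp add: \<epsilon>_def norm_divide dist_norm norm_minus_commute divide_less_eq)
      then show ?thesis using complex_Re_le_cmod le_less_trans by blast
    qed
    ultimately show ?thesis by simp
  qed
  have der: "(\<Lambda>0 has_field_derivative - (1 / (1 - w))) (at w)" and ex: "exp (\<Lambda>0 w) = 1 - w" if "w \<in> ball z0 \<epsilon>" for w
  proof -
    have m: "((\<lambda>w. 1 - w) has_field_derivative - 1) (at w)" by (auto intro!: derivative_eq_intros)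
    show "(\<Lambda>0 has_field_derivative - (1 / (1 - w))) (at w)"
      using DERIV_chain2[OF has_derivative_Ln_quotient(1)[OF z01 pos[OF that]] m] by (simp add: \<Lambda>0_def[abs_def])
    show "exp (\<Lambda>0 w) = 1 - w"
      unfolding \<Lambda>0_def by (rule has_derivative_Ln_quotient(2)[OF z01 pos[OF that]])
  qed
  have hol: "\<Lambda>0 holomorphic_on ball z0 \<epsilon>" using der holomorphic_on_open[OF open_ball] by blast
  show "\<exists>\<epsilon>>0. \<forall>z1\<in>ball z0 \<epsilon>. \<forall>y. elem_germ s R z1 y \<longrightarrow>
    (\<exists>y'. y' holomorphic_on ball z0 \<epsilon> \<and> (\<forall>\<^sub>F w in nhds z1. y' w = y w) \<and> (\<forall>z\<in>ball z0 \<epsilon>. elem_germ s R z y'))"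
  proof (intro exI[of _ \<epsilon>] conjI \<epsilon> ballI allI impI)
    fix z1 y assume z1: "z1 \<in> ball z0 \<epsilon>" and "elem_germ s R z1 y"
    then obtain C \<Lambda> where \<Lambda>: "isCont \<Lambda> z1"
      "\<forall>\<^sub>F w in nhds z1. exp (\<Lambda> w) = 1 - w \<and> y w = C * (exp (s * \<Lambda> w) * R w)"
      unfolding elem_germ_def by blast
    have nb: "\<forall>\<^sub>F w in nhds z1. w \<in> ball z0 \<epsilon>" using z1 by (intro eventually_nhds_in_open) auto
    define D where "D w = \<Lambda> w - \<Lambda>0 w" for w
    have "\<forall>\<^sub>F w in nhds z1. D w = D z1"
    proof (rule logs_differ_by_constant[where k = 1])
      show "isCont D z1" unfolding D_def by (intro continuous_intros \<Lambda>(1) DERIV_isCont[OF der[OF z1]])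
      show "\<forall>\<^sub>F w in nhds z1. exp (D w) = 1" using \<Lambda>(2) nb
      proof eventually_elim
        case (elim w)
        then have "1 - w \<noteq> 0" using pos[OF elim(2)] by auto
        then show ?case using elim ex[OF elim(2)] by (simp add: D_def exp_diff)
      qed
    qed
    then have ev: "\<forall>\<^sub>F w in nhds z1. C * exp (s * D z1) * (exp (s * \<Lambda>0 w) * R w) = y w" using \<Lambda>(2)
    proof eventually_elim
      case (elim w)
      have "exp (s * \<Lambda> w) = exp (s * D z1) * exp (s * \<Lambda>0 w)"
        unfolding elim(1)[symmetric] by (simp add: D_def exp_add[symmetric] algebra_simps)
      then show ?case using elim by (simp add: mult_ac)
    qed
    have "elem_germ s R z (\<lambda>w. C * exp (s * D z1) * (exp (s * \<Lambda>0 w) * R w))" if "z \<in> ball z0 \<epsilon>" for z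
      unfolding elem_germ_def
    proof (intro exI conjI)
      show "isCont \<Lambda>0 z" by (rule DERIV_isCont[OF der[OF that]])
      show "\<forall>\<^sub>F w in nhds z. exp (\<Lambda>0 w) = 1 - w \<and>
          C * exp (s * D z1) * (exp (s * \<Lambda>0 w) * R w) = C * exp (s * D z1) * (exp (s * \<Lambda>0 w) * R w)"
        using eventually_nhds_in_open[OF open_ball that] by (auto elim: eventually_mono simp: ex)
    qed
    moreover have "(\<lambda>w. C * exp (s * D z1) * (exp (s * \<Lambda>0 w) * R w)) holomorphic_on ball z0 \<epsilon>"
      by (intro holomorphic_intros hol holomorphic_on_subset[OF R]) auto
    ultimately show "\<exists>y'. y' holomorphic_on ball z0 \<epsilon> \<and> (\<forall>\<^sub>F w in nhds z1. y' w = y w) \<and> (\<forall>z\<in>ball z0 \<epsilon>. elem_germ s R z y')"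
      using ev by blast
  qed
qed

lemma reflect_polynomial:
  fixes \<rho> :: "nat \<Rightarrow> complex"
  assumes "w \<noteq> 0"
  shows "(\<Sum>i\<le>N. \<rho> i * w ^ i) = w ^ N * (\<Sum>i\<le>N. \<rho> i * (1 / w) ^ (N - i))"
proof -
  have eq: "\<rho> i * w ^ i = w ^ N * (\<rho> i * (1 / w) ^ (N - i))" if "i \<le> N" for i
  proof -
    have "w ^ N = w ^ i * w ^ (N - i)" using that by (simp add: power_add[symmetric])
    then show ?thesis using assms by (simp add: power_divide)
  qed
  show ?thesis unfolding sum_distrib_left by (rule sum.cong[OF refl], rule eq) simp
qed

lemma Ln_one_minus_split:
  assumes "Re z < 0" "norm z > 1"
  shows "Ln (1 - z) = Ln (- z) + Ln (1 - 1 / z)"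
proof (rule exp_complex_eqI)
  have z0: "z \<noteq> 0" "1 - z \<noteq> 0" using assms by auto
  have *: "(- z) * (1 - 1 / z) = 1 - z" using z0 by (simp add: field_simps)
  then have nz: "1 - 1 / z \<noteq> 0" using z0 by (metis mult_zero_right)
  have "Re (1 / z) \<le> norm (1 / z)" by (rule complex_Re_le_cmod)
  also have "\<dots> < 1" using assms by (simp add: norm_divide divide_less_eq)
  finally have p3: "Re (1 - 1 / z) > 0" by simp
  show "exp (Ln (1 - z)) = exp (Ln (- z) + Ln (1 - 1 / z))"
    using z0 nz * by (simp add: exp_add)
  have "\<bar>Im (Ln (1 - z))\<bar> < pi / 2" "\<bar>Im (Ln (- z))\<bar> < pi / 2" "\<bar>Im (Ln (1 - 1 / z))\<bar> < pi / 2"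
    using Re_Ln_pos_lt[of "1 - z"] Re_Ln_pos_lt[of "- z"] Re_Ln_pos_lt[of "1 - 1 / z"] z0 nz p3 assms by auto
  then show "\<bar>Im (Ln (1 - z)) - Im (Ln (- z) + Ln (1 - 1 / z))\<bar> < 2 * pi" by simp
qed

text \<open>
  As \<open>z \<rightarrow> \<infinity>\<close>, \<open>(1 - z)\<^sup>s\<close> times a polynomial of degree \<open>N\<close> is \<open>z\<^bsup>s+N\<^esup>\<close> times a holomorphic function of \<open>1/z\<close>
  with nonzero value at \<open>0\<close>: the only exponent is \<open>e\<close>.
\<close>

lemma elementary_K\<^sub>1_iff:
  fixes \<rho> :: "nat \<Rightarrow> complex"
  assumes q: "q > 0" and r: "r > 0"
    and f0: "\<And>z. z \<in> ball 0 1 \<Longrightarrow> f0 z = exp (s * Ln (1 - z)) * (\<Sum>i\<le>N. \<rho> i * z ^ i)"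
    and \<rho>: "\<rho> N \<noteq> 0" and e: "e = - (s + of_nat N)"
  shows "holomorphic_on_K\<^sub>1 n q r (pullback n q l f0) \<longleftrightarrow> of_nat l + e * of_nat q \<in> \<nat>"
proof -
  define R where "R z = (\<Sum>i\<le>N. \<rho> i * z ^ i)" for z
  have R: "R holomorphic_on S" for S unfolding R_def[abs_def] by (intro holomorphic_intros)
  define G where "G u = exp (s * Ln (1 - u)) * (\<Sum>i\<le>N. \<rho> i * u ^ (N - i))" for u
  have G: "G holomorphic_on ball 0 1" unfolding G_def[abs_def]
    using disc_subset_slit by (intro holomorphic_intros) (auto simp: slit_alt)
  have G0: "G 0 \<noteq> 0"
  proof -
    have "(\<Sum>i\<le>N. \<rho> i * 0 ^ (N - i)) = (\<Sum>i\<le>N. if i = N then \<rho> i else 0)"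
      by (rule sum.cong) (auto simp: power_0_left)
    also have "\<dots> = \<rho> N" by simp
    finally show ?thesis using \<rho> by (simp add: G_def)
  qed
  \<comment> \<open>any second exponent that differs from \<open>e\<close> by a non-integer will do, since its coefficient is \<open>0\<close>\<close>
  have half: "e - (e - 1/2) \<notin> (\<int> :: complex set)"
  proof
    assume "e - (e - 1/2) \<in> \<int>"
    then obtain k :: int where "1 / 2 = (of_int k :: complex)" by (auto elim: Ints_cases)
    then have "of_int 1 = (of_int (2 * k) :: complex)" by (simp add: field_simps)
    then show False unfolding of_int_eq_iff by presburger
  qed
  show ?thesis
  proof
    assume hol: "holomorphic_on_K\<^sub>1 n q r (pullback n q l f0)"
    show "of_nat l + e * of_nat q \<in> \<nat>"
    proof (rule K\<^sub>1_exponent[OF q r hol, where f = "\<lambda>z. exp (s * Ln (1 - z)) * R z" and ?C1.0 = "(-1) ^ N" and ?C2.0 = 0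
          and ?G1.0 = G and ?G2.0 = "\<lambda>_. 0"])
      show "(\<lambda>z. exp (s * Ln (1 - z)) * R z) holomorphic_on slit"
        by (intro holomorphic_intros R) (auto simp: slit_alt)
      show "exp (s * Ln (1 - z)) * R z = f0 z" if "z \<in> ball 0 1" for z using f0[OF that] by (simp add: R_def)
      show "e - (e - 1/2) \<notin> (\<int> :: complex set)" by (rule half)
      fix z :: complex assume z: "norm z > 1" "Re z < 0"
      then have z0: "z \<noteq> 0" by auto
      have "z ^ N = (-1) ^ N * exp (of_nat N * Ln (- z))"
        using z0 by (simp add: exp_of_nat_mult power_mult_distrib[symmetric])
      then have "exp (s * Ln (1 - z)) * R z =
          (-1) ^ N * (exp (s * Ln (- z)) * exp (of_nat N * Ln (- z))) * G (1 / z)"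
        unfolding R_def reflect_polynomial[OF z0] Ln_one_minus_split[OF z(2,1)] G_def
        by (simp add: distrib_left exp_add mult_ac)
      also have "exp (s * Ln (- z)) * exp (of_nat N * Ln (- z)) = exp (- e * Ln (- z))"
        by (simp add: e exp_add[symmetric] algebra_simps)
      finally show "exp (s * Ln (1 - z)) * R z = (-1) ^ N * (exp (- e * Ln (- z)) * G (1 / z)) + 0 * (exp (- (e - 1/2) * Ln (- z)) * 0)"
        by (simp add: mult.assoc)
    qed (use G G0 in auto)
  next
    assume nat: "of_nat l + e * of_nat q \<in> \<nat>"
    show "holomorphic_on_K\<^sub>1 n q r (pullback n q l f0)"
    proof (rule holomorphic_on_K\<^sub>1I[OF local_system_elem[OF R] q, where a = e and b = e and ?G1.0 = G and ?G2.0 = G])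
      fix z :: complex assume z: "z \<noteq> 0" "norm z < 1"
      show "elem_germ s R z f0" unfolding elem_germ_def
      proof (intro exI[of _ 1] exI[of _ "\<lambda>z. Ln (1 - z)"] conjI)
        have "z \<in> slit" using z disc_subset_slit by auto
        then show "isCont (\<lambda>z. Ln (1 - z)) z" by (intro DERIV_isCont[OF has_derivative_Ln_one_minus])
        have "\<forall>\<^sub>F w in nhds z. w \<in> ball 0 1" using z by (intro eventually_nhds_in_open) auto
        then show "\<forall>\<^sub>F w in nhds z. exp (Ln (1 - w)) = 1 - w \<and> f0 w = 1 * (exp (s * Ln (1 - w)) * R w)"
        proof eventually_elim
          case (elim w)
          then have "1 - w \<noteq> 0" by auto
          then show ?case using f0[OF elim] by (simp add: R_def)
        qed
      qed
    next
      fix z y assume z: "norm z > 1" and y: "elem_germ s R z y"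
      have z0: "z \<noteq> 0" using z by auto
      obtain C \<Lambda> where \<Lambda>: "isCont \<Lambda> z"
        "\<forall>\<^sub>F w in nhds z. exp (\<Lambda> w) = 1 - w \<and> y w = C * (exp (s * \<Lambda> w) * R w)"
        using y unfolding elem_germ_def by blast
      define M where "M w = Ln (w / z) + Ln z" for w
      have posz: "Re (z / z) > 0" using z0 by simp
      have contM: "isCont M z" unfolding M_def[abs_def] by (rule DERIV_isCont[OF has_derivative_Ln_quotient(1)[OF z0 posz]])
      have evM: "\<forall>\<^sub>F w in nhds z. exp (M w) = w"
      proof -
        have "open {w. Re (w * inverse z) > 0}" by (intro open_Collect_less continuous_intros)
        then have "\<forall>\<^sub>F w in nhds z. w \<in> {w. Re (w * inverse z) > 0}"
          by (rule eventually_nhds_in_open) (use z0 in \<open>simp only: mem_Collect_eq right_inverse one_complex.sel, simp\<close>)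
        then show ?thesis
          by eventually_elim (use has_derivative_Ln_quotient(2)[OF z0] in \<open>simp add: M_def divide_inverse\<close>)
      qed
      have inv: "1 / w \<in> slit" "w \<noteq> 0" if "norm w > 1" for w :: complex
        using that disc_subset_slit by (auto simp: norm_divide divide_less_eq subset_iff)
      have evz: "\<forall>\<^sub>F w in nhds z. norm w > 1"
      proof -
        have "open {w::complex. norm w > 1}" by (intro open_Collect_less continuous_intros)
        from eventually_nhds_in_open[OF this, of z] z show ?thesis by simp
      qed
      \<comment> \<open>a logarithm of \<open>(1 - w) / (w (1 - 1/w)) = -1\<close>\<close>
      define D where "D w = \<Lambda> w - M w - Ln (1 - 1 / w)" for w
      have "isCont (\<lambda>w. Ln (1 - 1 / w)) z"
        by (intro continuous_intros) (use inv[OF z] in \<open>auto simp: slit_alt\<close>)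
      then have contD: "isCont D z" unfolding D_def[abs_def] by (intro continuous_diff \<Lambda>(1) contM)
      have "\<forall>\<^sub>F w in nhds z. exp (D w) = - 1" using \<Lambda>(2) evM evz
      proof eventually_elim
        case (elim w)
        have "1 - 1 / w \<noteq> 0" using inv[OF elim(3)] one_not_in_slit by auto
        then have "exp (D w) = (1 - w) / w / (1 - 1 / w)" using elim by (simp add: D_def exp_diff)
        also have "\<dots> = - 1" using inv[OF elim(3)] \<open>1 - 1 / w \<noteq> 0\<close> by (simp add: field_simps)
        finally show ?case .
      qed
      then have evD: "\<forall>\<^sub>F w in nhds z. D w = D z" by (rule logs_differ_by_constant[OF contD])
      have ev: "\<forall>\<^sub>F w in nhds z. exp (M w) = w \<and>
          y w = C * exp (s * D z) * (exp (- e * M w) * G (1 / w)) + 0 * (exp (- e * M w) * G (1 / w))"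
        using evD evM evz \<Lambda>(2)
      proof eventually_elim
        case (elim w)
        have "exp (s * \<Lambda> w) = exp (s * D z) * (exp (s * M w) * exp (s * Ln (1 - 1 / w)))"
          unfolding elim(1)[symmetric] by (simp add: D_def exp_add[symmetric] algebra_simps)
        moreover have "R w = exp (of_nat N * M w) * (\<Sum>i\<le>N. \<rho> i * (1 / w) ^ (N - i))"
          unfolding R_def reflect_polynomial[OF inv(2)[OF elim(3)]] exp_of_nat_mult elim(2) ..
        moreover have "exp (s * M w) * exp (of_nat N * M w) = exp (- e * M w)"
          by (simp add: e exp_add[symmetric] algebra_simps)
        ultimately have "exp (s * \<Lambda> w) * R w = exp (s * D z) * (exp (- e * M w) * G (1 / w))"
          unfolding G_def by (metis (no_types, lifting) mult.assoc mult.left_commute)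
        then show ?case using elim by simp
      qed
      show "\<exists>k1 k2 \<Lambda>. isCont \<Lambda> z \<and> (\<forall>\<^sub>F w in nhds z. exp (\<Lambda> w) = w \<and>
          y w = k1 * (exp (- e * \<Lambda> w) * G (1 / w)) + k2 * (exp (- e * \<Lambda> w) * G (1 / w))) \<and>
        (k1 = 0 \<or> of_nat l + e * of_nat q \<in> \<nat>) \<and> (k2 = 0 \<or> of_nat l + e * of_nat q \<in> \<nat>)"
        using contM ev nat by blast
    qed (use G in auto)
  qed
qed

section \<open>The five cases\<close>

text \<open>
  The condition \<open>a - b \<notin> \<int>\<close> excludes \<open>b\<close> from the integers, so the polynomial has exact degree \<open>- a\<close>.
\<close>

lemma polynomial_case:
  assumes q: "q > 0" and r: "r > 0" and c: "c \<notin> \<int>" and ab: "a - b \<notin> \<int>" and a: "a \<in> \<int>\<^sub>\<le>\<^sub>0"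
  shows "holomorphic_on_K\<^sub>1 n q r (pullback n q l (gauss_F a b c)) \<longleftrightarrow> of_nat l + a * of_nat q \<in> \<nat>"
    and "holomorphic_on_K\<^sub>2 n q r (pullback n q l (gauss_F a b c))"
proof -
  obtain N where N: "a = - of_nat N"
    "\<And>z. gauss_F a b c z = (\<Sum>i\<le>N. fps_nth (gauss_fps a b c) i * z ^ i)"
    using gauss_F_polynomial[OF a] by metis
  have "b \<notin> \<int>"
  proof
    assume "b \<in> \<int>"
    then have "a - b \<in> \<int>" unfolding N by (intro Ints_diff Ints_minus Ints_of_nat)
    with ab show False by simp
  qed
  then have nz: "fps_nth (gauss_fps a b c) N \<noteq> 0"
    using pochhammer_nonzero[OF Ints_minus_nonpos[OF c]] pochhammer_nonzero[OF Ints_minus_nonpos[of b]]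
    by (simp add: gauss_fps_def N(1) pochhammer_eq_0_ge)
  show "holomorphic_on_K\<^sub>1 n q r (pullback n q l (gauss_F a b c)) \<longleftrightarrow> of_nat l + a * of_nat q \<in> \<nat>"
  proof (rule elementary_K\<^sub>1_iff[where s = 0 and \<rho> = "fps_nth (gauss_fps a b c)" and N = N, OF q r _ nz])
    show "gauss_F a b c z = exp (0 * Ln (1 - z)) * (\<Sum>i\<le>N. fps_nth (gauss_fps a b c) i * z ^ i)" for z
      using N(2) by simp
    show "a = - (0 + of_nat N)" using N(1) by simp
  qed
  have "gauss_F a b c holomorphic_on UNIV"
    unfolding N(2)[abs_def] by (intro holomorphic_intros)
  then show "holomorphic_on_K\<^sub>2 n q r (pullback n q l (gauss_F a b c))"
    by (rule holomorphic_on_K\<^sub>2I[OF q])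
qed

text \<open>
  By Euler's transformation \<open>f\<close> is \<open>(1 - z)\<^bsup>c-a-b\<^esup>\<close> times a polynomial of degree \<open>a - c\<close>, and
  \<open>- (c - a - b + (a - c)) = b\<close>.
\<close>

lemma euler_case:
  assumes q: "q > 0" and r: "r > 0" and c: "c \<notin> \<int>" and ab: "a - b \<notin> \<int>"
    and ca: "c - a \<in> \<int>\<^sub>\<le>\<^sub>0"
  shows "holomorphic_on_K\<^sub>1 n q r (pullback n q l (gauss_F a b c)) \<longleftrightarrow> of_nat l + b * of_nat q \<in> \<nat>"
proof -
  obtain N where N: "c - a = - of_nat N"
    "\<And>z. gauss_F (c - a) (c - b) c z = (\<Sum>i\<le>N. fps_nth (gauss_fps (c - a) (c - b) c) i * z ^ i)"
    using gauss_F_polynomial[OF ca] by metis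
  have "c - b \<notin> \<int>"
  proof
    assume "c - b \<in> \<int>"
    then have "(c - b) - (c - a) \<in> \<int>" unfolding N(1) by (rule Ints_diff) simp
    with ab show False by simp
  qed
  then have "c - b \<notin> \<int>\<^sub>\<le>\<^sub>0" by (rule Ints_minus_nonpos)
  then have nz: "fps_nth (gauss_fps (c - a) (c - b) c) N \<noteq> 0"
    using pochhammer_nonzero[OF Ints_minus_nonpos[OF c], of N] pochhammer_nonzero[of "c - b" N]
    unfolding gauss_fps_def N(1) fps_nth_Abs_fps by (simp only: divide_eq_0_iff mult_eq_0_iff pochhammer_eq_0_ge fact_nonzero) simp
  show ?thesis
  proof (rule elementary_K\<^sub>1_iff[where s = "c - a - b" and \<rho> = "fps_nth (gauss_fps (c - a) (c - b) c)" and N = N, OF q r _ nz])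
    fix z :: complex assume z: "z \<in> ball 0 1"
    have c': "c \<notin> \<int>\<^sub>\<le>\<^sub>0" using c by (rule Ints_minus_nonpos)
    obtain f where f: "hg_sol a b c f slit" "\<And>z. z \<in> ball 0 1 \<Longrightarrow> f z = gauss_F a b c z"
      using gauss_continuation[OF c'] by metis
    have "f 0 = 1" using f(2)[of 0] by simp
    from gauss_euler[OF c' f(1) this z]
    have E: "exp (- (c - a - b) * Ln (1 - z)) * gauss_F a b c z = gauss_F (c - a) (c - b) c z"
      using f(2)[OF z] by simp
    have "exp ((c - a - b) * Ln (1 - z)) * exp (- (c - a - b) * Ln (1 - z)) = 1"
      by (simp add: exp_add[symmetric] algebra_simps)
    then show "gauss_F a b c z = exp ((c - a - b) * Ln (1 - z)) * (\<Sum>i\<le>N. fps_nth (gauss_fps (c - a) (c - b) c) i * z ^ i)"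
      unfolding N(2)[symmetric] E[symmetric] by (metis mult.assoc mult.left_neutral)
  next
    show "b = - (c - a - b + of_nat N)" using N(1) by (simp add: algebra_simps)
  qed
qed

lemma ramified_case:
  assumes q: "q > 0" and c: "c \<notin> \<int>" and s: "c - a - b \<notin> \<int>" and ab: "a - b \<notin> \<int>"
    and nonpoly: "a \<notin> \<int>\<^sub>\<le>\<^sub>0" "b \<notin> \<int>\<^sub>\<le>\<^sub>0"
  shows "ramified_around_K\<^sub>2 n q r (pullback n q l (gauss_F a b c))"
proof (rule gauss_connection[OF c s ab])
  fix f A B C\<^sub>1 C\<^sub>2
  assume f: "hg_sol a b c f slit" "\<And>z. z \<in> ball 0 1 \<Longrightarrow> f z = gauss_F a b c z"
    and near: "\<And>z. z \<in> slit \<inter> ball 1 1 \<Longrightarrow>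
      f z = A * one_sol a b c z + B * (exp ((c - a - b) * Ln (1 - z)) * one_sol' a b c z)"
    and B: "a \<notin> \<int>\<^sub>\<le>\<^sub>0 \<Longrightarrow> b \<notin> \<int>\<^sub>\<le>\<^sub>0 \<Longrightarrow> B \<noteq> 0"
  show ?thesis
  proof (rule ramified_around_K\<^sub>2I[OF q s B[OF nonpoly]])
    show "(\<lambda>z. A * one_sol a b c z) holomorphic_on ball 1 1"
      by (intro holomorphic_intros one_sol_holomorphic[OF s])
    show "one_sol' a b c holomorphic_on ball 1 1" by (rule one_sol_holomorphic[OF s])
    show "gauss_F a b c holomorphic_on ball 0 1"
      by (rule gauss_F_holomorphic[OF Ints_minus_nonpos[OF c]])
    show "gauss_F a b c z = A * one_sol a b c z + B * (exp ((c - a - b) * Ln (1 - z)) * one_sol' a b c z)"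
      if "z \<in> ball 0 1" "z \<in> ball 1 1" for z
      using near[of z] f(2)[of z] that disc_subset_slit by auto
  qed simp
qed

text \<open>
  Both exponents at infinity occur in \<open>f\<close>, so an extension forces both conditions. Conversely, under both conditions
  every solution of the Gauss equation near infinity gives a function that extends.
\<close>

lemma generic_case:
  assumes q: "q > 0" and r: "r > 0" and c: "c \<notin> \<int>" and s: "c - a - b \<notin> \<int>" and ab: "a - b \<notin> \<int>"
    and gen: "a \<notin> \<int>\<^sub>\<le>\<^sub>0" "b \<notin> \<int>\<^sub>\<le>\<^sub>0" "c - a \<notin> \<int>\<^sub>\<le>\<^sub>0" "c - b \<notin> \<int>\<^sub>\<le>\<^sub>0"
  shows "holomorphic_on_K\<^sub>1 n q r (pullback n q l (gauss_F a b c)) \<longleftrightarrow>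
    of_nat l + a * of_nat q \<in> \<nat> \<and> of_nat l + b * of_nat q \<in> \<nat>"
proof
  define G where "G a b = gauss_F a (a - c + 1) (a - b + 1)" for a b
  have ba: "b - a \<notin> \<int>" using ab by (metis Ints_minus minus_diff_eq)
  have "u + 1 \<notin> \<int>" if "u \<notin> \<int>" for u :: complex
    using that by (metis Ints_1 Ints_diff add_diff_cancel_right')
  then have G: "G a b holomorphic_on ball 0 1" "G b a holomorphic_on ball 0 1"
    unfolding G_def using ab ba by (auto intro!: gauss_F_holomorphic Ints_minus_nonpos)
  have G0: "G a b 0 \<noteq> 0" "G b a 0 \<noteq> 0" by (simp_all add: G_def)
  have sol: "inf_sol a b c \<Lambda> z = exp (- a * \<Lambda> z) * G a b (1 / z)" "inf_sol b a c \<Lambda> z = exp (- b * \<Lambda> z) * G b a (1 / z)" for \<Lambda> z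
    by (simp_all add: inf_sol_def G_def)
  {
    assume hol: "holomorphic_on_K\<^sub>1 n q r (pullback n q l (gauss_F a b c))"
    show "of_nat l + a * of_nat q \<in> \<nat> \<and> of_nat l + b * of_nat q \<in> \<nat>"
    proof (rule gauss_connection[OF c s ab])
      fix f A B C\<^sub>1 C\<^sub>2
      assume f: "hg_sol a b c f slit" "\<And>z. z \<in> ball 0 1 \<Longrightarrow> f z = gauss_F a b c z"
        and inf: "\<And>z. z \<in> cut_inf \<Longrightarrow>
          f z = C\<^sub>1 * inf_sol a b c (\<lambda>z. Ln (- z)) z + C\<^sub>2 * inf_sol b a c (\<lambda>z. Ln (- z)) z"
        and "a \<notin> \<int>\<^sub>\<le>\<^sub>0 \<Longrightarrow> b \<notin> \<int>\<^sub>\<le>\<^sub>0 \<Longrightarrow> c - a \<notin> \<int>\<^sub>\<le>\<^sub>0 \<Longrightarrow> c - b \<notin> \<int>\<^sub>\<le>\<^sub>0 \<Longrightarrow> C\<^sub>1 \<noteq> 0 \<and> C\<^sub>2 \<noteq> 0"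
      then have C: "C\<^sub>1 \<noteq> 0" "C\<^sub>2 \<noteq> 0" using gen by auto
      have inf': "f z = C\<^sub>1 * (exp (- a * Ln (- z)) * G a b (1 / z)) + C\<^sub>2 * (exp (- b * Ln (- z)) * G b a (1 / z))"
        if "norm z > 1" "Re z < 0" for z
        using inf[of z] that unfolding sol by (simp add: cut_inf_def slit_def)
      have inf'': "f z = C\<^sub>2 * (exp (- b * Ln (- z)) * G b a (1 / z)) + C\<^sub>1 * (exp (- a * Ln (- z)) * G a b (1 / z))"
        if "norm z > 1" "Re z < 0" for z
        using inf'[OF that] by simp
      show ?thesis
        using K\<^sub>1_exponent[OF q r hol hg_sol_holo[OF f(1)] f(2) inf' G G0(1) ab C(1)]
          K\<^sub>1_exponent[OF q r hol hg_sol_holo[OF f(1)] f(2) inf'' G(2,1) G0(2) ba C(2)] by simp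
    qed
  }
  assume nat: "of_nat l + a * of_nat q \<in> (\<nat>::complex set) \<and> of_nat l + b * of_nat q \<in> (\<nat>::complex set)"
  show "holomorphic_on_K\<^sub>1 n q r (pullback n q l (gauss_F a b c))"
  proof (rule holomorphic_on_K\<^sub>1I[OF local_system_hg q _ G])
    show "hg_germ a b c z (gauss_F a b c)" if "z \<noteq> 0" "norm z < 1" for z
      by (rule hg_germI[OF gauss_hg_sol[OF Ints_minus_nonpos[OF c]]]) (use that in auto)
    fix z y assume "norm z > 1" "hg_germ a b c z y"
    from hg_germ_at_infinity[OF ab this]
    show "\<exists>k1 k2 \<Lambda>. isCont \<Lambda> z \<and> (\<forall>\<^sub>F w in nhds z. exp (\<Lambda> w) = w \<and>
        y w = k1 * (exp (- a * \<Lambda> w) * G a b (1 / w)) + k2 * (exp (- b * \<Lambda> w) * G b a (1 / w))) \<and>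
      (k1 = 0 \<or> of_nat l + a * of_nat q \<in> \<nat>) \<and> (k2 = 0 \<or> of_nat l + b * of_nat q \<in> \<nat>)"
      unfolding sol using nat by blast
  qed
qed

theorem corollary2p3:
  fixes m n p q l :: nat and \<gamma> A B \<alpha> a b c :: complex and r :: real
    and U :: "complex \<times> complex \<Rightarrow> complex"
  assumes q: "int q = int m - int p + 2" "q > 0"
    and \<alpha>: "\<alpha> * (\<alpha> - A + 1) = - B"
    and a: "a = - (\<alpha> + of_nat l) / of_nat q"
    and b: "b = (1 + \<alpha> - A - of_nat l) / of_nat q"
    and c: "c = (of_nat n + \<gamma> + 1) / of_nat (n + 2)"
    and \<gamma>: "\<gamma> \<notin> \<int>\<^sub>\<le>\<^sub>0 - {0}"
    and nonint: "c \<notin> \<int>" "c - a - b \<notin> \<int>" "a - b \<notin> \<int>"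
    and r: "r > 0"
    and U: "U = U_sol n q l a b c"
  shows "solves_cauchy_problem m n p \<gamma> A B l (initial_region n q) U \<and>
    (a \<in> \<int>\<^sub>\<le>\<^sub>0 \<longrightarrow>
      (holomorphic_on_K\<^sub>1 n q r U \<longleftrightarrow> of_nat l + a * of_nat q \<in> \<nat>) \<and>
      holomorphic_on_K\<^sub>2 n q r U) \<and>
    (b \<in> \<int>\<^sub>\<le>\<^sub>0 \<longrightarrow>
      (holomorphic_on_K\<^sub>1 n q r U \<longleftrightarrow> of_nat l + b * of_nat q \<in> \<nat>) \<and>
      holomorphic_on_K\<^sub>2 n q r U) \<and>
    (c - a \<in> \<int>\<^sub>\<le>\<^sub>0 \<longrightarrow>
      (holomorphic_on_K\<^sub>1 n q r U \<longleftrightarrow> of_nat l + b * of_nat q \<in> \<nat>) \<and>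
      ramified_around_K\<^sub>2 n q r U) \<and>
    (c - b \<in> \<int>\<^sub>\<le>\<^sub>0 \<longrightarrow>
      (holomorphic_on_K\<^sub>1 n q r U \<longleftrightarrow> of_nat l + a * of_nat q \<in> \<nat>) \<and>
      ramified_around_K\<^sub>2 n q r U) \<and>
    (a \<notin> \<int>\<^sub>\<le>\<^sub>0 \<and> b \<notin> \<int>\<^sub>\<le>\<^sub>0 \<and> c - a \<notin> \<int>\<^sub>\<le>\<^sub>0 \<and> c - b \<notin> \<int>\<^sub>\<le>\<^sub>0 \<longrightarrow>
      (holomorphic_on_K\<^sub>1 n q r U \<longleftrightarrow> - \<alpha> \<in> \<nat> \<and> 1 + \<alpha> - A \<in> \<nat>) \<and>
      ramified_around_K\<^sub>2 n q r U)"
proof -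
  have c': "c \<notin> \<int>\<^sub>\<le>\<^sub>0" using nonint(1) by (rule Ints_minus_nonpos)
  have ba: "b - a \<notin> \<int>" using nonint(3) by (metis Ints_minus minus_diff_eq)
  have s': "c - b - a \<notin> \<int>" using nonint(2) by (simp add: algebra_simps)
  have Ua: "U = pullback n q l (gauss_F a b c)" and Ub: "U = pullback n q l (gauss_F b a c)"
    by (simp_all add: U U_sol_pullback gauss_F_commute[of b])
  have np1: "a \<notin> \<int>\<^sub>\<le>\<^sub>0" "b \<notin> \<int>\<^sub>\<le>\<^sub>0" if "c - a \<in> \<int>"
  proof -
    show "a \<notin> \<int>\<^sub>\<le>\<^sub>0"
      using nonint(1) Ints_add[OF that] nonpos_Ints_Int[of a] by auto
    show "b \<notin> \<int>\<^sub>\<le>\<^sub>0"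
      using nonint(2) Ints_diff[OF that] nonpos_Ints_Int[of b] by auto
  qed
  have np2: "a \<notin> \<int>\<^sub>\<le>\<^sub>0" "b \<notin> \<int>\<^sub>\<le>\<^sub>0" if "c - b \<in> \<int>"
  proof -
    show "b \<notin> \<int>\<^sub>\<le>\<^sub>0"
      using nonint(1) Ints_add[OF that] nonpos_Ints_Int[of b] by auto
    show "a \<notin> \<int>\<^sub>\<le>\<^sub>0"
      using s' Ints_diff[OF that] nonpos_Ints_Int[of a] by auto
  qed
  have ram: "a \<notin> \<int>\<^sub>\<le>\<^sub>0 \<Longrightarrow> b \<notin> \<int>\<^sub>\<le>\<^sub>0 \<Longrightarrow> ramified_around_K\<^sub>2 n q r U"
    unfolding Ua by (rule ramified_case[OF q(2) nonint])
  have exps: "of_nat l + a * of_nat q = - \<alpha>" "of_nat l + b * of_nat q = 1 + \<alpha> - A"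
    using q(2) by (simp_all add: a b)
  show ?thesis
  proof (intro conjI impI)
    show "solves_cauchy_problem m n p \<gamma> A B l (initial_region n q) U"
      unfolding U by (rule U_sol_solves[OF q \<alpha> a b c c'])
  next
    assume "a \<in> \<int>\<^sub>\<le>\<^sub>0"
    from polynomial_case[OF q(2) r nonint(1,3) this]
    show "holomorphic_on_K\<^sub>1 n q r U \<longleftrightarrow> of_nat l + a * of_nat q \<in> \<nat>" "holomorphic_on_K\<^sub>2 n q r U"
      unfolding Ua .
  next
    assume "b \<in> \<int>\<^sub>\<le>\<^sub>0"
    from polynomial_case[OF q(2) r nonint(1) ba this]
    show "holomorphic_on_K\<^sub>1 n q r U \<longleftrightarrow> of_nat l + b * of_nat q \<in> \<nat>" "holomorphic_on_K\<^sub>2 n q r U"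
      unfolding Ub .
  next
    assume ca: "c - a \<in> \<int>\<^sub>\<le>\<^sub>0"
    show "holomorphic_on_K\<^sub>1 n q r U \<longleftrightarrow> of_nat l + b * of_nat q \<in> \<nat>"
      unfolding Ua by (rule euler_case[OF q(2) r nonint(1,3) ca])
    show "ramified_around_K\<^sub>2 n q r U" using np1 ram ca nonpos_Ints_Int by blast
  next
    assume cb: "c - b \<in> \<int>\<^sub>\<le>\<^sub>0"
    show "holomorphic_on_K\<^sub>1 n q r U \<longleftrightarrow> of_nat l + a * of_nat q \<in> \<nat>"
      unfolding Ub by (rule euler_case[OF q(2) r nonint(1) ba cb])
    show "ramified_around_K\<^sub>2 n q r U" using np2 ram cb nonpos_Ints_Int by blast
  next
    assume gen: "a \<notin> \<int>\<^sub>\<le>\<^sub>0 \<and> b \<notin> \<int>\<^sub>\<le>\<^sub>0 \<and> c - a \<notin> \<int>\<^sub>\<le>\<^sub>0 \<and> c - b \<notin> \<int>\<^sub>\<le>\<^sub>0"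
    then show "holomorphic_on_K\<^sub>1 n q r U \<longleftrightarrow> - \<alpha> \<in> \<nat> \<and> 1 + \<alpha> - A \<in> \<nat>"
      unfolding Ua exps[symmetric] by (intro generic_case q r nonint) auto
    show "ramified_around_K\<^sub>2 n q r U" using gen ram by blast
  qed
qed

end
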